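(* Let $\mathfrak{g}$ and $\lambda\in\mathbb{C}$ be as in one of the following three cases: (i) $\mathfrak{g}=\mathfrak{so}(n,\mathbb{C})$ with $n\geq5$ and $\lambda\neq-\frac{n-4}{4(n-1)(n-2)}$; (ii) $\mathfrak{g}=\mathfrak{sp}(2n,\mathbb{C})$ with $n\geq2$ and $\lambda\neq-\frac{1}{16(n+1)}$; (iii) $\mathfrak{g}=\mathfrak{sl}(n,\mathbb{C})$ with $n\geq3$ and $\lambda\neq-\frac{1}{8(n+1)}$. Then the ideal $\bar I_\lambda$ of $\mathfrak{U}(\mathfrak{g})$ coincides with $\mathfrak{U}(\mathfrak{g})$ if $\lambda\neq0$, whilst $\bar I_0=\mathfrak{U}_+(\mathfrak{g})\subset\mathfrak{U}(\mathfrak{g})$, the unique maximal ideal consisting of elements without constant part.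
   Context: $\mathfrak{sp}(2n,\mathbb{C})$ is the Lie algebra of endomorphisms of $\mathbb{C}^{2n}$ preserving a non-degenerate skew form. For a complex simple Lie algebra $\mathfrak{g}$, $\bigotimes\mathfrak{g}=\bigoplus_{s\ge0}\bigotimes^s\mathfrak{g}$ is the full (unital, associative) tensor algebra over $\mathbb{C}$. The Cartan product $\mathfrak{g}\circledcirc\mathfrak{g}\subset\mathfrak{g}\otimes\mathfrak{g}$ is the unique irreducible component of $\mathfrak{g}\otimes\mathfrak{g}$ whose highest weight is twice the highest weight of $\mathfrak{g}$ (the adjoint representation), and $X\otimes Y\mapsto X\circledcirc Y\in\mathfrak{g}\circledcirc\mathfrak{g}\subset\mathfrak{g}\otimes\mathfrak{g}$ denotes the $\mathfrak{g}$-invariant projection onto it. $[X,Y]$ is the Lie bracket and $\langle X,Y\rangle=\mathrm{tr}(\mathrm{ad}_X\,\mathrm{ad}_Y)$ is the Killing form. For $\lambda\in\mathbb{C}$, $I_\lambda$ is the two-sided ideal of $\bigotimes\mathfrak{g}$ generated by all elements $X\otimes Y-X\circledcirc Y-\frac12[X,Y]-\lambda\langle X,Y\rangle\in\bigotimes^2\mathfrak{g}\oplus\mathfrak{g}\oplus\mathbb{C}$ with $X,Y\in\mathfrak{g}$. The universal enveloping algebra $\mathfrak{U}(\mathfrak{g})$ is the quotient of $\bigotimes\mathfrak{g}$ by the two-sided ideal generated by the elements $X\otimes Y-Y\otimes X-[X,Y]$ (which all lie in $I_\lambda$), and $\bar I_\lambda$ is the image of $I_\lambda$ in $\mathfrak{U}(\mathfrak{g})$.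 $\mathfrak{U}_+(\mathfrak{g})$, the ideal of elements without constant part, is by definition the image in $\mathfrak{U}(\mathfrak{g})$ of $\bigoplus_{s\geq1}\bigotimes^s\mathfrak{g}$. *)

theory Defs
  imports
    "HOL-Analysis.Analysis"
    "HOL-Library.Function_Algebras"
    "HOL-Algebra.QuotRing"
begin

section \<open>Matrix Lie algebras\<close>

definition cmat_scale :: "complex \<Rightarrow> complex^'m^'m \<Rightarrow> complex^'m^'m" where
  "cmat_scale c A = (\<chi> i j. c * A $ i $ j)"

global_interpretation cmat: vector_space "cmat_scale :: complex \<Rightarrow> complex^'m^'m \<Rightarrow> _"
  by unfold_locales (auto simp: cmat_scale_def vec_eq_iff algebra_simps)

definition bracket :: "complex^'m^'m \<Rightarrow> complex^'m^'m \<Rightarrow> complex^'m^'m" where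
  "bracket A B = A ** B - B ** A"

definition so_algebra :: "(complex^'m^'m) set" where
  "so_algebra = {A. transpose A = - A}"

text \<open>The endomorphisms preserving (infinitesimally) the bilinear form with Gram matrix \<open>J\<close>.\<close>

definition sp_algebra :: "complex^'m^'m \<Rightarrow> (complex^'m^'m) set" where
  "sp_algebra J = {A. transpose A ** J + J ** A = 0}"

definition nondegenerate_skew :: "complex^'m^'m \<Rightarrow> bool" where
  "nondegenerate_skew J \<longleftrightarrow> transpose J = - J \<and> invertible J"

definition sl_algebra :: "(complex^'m^'m) set" where
  "sl_algebra = {A. trace A = 0}"

text \<open>The trace of a linear endomorphism \<open>f\<close> of the subspace \<open>V\<close>, computed in some basis of \<open>V\<close>.\<close>

definition trace_on ::
  "(complex^'m^'m) set \<Rightarrow> (complex^'m^'m \<Rightarrow> complex^'m^'m) \<Rightarrow> complex" where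
  "trace_on V f =
    (let B = (SOME B. cmat.independent B \<and> cmat.span B = V)
     in \<Sum>b\<in>B. cmat.representation B (f b) b)"

definition killing ::
  "(complex^'m^'m) set \<Rightarrow> complex^'m^'m \<Rightarrow> complex^'m^'m \<Rightarrow> complex" where
  "killing g X Y = trace_on g (\<lambda>Z. bracket X (bracket Y Z))"


section \<open>Highest weights\<close>

text \<open>A Cartan subalgebra of a complex semisimple Lie algebra: a maximal commutative subalgebra
  all of whose elements act diagonalizably on \<open>g\<close>.\<close>

definition cartan_subalgebra :: "(complex^'m^'m) set \<Rightarrow> (complex^'m^'m) set \<Rightarrow> bool" where
  "cartan_subalgebra g h \<longleftrightarrow>
     h \<subseteq> g \<and> cmat.subspace h \<and>
     (\<forall>H\<in>h. \<forall>H'\<in>h. bracket H H' = 0) \<and>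
     (\<forall>X\<in>g. (\<forall>H\<in>h. bracket H X = 0) \<longrightarrow> X \<in> h) \<and>
     (\<forall>H\<in>h. cmat.span {X\<in>g. \<exists>c. bracket H X = cmat_scale c X} = g)"

text \<open>Weights are functions on all matrices of which only the values on \<open>h\<close> matter.\<close>

definition root_space ::
  "(complex^'m^'m) set \<Rightarrow> (complex^'m^'m) set \<Rightarrow> (complex^'m^'m \<Rightarrow> complex) \<Rightarrow> (complex^'m^'m) set"
where
  "root_space g h \<alpha> = {X\<in>g. \<forall>H\<in>h. bracket H X = cmat_scale (\<alpha> H) X}"

definition is_root ::
  "(complex^'m^'m) set \<Rightarrow> (complex^'m^'m) set \<Rightarrow> (complex^'m^'m \<Rightarrow> complex) \<Rightarrow> bool"
where
  "is_root g h \<alpha> \<longleftrightarrow> (\<exists>H\<in>h. \<alpha> H \<noteq> 0) \<and> root_space g h \<alpha> \<noteq> {0}"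

text \<open>A choice of positive roots is encoded by an element \<open>H0\<close> of \<open>h\<close> at which all roots take
  nonzero real values; the root \<open>\<alpha>\<close> is positive if \<open>\<alpha> H0 > 0\<close>.  Every positive system arises
  in this way.\<close>

definition positivity ::
  "(complex^'m^'m) set \<Rightarrow> (complex^'m^'m) set \<Rightarrow> complex^'m^'m \<Rightarrow> bool"
where
  "positivity g h H0 \<longleftrightarrow>
     H0 \<in> h \<and> (\<forall>\<alpha>. is_root g h \<alpha> \<longrightarrow> \<alpha> H0 \<in> \<real> \<and> \<alpha> H0 \<noteq> 0)"

text \<open>A representation of \<open>g\<close> on a subset \<open>V\<close> of a type is given by a scalar multiplication
  \<open>sc\<close> and an action \<open>act\<close>.\<close>

definition highest_weight ::
  "(complex^'m^'m) set \<Rightarrow> (complex^'m^'m) set \<Rightarrow> complex^'m^'m \<Rightarrow>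
   (complex \<Rightarrow> 'v \<Rightarrow> 'v) \<Rightarrow> (complex^'m^'m \<Rightarrow> 'v \<Rightarrow> 'v) \<Rightarrow> 'v::ab_group_add set \<Rightarrow>
   (complex^'m^'m \<Rightarrow> complex) \<Rightarrow> bool"
where
  "highest_weight g h H0 sc act V \<mu> \<longleftrightarrow>
     (\<exists>v\<in>V. v \<noteq> 0 \<and> (\<forall>H\<in>h. act H v = sc (\<mu> H) v) \<and>
       (\<forall>\<alpha>. is_root g h \<alpha> \<and> Re (\<alpha> H0) > 0 \<longrightarrow> (\<forall>X\<in>root_space g h \<alpha>. act X v = 0)))"

definition invariant_subspace ::
  "(complex^'m^'m) set \<Rightarrow> (complex \<Rightarrow> 'v \<Rightarrow> 'v) \<Rightarrow> (complex^'m^'m \<Rightarrow> 'v \<Rightarrow> 'v) \<Rightarrow>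
   'v::ab_group_add set \<Rightarrow> bool"
where
  "invariant_subspace g sc act V \<longleftrightarrow>
     module.subspace sc V \<and> (\<forall>X\<in>g. \<forall>v\<in>V. act X v \<in> V)"

definition irreducible_module ::
  "(complex^'m^'m) set \<Rightarrow> (complex \<Rightarrow> 'v \<Rightarrow> 'v) \<Rightarrow> (complex^'m^'m \<Rightarrow> 'v \<Rightarrow> 'v) \<Rightarrow>
   'v::ab_group_add set \<Rightarrow> bool"
where
  "irreducible_module g sc act V \<longleftrightarrow>
     invariant_subspace g sc act V \<and> V \<noteq> {0} \<and>
     (\<forall>W. W \<subseteq> V \<and> invariant_subspace g sc act W \<longrightarrow> W = {0} \<or> W = V)"


section \<open>The tensor algebra of a space of matrices\<close>

text \<open>With respect to the elementary matrices, a tensor in the \<open>s\<close>-th tensor power of the space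
  of all matrices is the family of its coordinates, indexed by the words of length \<open>s\<close> in pairs of
  indices; inhomogeneous tensors are functions on words of arbitrary length. As tensor products
  over a field preserve injections, the tensor algebra of a space \<open>g\<close> of matrices is the
  subalgebra (spanned by the products of elements of \<open>g\<close>) of the tensor algebra of the space
  of all matrices.\<close>

type_synonym 'm tensor = "('m \<times> 'm) list \<Rightarrow> complex"

definition tscale :: "complex \<Rightarrow> 'm tensor \<Rightarrow> 'm tensor" where
  "tscale c t = (\<lambda>w. c * t w)"

global_interpretation tens: vector_space "tscale :: complex \<Rightarrow> 'm tensor \<Rightarrow> _"
  by unfold_locales (auto simp: tscale_def fun_eq_iff algebra_simps)

definition tone :: "'m tensor" where
  "tone = (\<lambda>w. if w = [] then 1 else 0)"

definition tvec :: "complex^'m^'m \<Rightarrow> 'm tensor" where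
  "tvec A = (\<lambda>w. case w of [(i, j)] \<Rightarrow> A $ i $ j | _ \<Rightarrow> 0)"

definition tmult :: "'m tensor \<Rightarrow> 'm tensor \<Rightarrow> 'm tensor" (infixr \<open>\<otimes>\<^sub>t\<close> 70) where
  "s \<otimes>\<^sub>t t = (\<lambda>w. \<Sum>k\<le>length w. s (take k w) * t (drop k w))"

definition tpower :: "(complex^'m^'m) set \<Rightarrow> nat \<Rightarrow> 'm tensor set" where
  "tpower g s =
     tens.span {foldr tmult (map tvec Xs) tone | Xs. set Xs \<subseteq> g \<and> length Xs = s}"

definition tensors_ge :: "(complex^'m^'m) set \<Rightarrow> nat \<Rightarrow> 'm tensor set" where
  "tensors_ge g k = tens.span (\<Union>s\<in>{k..}. tpower g s)"

definition tensor_algebra :: "(complex^'m^'m) set \<Rightarrow> 'm tensor ring" where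
  "tensor_algebra g =
     \<lparr>carrier = tensors_ge g 0, mult = tmult, one = tone, zero = 0, add = (+)\<rparr>"

text \<open>The extension of the adjoint action to tensors as a derivation, in coordinates: the summand
  for \<open>k\<close> applies the commutator with \<open>X\<close> to the \<open>k\<close>-th tensor factor.\<close>

definition tact :: "complex^'m^'m \<Rightarrow> 'm tensor \<Rightarrow> 'm tensor" where
  "tact X t = (\<lambda>w. \<Sum>k<length w. case w ! k of (i, j) \<Rightarrow>
     (\<Sum>l\<in>UNIV. X $ i $ l * t (w[k := (l, j)]) - t (w[k := (i, l)]) * X $ l $ j))"

lemma tmult_tone [simp]: "tone \<otimes>\<^sub>t t = t" "t \<otimes>\<^sub>t tone = t"
proof -
  have "(\<Sum>k\<le>length w. tone (take k w) * t (drop k w)) = t w" for w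
  proof -
    have "(\<Sum>k\<le>length w. tone (take k w) * t (drop k w)) =
        (\<Sum>k\<in>{0}. tone (take k w) * t (drop k w))"
      by (rule sum.mono_neutral_right) (auto simp: tone_def)
    then show ?thesis by (simp add: tone_def)
  qed
  then show "tone \<otimes>\<^sub>t t = t" by (simp add: tmult_def)
  have "(\<Sum>k\<le>length w. t (take k w) * tone (drop k w)) = t w" for w
  proof -
    have "(\<Sum>k\<le>length w. t (take k w) * tone (drop k w)) =
        (\<Sum>k\<in>{length w}. t (take k w) * tone (drop k w))"
      by (rule sum.mono_neutral_right) (auto simp: tone_def)
    then show ?thesis by (simp add: tone_def)
  qed
  then show "t \<otimes>\<^sub>t tone = t" by (simp add: tmult_def)
qed

lemma tvec_eq_0: "length w \<noteq> 1 \<Longrightarrow> tvec A w = 0"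
  by (auto simp: tvec_def split: list.split)

lemma tmult_tvec_Cons: "(tvec A \<otimes>\<^sub>t t) ((i, j) # w) = A $ i $ j * t w"
proof -
  have "(\<Sum>k\<le>Suc (length w). tvec A (take k ((i, j) # w)) * t (drop k ((i, j) # w))) =
      (\<Sum>k\<in>{1}. tvec A (take k ((i, j) # w)) * t (drop k ((i, j) # w)))"
  proof (rule sum.mono_neutral_right)
    show "\<forall>k\<in>{..Suc (length w)} - {1}. tvec A (take k ((i, j) # w)) * t (drop k ((i, j) # w)) = 0"
    proof
      fix k assume k: "k \<in> {..Suc (length w)} - {1}"
      have "length (take k ((i, j) # w)) \<noteq> 1" using k by (auto simp: min_def)
      then have "tvec A (take k ((i, j) # w)) = 0"
        by (rule tvec_eq_0)
      then show "tvec A (take k ((i, j) # w)) * t (drop k ((i, j) # w)) = 0" by simp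
    qed
  qed auto
  then show ?thesis by (simp add: tmult_def tvec_def)
qed

lemma tmult_tvec_Nil: "(tvec A \<otimes>\<^sub>t t) [] = 0"
  by (simp add: tmult_def tvec_def)

lemma tmult_assoc: "(r \<otimes>\<^sub>t s) \<otimes>\<^sub>t t = r \<otimes>\<^sub>t (s \<otimes>\<^sub>t t)"
proof
  fix w :: "('a \<times> 'a) list"
  let ?n = "length w"
  let ?f = "\<lambda>i k. r (take i w) * s (take (k - i) (drop i w)) * t (drop k w)"
  have "((r \<otimes>\<^sub>t s) \<otimes>\<^sub>t t) w = (\<Sum>k\<le>?n. \<Sum>i\<le>k. ?f i k)"
    unfolding tmult_def sum_distrib_right
    by (intro sum.cong) (auto simp: min_def take_drop)
  also have "\<dots> = (\<Sum>(k, i)\<in>(SIGMA k:{..?n}. {..k}). ?f i k)"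
    by (simp add: sum.Sigma)
  also have "\<dots> = (\<Sum>(i, j)\<in>(SIGMA i:{..?n}. {..?n - i}). ?f i (i + j))"
    by (rule sum.reindex_bij_witness[of _ "\<lambda>(i, j). (i + j, i)" "\<lambda>(k, i). (i, k - i)"]) auto
  also have "\<dots> = (\<Sum>i\<le>?n. \<Sum>j\<le>?n - i. ?f i (i + j))"
    by (simp add: sum.Sigma)
  also have "\<dots> = (r \<otimes>\<^sub>t (s \<otimes>\<^sub>t t)) w"
    unfolding tmult_def sum_distrib_left
    by (intro sum.cong) (auto simp: mult.assoc add.commute)
  finally show "((r \<otimes>\<^sub>t s) \<otimes>\<^sub>t t) w = (r \<otimes>\<^sub>t (s \<otimes>\<^sub>t t)) w" .
qed

lemma tmult_linear:
  "(r + s) \<otimes>\<^sub>t t = r \<otimes>\<^sub>t t + s \<otimes>\<^sub>t t" "t \<otimes>\<^sub>t (r + s) = t \<otimes>\<^sub>t r + t \<otimes>\<^sub>t s"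
  "tscale c s \<otimes>\<^sub>t t = tscale c (s \<otimes>\<^sub>t t)" "t \<otimes>\<^sub>t tscale c s = tscale c (t \<otimes>\<^sub>t s)"
  "0 \<otimes>\<^sub>t t = 0" "t \<otimes>\<^sub>t 0 = 0"
  by (auto simp: tmult_def fun_eq_iff tscale_def algebra_simps sum.distrib sum_distrib_left)

lemma tensors_ge_eq:
  "tensors_ge g k =
     tens.span {foldr tmult (map tvec Xs) tone | Xs. set Xs \<subseteq> g \<and> k \<le> length Xs}"
  (is "_ = tens.span ?B")
proof
  have "tpower g s \<subseteq> tens.span ?B" if "k \<le> s" for s
    unfolding tpower_def by (rule tens.span_mono) (use that in auto)
  then show "tensors_ge g k \<subseteq> tens.span ?B"
    unfolding tensors_ge_def by (intro tens.span_minimal) auto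
  show "tens.span ?B \<subseteq> tensors_ge g k"
    unfolding tensors_ge_def tpower_def
    by (rule tens.span_mono) (auto intro!: tens.span_base)
qed

lemma foldr_tmult_append:
  "foldr tmult (map tvec (Xs @ Ys)) tone =
   foldr tmult (map tvec Xs) tone \<otimes>\<^sub>t foldr tmult (map tvec Ys) tone"
  by (induction Xs) (auto simp: tmult_assoc)

lemma tensors_ge_mult:
  assumes "s \<in> tensors_ge g k" "t \<in> tensors_ge g l"
  shows "s \<otimes>\<^sub>t t \<in> tensors_ge g (k + l)"
proof -
  let ?B = "\<lambda>k. {foldr tmult (map tvec Xs) tone | Xs. set Xs \<subseteq> g \<and> k \<le> length Xs}"
  have base: "a \<otimes>\<^sub>t b \<in> tens.span (?B (k + l))" if a: "a \<in> ?B k" and b: "b \<in> ?B l" for a b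
  proof -
    obtain Xs Ys where "a = foldr tmult (map tvec Xs) tone" "b = foldr tmult (map tvec Ys) tone"
      and XY: "set Xs \<subseteq> g" "set Ys \<subseteq> g" "k \<le> length Xs" "l \<le> length Ys"
      using a b by auto
    then have "a \<otimes>\<^sub>t b = foldr tmult (map tvec (Xs @ Ys)) tone"
      by (simp only: foldr_tmult_append)
    moreover have "set (Xs @ Ys) \<subseteq> g \<and> k + l \<le> length (Xs @ Ys)" using XY by auto
    ultimately show ?thesis by (intro tens.span_base) blast
  qed
  have left: "a \<otimes>\<^sub>t b \<in> tens.span (?B (k + l))" if a: "a \<in> ?B k" and b: "b \<in> tens.span (?B l)" for a b
    using b
  proof (induction rule: tens.span_induct_alt)
    case base then show ?case by (simp only: tmult_linear tens.span_zero)
  next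
    case (step c x y)
    show ?case
      unfolding tmult_linear by (rule tens.span_add[OF tens.span_scale[OF base[OF a step(1)]] step(2)])
  qed
  have t: "t \<in> tens.span (?B l)" using assms(2) by (simp only: tensors_ge_eq)
  have "s \<in> tens.span (?B k)" using assms(1) by (simp only: tensors_ge_eq)
  then have "s \<otimes>\<^sub>t t \<in> tens.span (?B (k + l))"
  proof (induction rule: tens.span_induct_alt)
    case base then show ?case by (simp only: tmult_linear tens.span_zero)
  next
    case (step c x y)
    show ?case
      unfolding tmult_linear by (rule tens.span_add[OF tens.span_scale[OF left[OF step(1) t]] step(2)])
  qed
  then show ?thesis by (simp add: tensors_ge_eq)
qed

lemma tone_in_tensors: "tone \<in> tensors_ge g 0"
  unfolding tensors_ge_eq by (rule tens.span_base) (auto intro!: exI[of _ "[]"])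

lemma ring_tensor_algebra: "ring (tensor_algebra g)"
proof (rule ringI)
  show "abelian_group (tensor_algebra g)"
  proof (rule abelian_groupI)
    show "\<exists>y\<in>carrier (tensor_algebra g). y \<oplus>\<^bsub>tensor_algebra g\<^esub> x = \<zero>\<^bsub>tensor_algebra g\<^esub>"
      if "x \<in> carrier (tensor_algebra g)" for x
      using that tens.span_neg[of x]
      by (auto simp: tensor_algebra_def tensors_ge_def intro!: bexI[of _ "- x"])
  qed (auto simp: tensor_algebra_def tensors_ge_def algebra_simps
        intro: tens.span_add tens.span_zero)
  show "Group.monoid (tensor_algebra g)"
    using tensors_ge_mult[of _ g 0 _ 0]
    by (intro monoidI) (auto simp: tensor_algebra_def tmult_assoc tone_in_tensors)
qed (auto simp: tensor_algebra_def tmult_linear)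

lemma tact_tvec: "tact X (tvec Y) = tvec (bracket X Y)"
proof
  fix w :: "('a \<times> 'a) list"
  show "tact X (tvec Y) w = tvec (bracket X Y) w"
  proof (cases "length w = 1")
    case True
    then obtain i j where "w = [(i, j)]" by (cases w) auto
    then show ?thesis
      by (simp add: tact_def tvec_def bracket_def matrix_matrix_mult_def sum_subtractf)
  next
    case False
    then have "tvec Z w' = 0" if "length w' = length w" for Z and w' :: "('a \<times> 'a) list"
      using that by (auto intro: tvec_eq_0)
    then show ?thesis by (auto simp: tact_def intro!: sum.neutral split: prod.split)
  qed
qed

lemma tact_tvec_tvec:
  "tact X (tvec Y \<otimes>\<^sub>t tvec Z) = tvec (bracket X Y) \<otimes>\<^sub>t tvec Z + tvec Y \<otimes>\<^sub>t tvec (bracket X Z)"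
proof
  fix w :: "('a \<times> 'a) list"
  have two: "(tvec A \<otimes>\<^sub>t tvec B) [(i, j), (k, l)] = A $ i $ j * B $ k $ l"
    for A B :: "complex^'a^'a" and i j k l
    by (simp add: tmult_tvec_Cons) (simp add: tvec_def)
  show "tact X (tvec Y \<otimes>\<^sub>t tvec Z) w =
    (tvec (bracket X Y) \<otimes>\<^sub>t tvec Z + tvec Y \<otimes>\<^sub>t tvec (bracket X Z)) w"
  proof (cases "length w = 2")
    case True
    then obtain i j k l where w: "w = [(i, j), (k, l)]"
      by (cases w) (auto simp: length_Suc_conv numeral_2_eq_2)
    show ?thesis
      by (simp add: w two tact_def bracket_def matrix_matrix_mult_def sum_subtractf lessThan_Suc
          sum_distrib_left sum_distrib_right algebra_simps)
  next
    case False
    have "(tvec A \<otimes>\<^sub>t tvec B) w' = 0" if "length w' = length w"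
      for A B :: "complex^'a^'a" and w' :: "('a \<times> 'a) list"
    proof (cases w')
      case Nil then show ?thesis by (simp add: tmult_tvec_Nil)
    next
      case (Cons a v)
      then have "length v \<noteq> 1" using that False by auto
      then have "tvec B v = 0" by (rule tvec_eq_0)
      then show ?thesis using Cons by (cases a) (simp add: tmult_tvec_Cons)
    qed
    then show ?thesis by (auto simp: tact_def intro!: sum.neutral split: prod.split)
  qed
qed


section \<open>The Cartan product\<close>

definition cartan_square ::
  "(complex^'m^'m) set \<Rightarrow> (complex^'m^'m) set \<Rightarrow> complex^'m^'m \<Rightarrow> 'm tensor set \<Rightarrow> bool"
where
  "cartan_square g h H0 C \<longleftrightarrow>
     C \<subseteq> tpower g 2 \<and> irreducible_module g tscale tact C \<and>
     (\<exists>\<theta>. highest_weight g h H0 cmat_scale bracket g \<theta> \<and>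
          highest_weight g h H0 tscale tact C (\<lambda>H. 2 * \<theta> H))"

text \<open>\<open>P\<close> is the invariant projection of the second tensor power of \<open>g\<close> onto the Cartan square;
  its values elsewhere are irrelevant.\<close>

definition cartan_projection ::
  "(complex^'m^'m) set \<Rightarrow> (complex^'m^'m) set \<Rightarrow> complex^'m^'m \<Rightarrow>
   ('m tensor \<Rightarrow> 'm tensor) \<Rightarrow> bool"
where
  "cartan_projection g h H0 P \<longleftrightarrow>
     (\<exists>C. cartan_square g h H0 C \<and> P ` tpower g 2 = C \<and> (\<forall>t\<in>C. P t = t)) \<and>
     (\<forall>s\<in>tpower g 2. \<forall>t\<in>tpower g 2. P (s + t) = P s + P t) \<and>
     (\<forall>c. \<forall>t\<in>tpower g 2. P (tscale c t) = tscale c (P t)) \<and>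
     (\<forall>X\<in>g. \<forall>t\<in>tpower g 2. P (tact X t) = tact X (P t))"


section \<open>The enveloping algebra and the ideals\<close>

definition I_ideal ::
  "(complex^'m^'m) set \<Rightarrow> ('m tensor \<Rightarrow> 'm tensor) \<Rightarrow> complex \<Rightarrow> 'm tensor set"
where
  "I_ideal g P lam = Idl\<^bsub>tensor_algebra g\<^esub>
     {tvec X \<otimes>\<^sub>t tvec Y - P (tvec X \<otimes>\<^sub>t tvec Y) - tscale (1/2) (tvec (bracket X Y))
        - tscale (lam * killing g X Y) tone | X Y. X \<in> g \<and> Y \<in> g}"

definition env_ideal :: "(complex^'m^'m) set \<Rightarrow> 'm tensor set" where
  "env_ideal g = Idl\<^bsub>tensor_algebra g\<^esub>
     {tvec X \<otimes>\<^sub>t tvec Y - tvec Y \<otimes>\<^sub>t tvec X - tvec (bracket X Y) | X Y. X \<in> g \<and> Y \<in> g}"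

definition env_algebra :: "(complex^'m^'m) set \<Rightarrow> 'm tensor set ring" where
  "env_algebra g = tensor_algebra g Quot env_ideal g"

definition env_proj :: "(complex^'m^'m) set \<Rightarrow> 'm tensor \<Rightarrow> 'm tensor set" where
  "env_proj g t = env_ideal g +>\<^bsub>tensor_algebra g\<^esub> t"

definition I_bar ::
  "(complex^'m^'m) set \<Rightarrow> ('m tensor \<Rightarrow> 'm tensor) \<Rightarrow> complex \<Rightarrow> 'm tensor set set"
where
  "I_bar g P lam = env_proj g ` I_ideal g P lam"

definition env_plus :: "(complex^'m^'m) set \<Rightarrow> 'm tensor set set" where
  "env_plus g = env_proj g ` tensors_ge g 1"

end

theory Submission
  imports
    Defs
    "HOL-Computational_Algebra.Fundamental_Theorem_Algebra"
begin

text \<open>Every tensor \<open>t\<close> in the kernel of the projection onto the Cartan square gives a congruence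
  \<open>t \<equiv> [t]/2 + \<lambda>\<langle>t\<rangle>\<close> modulo \<open>I\<^sub>\<lambda>\<close>. The Cartan square is irreducible and contains a vector of weight
  \<open>2\<theta>\<close>, so a submodule of the second tensor power in which this weight does not occur lies in the
  kernel. In terms of the standard representation \<open>V\<close>, these submodules include the antisymmetrizations
  in two upper or two lower indices for \<open>sl(V)\<close>, in one index of each factor of \<open>S\<^sup>2V \<otimes> S\<^sup>2V\<close> for
  \<open>sp(V)\<close>, and the antisymmetrizations in three indices and the contraction for \<open>so(V)\<close>. To see
  that \<open>2\<theta>\<close> is not a weight, the element \<open>H0\<close>, which only acts diagonalizably on \<open>g\<close>, is
  diagonalized on \<open>V\<close>, and the highest weight vector of \<open>g\<close> is located in terms of its eigenvalues.
  Reducing a suitable tensor of degree three in two ways then gives \<open>(\<lambda> - \<lambda>\<^sub>0) X \<in> I\<^sub>\<lambda>\<close> with \<open>\<lambda>\<^sub>0\<close> the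
  excluded value, hence \<open>g \<subseteq> I\<^sub>\<lambda>\<close>, and any pair with nonzero Killing form finally gives
  \<open>\<lambda> \<in> I\<^sub>\<lambda>\<close>.\<close>

section \<open>Eigenvectors of commuting operators\<close>

text \<open>The Cartan subalgebra, the positive system and, for sp, the form are arbitrary, so no
  computation can start from a standard torus. What is kept of the root system is the single
  operator \<open>bracket H0\<close>: its kernel in \<open>g\<close> is commutative, its eigenvalues
  on \<open>g\<close> are real, and its eigenvectors with positive eigenvalue annihilate the highest
  weight vector. The Cartan square is never determined either: invariance, irreducibility and one
  eigenvalue of \<open>H0\<close> are enough to force a projection to vanish. Each congruence
  compares two expressions with the same Cartan part, so it carries half brackets and
  \<open>lam\<close> times a value of the Killing form. Write N for \<open>CARD('m)\<close>. The
  Killing form is 2N times the trace form for sl and N - 2 \<open>eps\<close> times it for a form of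
  sign \<open>eps\<close>. The cubic overlaps then leave the factors k + 1/4 with k = 2(N+1)
  \<open>lam\<close> for sl, 3(k + 1/4) with k = 2(N+2) \<open>lam\<close> for sp, and m + (N-4)/2
  with m = 2(N-1)(N-2) \<open>lam\<close> for so. The excluded value of \<open>lam\<close> is the
  zero of this factor; the summands free of \<open>lam\<close> come from the half brackets.\<close>

context vector_space
begin

lemma eigen_sum_eq_0:
  assumes lin: "Vector_Spaces.linear scale scale f"
    and fin: "finite F"
    and eig: "\<And>c. c \<in> F \<Longrightarrow> f (X c) = scale c (X c)"
    and sum: "(\<Sum>c\<in>F. X c) = 0"
    and c: "c \<in> F"
  shows "X c = 0"
proof -
  interpret f: Vector_Spaces.linear scale scale f by (rule lin)
  show ?thesis using fin eig sum c
  proof (induction F arbitrary: X c)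
    case empty then show ?case by simp
  next
    case (insert a F)
    have s: "X a + (\<Sum>c\<in>F. X c) = 0" using insert by simp
    \<comment> \<open>Applying \<open>f - a\<close> kills \<open>X a\<close> and multiplies every
      other \<open>X c\<close> by the nonzero factor \<open>c - a\<close>, which leaves a shorter
      sum for the induction hypothesis.\<close>
    have "f (X a + (\<Sum>c\<in>F. X c)) - scale a (X a + (\<Sum>c\<in>F. X c)) = 0" by (simp add: s f.zero)
    then have "(\<Sum>c\<in>F. scale c (X c)) - (\<Sum>c\<in>F. scale a (X c)) = 0"
      using insert.prems(1) by (simp add: f.add f.sum scale_right_distrib scale_sum_right)
    then have "(\<Sum>c\<in>F. scale (c - a) (X c)) = 0"
      by (simp add: sum_subtractf[symmetric] scale_left_diff_distrib)
    moreover have "f (scale (c - a) (X c)) = scale c (scale (c - a) (X c))" if "c \<in> F" for c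
      using insert.prems(1)[of c] that by (simp add: f.scale mult.commute)
    ultimately have *: "scale (c - a) (X c) = 0" if "c \<in> F" for c
      using insert.IH[of "\<lambda>c. scale (c - a) (X c)" c] that by simp
    have X0: "X c = 0" if "c \<in> F" for c
      using *[OF that] insert.hyps that by auto
    then have "X a = 0" using s by simp
    then show ?case using X0 insert.prems(3) by auto
  qed
qed

text \<open>Components are indexed by their eigenvalue, so vectors with equal eigenvalue are merged.
  \<open>D = UNIV\<close> serves to split a vector, \<open>D = - {d}\<close> to exclude an
  eigenvalue. The eigenvector equation is required of \<open>Y c\<close> for all \<open>c\<close>,
  which the value 0 satisfies.\<close>

lemma span_eigen_decomp:
  assumes U: "subspace U"
    and x: "x \<in> span {X\<in>U. \<exists>c\<in>D. f X = scale c X}"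
    and lin: "Vector_Spaces.linear scale scale f"
  obtains F Y where "finite F" "F \<subseteq> D" "x = (\<Sum>c\<in>F. Y c)"
    "\<And>c. Y c \<in> U" "\<And>c. f (Y c) = scale c (Y c)"
proof -
  interpret f: Vector_Spaces.linear scale scale f by (rule lin)
  have "\<exists>F Y. finite F \<and> F \<subseteq> D \<and> x = (\<Sum>c\<in>F. Y c) \<and> (\<forall>c. Y c \<in> U \<and> f (Y c) = scale c (Y c))"
    using x
  proof (induction rule: span_induct_alt)
    case base
    show ?case
      by (rule exI[of _ "{}"], rule exI[of _ "\<lambda>_. 0"]) (simp add: U subspace_0 f.zero)
  next
    case (step a y z)
    then obtain F Y where F: "finite F" "F \<subseteq> D" "z = (\<Sum>c\<in>F. Y c)"
      "\<And>c. Y c \<in> U" "\<And>c. f (Y c) = scale c (Y c)" by blast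
    obtain d where d: "y \<in> U" "d \<in> D" "f y = scale d y" using step by blast
    define Y' where "Y' = (\<lambda>c. (if c \<in> F then Y c else 0) + (if c = d then scale a y else 0))"
    have "(\<Sum>c\<in>insert d F. Y' c) = scale a y + z"
    proof -
      have "(\<Sum>c\<in>insert d F. (if c \<in> F then Y c else 0)) = z"
        unfolding F(3) using F(1) by (intro sum.mono_neutral_cong_right) auto
      moreover have "(\<Sum>c\<in>insert d F. (if c = d then scale a y else 0)) = scale a y"
        using F(1) by (simp add: sum.delta)
      ultimately show ?thesis unfolding Y'_def sum.distrib by (simp add: add.commute)
    qed
    moreover have "Y' c \<in> U" for c
      unfolding Y'_def using F(4) d U by (auto intro!: subspace_add subspace_scale simp: subspace_0)
    moreover have "f (Y' c) = scale c (Y' c)" for c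
      unfolding Y'_def using F(5) d(3)
      by (auto simp: f.add f.zero f.scale scale_right_distrib mult.commute)
    ultimately show ?case using F(1,2) d(2) by (intro exI[of _ "insert d F"] exI[of _ Y']) auto
  qed
  then show ?thesis using that by blast
qed

lemma span_eigen_disjoint:
  assumes lin: "Vector_Spaces.linear scale scale f"
    and x: "x \<in> span {X. \<exists>c. c \<noteq> d \<and> f X = scale c X}" and d: "f x = scale d x"
  shows "x = 0"
proof -
  interpret f: Vector_Spaces.linear scale scale f by (rule lin)
  have "x \<in> span {X\<in>UNIV. \<exists>c\<in>- {d}. f X = scale c X}" using x by (simp add: Bex_def)
  then obtain F Y where F: "finite F" "d \<notin> F" "x = (\<Sum>c\<in>F. Y c)"
      "\<And>c. f (Y c) = scale c (Y c)"
    by (rule span_eigen_decomp[OF subspace_UNIV _ lin]) auto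
  \<comment> \<open>Moving \<open>x\<close> to the other side as the component at the new index
    \<open>d\<close> gives a vanishing sum of eigenvectors with distinct eigenvalues.\<close>
  define Y' where "Y' = (\<lambda>c. if c = d then - x else Y c)"
  have "(\<Sum>c\<in>insert d F. Y' c) = 0"
  proof -
    have "(\<Sum>c\<in>F. Y' c) = x" unfolding F(3) using F(2) by (intro sum.cong) (auto simp: Y'_def)
    then show ?thesis using F(1,2) by (simp add: Y'_def)
  qed
  moreover have "f (Y' c) = scale c (Y' c)" for c
    using F(4) d by (auto simp: Y'_def f.neg)
  ultimately have "Y' d = 0"
    using eigen_sum_eq_0[OF lin, of "insert d F" Y' d] F(1) by blast
  then show "x = 0" by (simp add: Y'_def)
qed

text \<open>If \<open>f b X = scale e X\<close>, then \<open>f b - e\<close> kills \<open>X\<close>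
  and commutes with \<open>f a\<close>, hence kills every \<open>f a\<close>-component of
  \<open>X\<close> separately. Splitting a joint eigenvector along one more operator therefore keeps
  the eigenvalues already achieved.\<close>

lemma joint_diagonalization:
  assumes U: "subspace U" and fin: "finite A"
    and lin: "\<And>a. a \<in> A \<Longrightarrow> Vector_Spaces.linear scale scale (f a)"
    and diag: "\<And>a. a \<in> A \<Longrightarrow> U \<subseteq> span {X\<in>U. \<exists>c. f a X = scale c X}"
    and comm: "\<And>a b X. a \<in> A \<Longrightarrow> b \<in> A \<Longrightarrow> X \<in> U \<Longrightarrow> f a (f b X) = f b (f a X)"
  shows "U \<subseteq> span {X\<in>U. \<forall>a\<in>A. \<exists>c. f a X = scale c X}"
  using fin lin diag comm
proof (induction A)
  case empty
  then show ?case by (auto intro: span_base)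
next
  case (insert a A)
  interpret fa: Vector_Spaces.linear scale scale "f a" by (rule insert.prems) simp
  have IH: "U \<subseteq> span {X\<in>U. \<forall>b\<in>A. \<exists>c. f b X = scale c X}"
    using insert.prems by (intro insert.IH) auto
  have "{X\<in>U. \<forall>b\<in>A. \<exists>c. f b X = scale c X} \<subseteq> span {X\<in>U. \<forall>b\<in>insert a A. \<exists>c. f b X = scale c X}"
  proof
    fix X assume "X \<in> {X\<in>U. \<forall>b\<in>A. \<exists>c. f b X = scale c X}"
    then have X: "X \<in> U" "\<And>b. b \<in> A \<Longrightarrow> \<exists>c. f b X = scale c X" by auto
    have "X \<in> span {X\<in>U. \<exists>c\<in>UNIV. f a X = scale c X}" using insert.prems(2)[of a] X by auto
    then obtain F Y where F: "finite F" "X = (\<Sum>c\<in>F. Y c)"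
      "\<And>c. Y c \<in> U" "\<And>c. f a (Y c) = scale c (Y c)"
      by (rule span_eigen_decomp[OF U _ insert.prems(1)[of a]]) auto
    have "\<exists>c'. f b (Y c) = scale c' (Y c)" if b: "b \<in> A" and c: "c \<in> F" for b c
    proof -
      interpret fb: Vector_Spaces.linear scale scale "f b" by (rule insert.prems) (simp add: b)
      obtain e where e: "f b X = scale e X" using X(2)[OF b] by blast
      have "(\<Sum>c\<in>F. f b (Y c) - scale e (Y c)) = f b X - scale e X"
        by (simp add: F(2) fb.sum scale_sum_right sum_subtractf)
      also have "\<dots> = 0" using e by simp
      finally have s: "(\<Sum>c\<in>F. f b (Y c) - scale e (Y c)) = 0" .
      have "f a (f b (Y c) - scale e (Y c)) = scale c (f b (Y c) - scale e (Y c))" for c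
        using insert.prems(3)[of a b "Y c"] F(3,4) b
        by (simp add: fa.diff fa.scale fb.scale scale_right_diff_distrib mult.commute)
      then have "f b (Y c) - scale e (Y c) = 0"
        using eigen_sum_eq_0[OF insert.prems(1)[of a] F(1) _ s c] by simp
      then show ?thesis by auto
    qed
    then have "Y c \<in> {X\<in>U. \<forall>b\<in>insert a A. \<exists>c. f b X = scale c X}" if "c \<in> F" for c
      using F(3,4) that by auto
    then show "X \<in> span {X\<in>U. \<forall>b\<in>insert a A. \<exists>c. f b X = scale c X}"
      unfolding F(2) by (intro span_sum span_base)
  qed
  then have "span {X\<in>U. \<forall>b\<in>A. \<exists>c. f b X = scale c X}
      \<subseteq> span {X\<in>U. \<forall>b\<in>insert a A. \<exists>c. f b X = scale c X}"
    by (intro span_minimal subspace_span)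
  then show ?case using IH by blast
qed

end

section \<open>Cartan subalgebras\<close>

lemma cmat_scale_nth [simp]: "cmat_scale c A $ i $ j = c * A $ i $ j"
  by (simp add: cmat_scale_def)

lemma cmat_scale_mult:
  "cmat_scale c A ** B = cmat_scale c (A ** B)" "A ** cmat_scale c B = cmat_scale c (A ** B)"
  by (simp_all add: vec_eq_iff matrix_matrix_mult_def sum_distrib_left mult.assoc mult.left_commute)

lemma cmat_mult_diff:
  fixes A B C :: "complex^'m^'m"
  shows "(A - B) ** C = A ** C - B ** C" "A ** (B - C) = A ** B - A ** C"
    "(- A) ** B = - (A ** B)" "A ** (- B) = - (A ** B)"
    "(A + B) ** C = A ** C + B ** C" "A ** (B + C) = A ** B + A ** C"
  by (simp_all add: vec_eq_iff matrix_matrix_mult_def sum_subtractf sum.distrib sum_negf algebra_simps)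

lemma bracket_linear:
  "bracket (A + B) C = bracket A C + bracket B C" "bracket A (B + C) = bracket A B + bracket A C"
  "bracket (A - B) C = bracket A C - bracket B C" "bracket A (B - C) = bracket A B - bracket A C"
  "bracket (cmat_scale c A) B = cmat_scale c (bracket A B)"
  "bracket A (cmat_scale c B) = cmat_scale c (bracket A B)"
  "bracket 0 A = 0" "bracket A 0 = 0" "bracket (- A) B = - bracket A B" "bracket A (- B) = - bracket A B"
  by (simp_all add: bracket_def cmat_mult_diff cmat_scale_mult cmat.scale_right_diff_distrib)

lemma linear_bracket: "Vector_Spaces.linear cmat_scale cmat_scale (bracket H)"
  by unfold_locales (simp_all add: bracket_linear)

lemma bracket_anticomm: "bracket A B = - bracket B A"
  by (simp add: bracket_def)

lemma bracket_jacobi: "bracket A (bracket B C) = bracket (bracket A B) C + bracket B (bracket A C)"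
  by (simp add: bracket_def cmat_mult_diff matrix_mul_assoc)

lemma cmat_sum_axis:
  "A = (\<Sum>i\<in>UNIV. \<Sum>j\<in>UNIV. cmat_scale (A $ i $ j) (axis i (axis j 1)))"
proof -
  have "(\<Sum>i\<in>UNIV. \<Sum>j\<in>UNIV. A $ i $ j * axis i (axis j (1::complex)) $ k $ l) =
      (\<Sum>i\<in>UNIV. \<Sum>j\<in>UNIV. if j = l then if i = k then A $ k $ l else 0 else 0)" for k l
    by (intro sum.cong refl) (auto simp: axis_def)
  then show ?thesis by (simp add: vec_eq_iff)
qed

lemma cmat_finite_basis:
  obtains B where "finite B" "B \<subseteq> S" "cmat.independent B" "S \<subseteq> cmat.span B"
proof -
  obtain B where B: "B \<subseteq> S" "cmat.independent B" "S \<subseteq> cmat.span B"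
    by (rule cmat.maximal_independent_subset)
  let ?T = "(\<lambda>(i, j). axis i (axis j 1)) ` UNIV :: (complex^'a^'a) set"
  have "A \<in> cmat.span ?T" for A :: "complex^'a^'a"
    by (subst cmat_sum_axis[of A]) (intro cmat.span_sum cmat.span_scale cmat.span_base, auto)
  then have "B \<subseteq> cmat.span ?T" by blast
  moreover have "finite ?T" by simp
  ultimately have "finite B" using cmat.independent_span_bound[of ?T B] B(2) by blast
  then show ?thesis using B that by blast
qed

lemma cartan_subalgebraD:
  assumes "cartan_subalgebra g h"
  shows "h \<subseteq> g" "cmat.subspace h" "\<And>H H'. H \<in> h \<Longrightarrow> H' \<in> h \<Longrightarrow> bracket H H' = 0"
    "\<And>X. X \<in> g \<Longrightarrow> (\<And>H. H \<in> h \<Longrightarrow> bracket H X = 0) \<Longrightarrow> X \<in> h"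
    "\<And>H. H \<in> h \<Longrightarrow> cmat.span {X\<in>g. \<exists>c. bracket H X = cmat_scale c X} = g"
proof -
  note a = assms[unfolded cartan_subalgebra_def]
  note a1 = conjunct1[OF a] and b1 = conjunct2[OF a]
  note a2 = conjunct1[OF b1] and b2 = conjunct2[OF b1]
  note a3 = conjunct1[OF b2] and b3 = conjunct2[OF b2]
  note a4 = conjunct1[OF b3] and a5 = conjunct2[OF b3]
  show "h \<subseteq> g" by (rule a1)
  show "cmat.subspace h" by (rule a2)
  show "bracket H H' = 0" if "H \<in> h" "H' \<in> h" for H H'
    by (rule a3[rule_format, OF that])
  show "X \<in> h" if "X \<in> g" "\<And>H. H \<in> h \<Longrightarrow> bracket H X = 0" for X
    by (rule a4[rule_format, OF that])
  show "cmat.span {X\<in>g. \<exists>c. bracket H X = cmat_scale c X} = g" if "H \<in> h" for H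
    by (rule a5[rule_format, OF that])
qed

text \<open>For any \<open>H\<close> in \<open>h\<close> the algebra is the span of the eigenvectors
  of \<open>bracket H\<close>, and \<open>h\<close> contains 0.\<close>

lemma cartan_subspace:
  assumes "cartan_subalgebra g h"
  shows "cmat.subspace g"
proof -
  have "0 \<in> h" by (rule cmat.subspace_0) (rule cartan_subalgebraD(2)[OF assms])
  then show ?thesis
    by (subst cartan_subalgebraD(5)[OF assms, symmetric]) (auto simp: cmat.subspace_span)
qed

text \<open>The definition diagonalizes each \<open>bracket H\<close> separately. These operators
  commute by the Jacobi identity, and a finite basis of \<open>h\<close> suffices because joint
  eigenvectors for the basis are joint eigenvectors for its span.\<close>

lemma weight_space_decomposition:
  assumes c: "cartan_subalgebra g h"
  shows "g \<subseteq> cmat.span {X\<in>g. \<exists>\<alpha>. \<forall>H\<in>h. bracket H X = cmat_scale (\<alpha> H) X}"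
proof -
  obtain B where B: "finite B" "B \<subseteq> h" "cmat.independent B" "h \<subseteq> cmat.span B"
    by (rule cmat_finite_basis)
  have "g \<subseteq> cmat.span {X\<in>g. \<forall>a\<in>B. \<exists>c. bracket a X = cmat_scale c X}"
  proof (rule cmat.joint_diagonalization[OF cartan_subspace[OF c] B(1) linear_bracket])
    show "g \<subseteq> cmat.span {X \<in> g. \<exists>c. bracket a X = cmat_scale c X}" if "a \<in> B" for a
      using cartan_subalgebraD(5)[OF c, of a] B(2) that by auto
    show "bracket a (bracket b X) = bracket b (bracket a X)" if "a \<in> B" "b \<in> B" for a b X
    proof -
      have "bracket a b = 0" using cartan_subalgebraD(3)[OF c] that B(2) by auto
      then show ?thesis using bracket_jacobi[of a b X] by (simp add: bracket_linear)
    qed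
  qed
  also have "\<dots> \<subseteq> cmat.span {X\<in>g. \<exists>\<alpha>. \<forall>H\<in>h. bracket H X = cmat_scale (\<alpha> H) X}"
  proof (intro cmat.span_mono subsetI)
    fix X assume "X \<in> {X\<in>g. \<forall>a\<in>B. \<exists>c. bracket a X = cmat_scale c X}"
    then have X: "X \<in> g" "\<And>a. a \<in> B \<Longrightarrow> \<exists>c. bracket a X = cmat_scale c X" by auto
    have "\<exists>c. bracket H X = cmat_scale c X" if "H \<in> cmat.span B" for H
      using that
    proof (induction rule: cmat.span_induct_alt)
      case base
      then show ?case by (intro exI[of _ 0]) (simp add: bracket_linear)
    next
      case (step a y z)
      then obtain d e where "bracket y X = cmat_scale d X" "bracket z X = cmat_scale e X"
        using X by blast
      then have "bracket (cmat_scale a y + z) X = cmat_scale (a * d + e) X"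
        by (simp add: bracket_linear cmat.scale_left_distrib)
      then show ?case by blast
    qed
    then have "\<forall>H\<in>h. \<exists>c. bracket H X = cmat_scale c X" using B(4) by blast
    then show "X \<in> {X\<in>g. \<exists>\<alpha>. \<forall>H\<in>h. bracket H X = cmat_scale (\<alpha> H) X}"
      using X(1) bchoice by auto
  qed
  finally show ?thesis .
qed

text \<open>This carries conditions on roots over to \<open>bracket H0\<close> alone. The weight
  vectors whose weight differs from \<open>c\<close> at \<open>H0\<close> contribute a part that is
  an eigenvector for \<open>c\<close> and a sum of eigenvectors for other eigenvalues, hence
  zero.\<close>

lemma ad_eigenvector_weight_decomposition:
  assumes c: "cartan_subalgebra g h" and H0: "H0 \<in> h"
    and X: "X \<in> g" "bracket H0 X = cmat_scale c X"
  shows "X \<in> cmat.span {Y\<in>g. Y \<noteq> 0 \<and> (\<exists>\<alpha>. \<alpha> H0 = c \<and> (\<forall>H\<in>h. bracket H Y = cmat_scale (\<alpha> H) Y))}"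
    (is "X \<in> cmat.span ?E")
proof -
  let ?D = "{Y\<in>g. \<exists>c'. c' \<noteq> c \<and> bracket H0 Y = cmat_scale c' Y}"
  have "{X\<in>g. \<exists>\<alpha>. \<forall>H\<in>h. bracket H X = cmat_scale (\<alpha> H) X} \<subseteq> cmat.span (?E \<union> ?D)"
  proof
    fix Y assume "Y \<in> {X\<in>g. \<exists>\<alpha>. \<forall>H\<in>h. bracket H X = cmat_scale (\<alpha> H) X}"
    then obtain \<alpha> where Y: "Y \<in> g" "\<forall>H\<in>h. bracket H Y = cmat_scale (\<alpha> H) Y" by auto
    show "Y \<in> cmat.span (?E \<union> ?D)"
    proof (cases "Y = 0")
      case True then show ?thesis by (simp add: cmat.span_zero)
    next
      case False
      have "Y \<in> ?E \<union> ?D"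
      proof (cases "\<alpha> H0 = c")
        case True
        then have "\<alpha> H0 = c \<and> (\<forall>H\<in>h. bracket H Y = cmat_scale (\<alpha> H) Y)" using Y(2) by simp
        then have "Y \<in> ?E" using \<open>Y \<noteq> 0\<close> Y(1) by auto
        then show ?thesis ..
      next
        case False
        then have "Y \<in> ?D" using Y H0 by auto
        then show ?thesis ..
      qed
      then show ?thesis by (rule cmat.span_base)
    qed
  qed
  then have "X \<in> cmat.span (?E \<union> ?D)"
    using weight_space_decomposition[OF c] X(1) cmat.span_minimal[OF _ cmat.subspace_span] by blast
  then obtain X1 X2 where x: "X = X1 + X2" "X1 \<in> cmat.span ?E" "X2 \<in> cmat.span ?D"
    unfolding cmat.span_Un by blast
  have "?E \<subseteq> {Y. bracket H0 Y = cmat_scale c Y}" using H0 by auto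
  moreover have "cmat.subspace {Y. bracket H0 Y = cmat_scale c Y}"
    by (auto simp: cmat.subspace_def bracket_linear cmat.scale_right_distrib mult.commute)
  ultimately have "X1 \<in> {Y. bracket H0 Y = cmat_scale c Y}" using x(2) cmat.span_minimal by blast
  then have "bracket H0 X2 = cmat_scale c X2"
    using X(2) unfolding x(1) by (simp add: bracket_linear cmat.scale_right_distrib)
  moreover have "X2 \<in> cmat.span {Y. \<exists>c'. c' \<noteq> c \<and> bracket H0 Y = cmat_scale c' Y}"
    using x(3) by (rule subsetD[OF cmat.span_mono, rotated]) auto
  ultimately have "X2 = 0"
    using cmat.span_eigen_disjoint[OF linear_bracket] by blast
  then show ?thesis using x by simp
qed

text \<open>A weight that vanishes at \<open>H0\<close> is not a root, so it vanishes on
  \<open>h\<close>, and maximality of \<open>h\<close> puts its weight vectors into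
  \<open>h\<close>.\<close>

lemma regular_centralizer:
  assumes c: "cartan_subalgebra g h" "positivity g h H0"
    and X: "X \<in> g" "bracket H0 X = 0"
  shows "X \<in> h"
proof -
  have H0: "H0 \<in> h" using c by (simp add: positivity_def)
  note sub = cartan_subalgebraD(2)[OF c(1)] and mx = cartan_subalgebraD(4)[OF c(1)]
  let ?E = "{Y\<in>g. Y \<noteq> 0 \<and> (\<exists>\<alpha>. \<alpha> H0 = 0 \<and> (\<forall>H\<in>h. bracket H Y = cmat_scale (\<alpha> H) Y))}"
  have "X \<in> cmat.span ?E"
    using ad_eigenvector_weight_decomposition[OF c(1) H0 X(1), of 0] X(2) by simp
  moreover have "?E \<subseteq> h"
  proof
    fix Y assume "Y \<in> ?E"
    then obtain \<alpha> where Y: "Y \<in> g" "Y \<noteq> 0" "\<alpha> H0 = 0" "\<forall>H\<in>h. bracket H Y = cmat_scale (\<alpha> H) Y"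
      by auto
    have "\<not> is_root g h \<alpha>" using c(2) Y(3) by (auto simp: positivity_def)
    moreover have "root_space g h \<alpha> \<noteq> {0}" using Y by (auto simp: root_space_def)
    ultimately have "\<forall>H\<in>h. \<alpha> H = 0" by (auto simp: is_root_def)
    then show "Y \<in> h" using Y by (intro mx) auto
  qed
  ultimately show ?thesis using sub cmat.span_minimal by blast
qed

lemma regular_eigenvalue_real:
  assumes c: "cartan_subalgebra g h" "positivity g h H0"
    and X: "X \<in> g" "X \<noteq> 0" "bracket H0 X = cmat_scale c X"
  shows "c \<in> \<real>"
proof (cases "c = 0")
  case False
  have H0: "H0 \<in> h" using c by (simp add: positivity_def)
  let ?E = "{Y\<in>g. Y \<noteq> 0 \<and> (\<exists>\<alpha>. \<alpha> H0 = c \<and> (\<forall>H\<in>h. bracket H Y = cmat_scale (\<alpha> H) Y))}"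
  have "X \<in> cmat.span ?E" by (rule ad_eigenvector_weight_decomposition[OF c(1) H0 X(1,3)])
  then have "?E \<noteq> {}"
  proof (rule contrapos_pn)
    assume "?E = {}"
    show "X \<notin> cmat.span ?E" unfolding \<open>?E = {}\<close> using X(2) by simp
  qed
  then obtain Y where "Y \<in> ?E" by (meson all_not_in_conv)
  then obtain \<alpha> where Y: "Y \<in> g" "Y \<noteq> 0" "\<alpha> H0 = c" "\<forall>H\<in>h. bracket H Y = cmat_scale (\<alpha> H) Y"
    by auto
  then have "Y \<in> root_space g h \<alpha>" by (simp add: root_space_def)
  moreover have "\<alpha> H0 \<noteq> 0" using False Y(3) by simp
  ultimately have "is_root g h \<alpha>" using Y(2) H0 unfolding is_root_def by blast
  then show ?thesis using c(2) Y(3) by (auto simp: positivity_def)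
qed auto

text \<open>The highest weight condition speaks of root vectors; an eigenvector of
  \<open>bracket H0\<close> with positive eigenvalue is a sum of root vectors for positive
  roots.\<close>

lemma positive_eigenvector_kills:
  assumes c: "cartan_subalgebra g h" "positivity g h H0"
    and v: "\<forall>\<alpha>. is_root g h \<alpha> \<and> Re (\<alpha> H0) > 0 \<longrightarrow> (\<forall>X\<in>root_space g h \<alpha>. bracket X v = 0)"
    and X: "X \<in> g" "bracket H0 X = cmat_scale c X" "Re c > 0"
  shows "bracket X v = 0"
proof -
  have H0: "H0 \<in> h" using c by (simp add: positivity_def)
  let ?E = "{Y\<in>g. Y \<noteq> 0 \<and> (\<exists>\<alpha>. \<alpha> H0 = c \<and> (\<forall>H\<in>h. bracket H Y = cmat_scale (\<alpha> H) Y))}"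
  have "X \<in> cmat.span ?E" by (rule ad_eigenvector_weight_decomposition[OF c(1) H0 X(1,2)])
  moreover have "?E \<subseteq> {Y. bracket Y v = 0}"
  proof
    fix Y assume "Y \<in> ?E"
    then obtain \<alpha> where Y: "Y \<in> g" "Y \<noteq> 0" "\<alpha> H0 = c" "\<forall>H\<in>h. bracket H Y = cmat_scale (\<alpha> H) Y"
      by auto
    then have rs: "Y \<in> root_space g h \<alpha>" by (auto simp: root_space_def)
    moreover have "\<alpha> H0 \<noteq> 0" using X(3) Y(3) by auto
    ultimately have "is_root g h \<alpha>" using Y(2) H0 unfolding is_root_def by blast
    then have "is_root g h \<alpha> \<and> Re (\<alpha> H0) > 0" using X(3) Y(3) by simp
    then show "Y \<in> {Y. bracket Y v = 0}" using v rs by blast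
  qed
  moreover have "cmat.subspace {Y. bracket Y v = 0}"
    by (auto simp: cmat.subspace_def bracket_linear)
  ultimately show ?thesis using cmat.span_minimal by blast
qed

section \<open>Diagonalizable matrices\<close>

lemma complex_matrix_eigenvector:
  fixes A :: "complex^'m^'m"
  obtains w c where "w \<noteq> 0" "A *v w = c *s w"
proof -
  \<comment> \<open>The characteristic polynomial, as the Leibniz expansion of a determinant with
    linear polynomials as entries.\<close>
  define p where "p = (\<Sum>\<sigma> | \<sigma> permutes (UNIV::'m set).
     [:of_int (sign \<sigma>):] * (\<Prod>i\<in>UNIV. [:A $ i $ \<sigma> i, - (mat 1 $ i $ \<sigma> i):]))"
  have p: "poly p z = det (A - mat z)" for z
    unfolding p_def det_def
    by (simp add: poly_sum poly_prod mat_def) (intro sum.cong prod.cong arg_cong2[of _ _ _ _ "(*)"]; simp)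
  have "\<exists>z. poly p z = 0"
  proof (cases "constant (poly p)")
    case False
    then show ?thesis by (rule fundamental_theorem_of_algebra)
  next
    case True
    \<comment> \<open>If \<open>p\<close> were constant, the reversed determinant
      \<open>q t = det (t A - 1)\<close> would equal \<open>t ^ CARD('m) * poly p 0\<close> away
      from 0 and tend to 0, whereas \<open>q 0 = det (- 1)\<close> is nonzero.\<close>
    define q where "q t = det (\<chi> i j. t * A $ i $ j - mat 1 $ i $ j)" for t
    have qt: "q t = t ^ CARD('m) * poly p 0" if "t \<noteq> 0" for t
    proof -
      have "(\<chi> i j. t * A $ i $ j - mat 1 $ i $ j) = (\<chi> i. t *s (A - mat (1 / t)) $ i)"
        using that by (simp add: vec_eq_iff mat_def right_diff_distrib)
      then have "q t = det (\<chi> i. t *s (A - mat (1 / t)) $ i)" by (simp add: q_def)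
      also have "\<dots> = (\<Prod>i\<in>(UNIV::'m set). t) * det (\<chi> i. (A - mat (1 / t)) $ i)"
        by (rule det_rows_mul)
      also have "\<dots> = t ^ CARD('m) * poly p (1 / t)"
        unfolding p vec_nth_inverse by simp
      also have "poly p (1 / t) = poly p 0" using True unfolding constant_def by blast
      finally show ?thesis .
    qed
    have "continuous_on UNIV q"
      unfolding q_def det_def by (intro continuous_intros)
    then have "q \<midarrow>0\<rightarrow> q 0" by (simp add: continuous_on_def)
    then have "(\<lambda>t. t ^ CARD('m) * poly p 0) \<midarrow>0\<rightarrow> q 0"
      by (rule Lim_transform_eventually) (auto simp: eventually_at_filter qt)
    moreover have "(\<lambda>t. t ^ CARD('m) * poly p 0) \<midarrow>0\<rightarrow> 0 ^ CARD('m) * poly p 0"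
      by (intro tendsto_intros)
    ultimately have "q 0 = 0" using LIM_unique by fastforce
    moreover have "(\<chi> i j. 0 * A $ i $ j - mat 1 $ i $ j) = - (mat 1 :: complex^'m^'m)"
      by (simp add: vec_eq_iff)
    moreover have "det (- (mat 1 :: complex^'m^'m)) \<noteq> 0"
    proof -
      have "(- mat 1) ** (- mat 1) = (mat 1 :: complex^'m^'m)" by (simp add: cmat_mult_diff)
      then have "det (- (mat 1 :: complex^'m^'m)) * det (- (mat 1 :: complex^'m^'m)) = 1"
        by (metis det_I det_mul)
      then show ?thesis by auto
    qed
    ultimately show ?thesis by (simp add: q_def)
  qed
  then obtain z where "det (A - mat z) = 0" unfolding p by blast
  then have "\<not> invertible (A - mat z)" by (simp add: invertible_det_nz)
  then obtain w where w: "w \<noteq> 0" "(A - mat z) *v w = 0"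
    unfolding invertible_left_inverse matrix_left_invertible_ker by blast
  have "mat z *v w = z *s w" by (simp add: vec_eq_iff matrix_vector_mult_def mat_def if_distrib[of "\<lambda>a. a * _"] cong: if_cong)
  then show ?thesis using w that[of w z] by (simp add: matrix_vector_mult_diff_rdistrib)
qed

lemma eigenbasis:
  fixes A :: "complex^'m^'m"
  assumes "vec.span {w. \<exists>c. A *v w = c *s w} = UNIV"
  obtains Q :: "complex^'m^'m" and e where "invertible Q" "\<And>i. A *v column i Q = e i *s column i Q"
proof -
  obtain B where B: "B \<subseteq> {w. \<exists>c. A *v w = c *s w}" "vec.independent B" "{w. \<exists>c. A *v w = c *s w} \<subseteq> vec.span B"
    by (rule vec.maximal_independent_subset)
  have sp: "vec.span B = UNIV"
    using vec.span_minimal[OF B(3) vec.subspace_span] assms by auto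
  have "card B = CARD('m)"
    using vec.dim_eq_card[of B UNIV] sp B(2) by (simp add: card_cart_basis)
  then obtain b where b: "bij_betw b (UNIV::'m set) B"
    using finite_same_card_bij[of "UNIV::'m set" B] vec.finiteI_independent[OF B(2)] by auto
  define Q where "Q = (\<chi> i j. b j $ i)"
  have col: "column j Q = b j" for j by (simp add: Q_def column_def vec_eq_iff)
  have "columns Q = B" using b by (auto simp: columns_def col bij_betw_def)
  then have "invertible Q"
    using sp matrix_right_invertible_span_columns[of Q] invertible_right_inverse by blast
  moreover have "\<forall>i. \<exists>c. A *v column i Q = c *s column i Q"
    using b B(1) unfolding col bij_betw_def by blast
  then obtain e where "\<And>i. A *v column i Q = e i *s column i Q" by metis
  ultimately show ?thesis using that[of Q e] by simp
qed

text \<open>Used one argument at a time to pass from an eigenbasis, stored as the columns of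
  \<open>Q\<close>, to arbitrary vectors. With \<open>S = {0}\<close> it shows that a linear map
  vanishes.\<close>

lemma columns_induct:
  fixes Q :: "complex^'m^'m"
  assumes Q: "invertible Q" and S: "module.subspace sc S" and f: "Vector_Spaces.linear (*s) sc f"
    and b: "\<And>i. f (column i Q) \<in> S"
  shows "f x \<in> S"
proof -
  interpret f: Vector_Spaces.linear "(*s)" sc f by (rule f)
  have "vec.span (columns Q) = UNIV"
    using Q matrix_right_invertible_span_columns[of Q] invertible_right_inverse by blast
  then have "x \<in> vec.span (columns Q)" by simp
  then show ?thesis
  proof (induction rule: vec.span_induct_alt)
    case base
    then show ?case using S by (simp add: f.zero f.vs2.subspace_0)
  next
    case (step c x y)
    then show ?case using b S by (auto simp: columns_def f.add f.scale intro!: f.vs2.subspace_add f.vs2.subspace_scale)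
  qed
qed

lemma bracket_mult_vec: "bracket A B *v x = A *v (B *v x) - B *v (A *v x)"
  by (simp add: bracket_def matrix_vector_mult_diff_rdistrib matrix_vector_mul_assoc)

lemma cmat_scale_mult_vec: "cmat_scale c A *v x = c *s (A *v x)"
  by (simp add: vec_eq_iff matrix_vector_mult_def sum_distrib_left mult.assoc)

text \<open>An eigenvector of \<open>bracket H\<close> with eigenvalue \<open>c\<close> shifts
  eigenvalues of \<open>H\<close> by \<open>c\<close>. This is the bridge from diagonalizability on
  \<open>g\<close> to diagonalizability on the standard representation.\<close>

lemma ad_eigenvectors_act:
  assumes X: "X \<in> cmat.span {X. \<exists>c. bracket H X = cmat_scale c X}" and w: "H *v w = d *s w"
  shows "X *v w \<in> vec.span {w. \<exists>c. H *v w = c *s w}"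
  using X
proof (induction rule: cmat.span_induct_alt)
  case base
  then show ?case by (simp add: vec.span_zero)
next
  case (step a X Y)
  then obtain c where c: "bracket H X = cmat_scale c X" by blast
  have "H *v (X *v w) = X *v (H *v w) + bracket H X *v w" by (simp add: bracket_mult_vec)
  also have "\<dots> = (d + c) *s (X *v w)"
    by (simp add: w c cmat_scale_mult_vec vec.scale vec.scale_left_distrib)
  finally have "X *v w \<in> vec.span {w. \<exists>c. H *v w = c *s w}" by (intro vec.span_base) blast
  then show ?case using step
    by (simp add: matrix_vector_mult_add_rdistrib cmat_scale_mult_vec vec.span_add vec.span_scale)
qed

section \<open>The Lie algebra of a bilinear form\<close>

definition bil :: "complex^'m^'m \<Rightarrow> complex^'m \<Rightarrow> complex^'m \<Rightarrow> complex" where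
  "bil J x y = (\<Sum>i\<in>UNIV. x $ i * (J *v y) $ i)"

lemma bil_linear [simp]:
  "bil J (x + y) z = bil J x z + bil J y z" "bil J z (x + y) = bil J z x + bil J z y"
  "bil J (c *s x) z = c * bil J x z" "bil J z (c *s x) = c * bil J z x"
  "bil J (x - y) z = bil J x z - bil J y z" "bil J z (x - y) = bil J z x - bil J z y"
  "bil J 0 z = 0" "bil J z 0 = 0" "bil J (- x) z = - bil J x z" "bil J z (- x) = - bil J z x"
  by (simp_all add: bil_def algebra_simps sum.distrib sum_subtractf sum_distrib_left sum_negf
      matrix_vector_right_distrib matrix_vector_mult_diff_distrib vec.scale vec.neg)

lemma bil_sum: "bil J (\<Sum>i\<in>A. f i) z = (\<Sum>i\<in>A. bil J (f i) z)"
  "bil J z (\<Sum>i\<in>A. f i) = (\<Sum>i\<in>A. bil J z (f i))"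
  by (induction A rule: infinite_finite_induct) simp_all

lemma bil_axis: "bil J (axis i 1) z = (J *v z) $ i"
  by (simp add: bil_def axis_def if_distrib[of "\<lambda>a. a * _"] cong: if_cong)

lemma vector_matrix_mult_nth:
  fixes A :: "complex^'n^'m"
  shows "(x v* A) $ j = (\<Sum>i\<in>UNIV. A $ i $ j * x $ i)"
  by (simp add: vector_matrix_mult_def mult.commute)

lemma bil_mult_left: "bil J (A *v x) y = (\<Sum>i\<in>UNIV. x $ i * ((transpose A ** J) *v y) $ i)"
proof -
  have "bil J (A *v x) y = (\<Sum>i\<in>UNIV. \<Sum>j\<in>UNIV. A $ i $ j * x $ j * (J *v y) $ i)"
    by (simp add: bil_def matrix_vector_mult_def sum_distrib_right)
  also have "\<dots> = (\<Sum>j\<in>UNIV. \<Sum>i\<in>UNIV. A $ i $ j * x $ j * (J *v y) $ i)"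
    by (rule sum.swap)
  also have "\<dots> = (\<Sum>j\<in>UNIV. x $ j * (transpose A *v (J *v y)) $ j)"
    by (simp add: vector_matrix_mult_nth sum_distrib_left mult_ac)
  finally show ?thesis by (simp add: matrix_vector_mul_assoc)
qed

lemma bil_mult_right: "bil J x (A *v y) = (\<Sum>i\<in>UNIV. x $ i * ((J ** A) *v y) $ i)"
  by (simp add: bil_def matrix_vector_mul_assoc)

lemma sp_algebra_iff: "A \<in> sp_algebra J \<longleftrightarrow> (\<forall>x y. bil J (A *v x) y + bil J x (A *v y) = 0)"
proof -
  let ?M = "transpose A ** J + J ** A"
  have *: "bil J (A *v x) y + bil J x (A *v y) = (\<Sum>i\<in>UNIV. x $ i * (?M *v y) $ i)" for x y
    by (simp add: bil_mult_left bil_mult_right sum.distrib[symmetric] matrix_vector_mult_add_rdistrib algebra_simps)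
  have "?M = 0 \<longleftrightarrow> (\<forall>x y. (\<Sum>i\<in>UNIV. x $ i * (?M *v y) $ i) = 0)"
  proof
    assume a: "\<forall>x y. (\<Sum>i\<in>UNIV. x $ i * (?M *v y) $ i) = 0"
    have "(?M *v y) $ k = 0" for y k
      using a[rule_format, of "axis k 1" y]
      by (simp add: axis_def if_distrib[of "\<lambda>a. a * _"] cong: if_cong)
    then have "?M *v y = 0" for y by (simp add: vec_eq_iff)
    then show "?M = 0" by (simp add: matrix_eq)
  qed simp
  then show ?thesis by (simp add: sp_algebra_def *)
qed

lemma so_algebra_eq: "so_algebra = sp_algebra (mat 1)"
  by (auto simp: so_algebra_def sp_algebra_def add_eq_0_iff2)

lemma subspace_sp_algebra: "cmat.subspace (sp_algebra J)"
  by (auto simp: cmat.subspace_def sp_algebra_iff matrix_vector_mult_add_rdistrib cmat_scale_mult_vec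
      algebra_simps add_eq_0_iff2)

lemma bracket_sp_algebra:
  assumes "A \<in> sp_algebra J" "B \<in> sp_algebra J"
  shows "bracket A B \<in> sp_algebra J"
proof -
  have a: "bil J (A *v x) y = - bil J x (A *v y)" and b: "bil J (B *v x) y = - bil J x (B *v y)" for x y
    using assms by (simp_all add: sp_algebra_iff add_eq_0_iff)
  show ?thesis
    unfolding sp_algebra_iff bracket_mult_vec by (simp add: a b)
qed

text \<open>The sign \<open>eps\<close> lets so(n) (symmetric form, 1) and sp(2n) (skew form, -1)
  share one calculus.\<close>

locale eps_form =
  fixes J :: "complex^'m^'m" and eps :: complex
  assumes J: "transpose J = cmat_scale eps J" "invertible J" and eps: "eps = 1 \<or> eps = -1"
begin

lemma eps2 [simp]: "eps * eps = 1" "eps * (eps * x) = x"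
  using eps by auto

lemma bil_swap: "bil J y x = eps * bil J x y"
proof -
  have "bil J y x = (\<Sum>i\<in>UNIV. \<Sum>j\<in>UNIV. y $ i * (J $ i $ j * x $ j))"
    by (simp add: bil_def matrix_vector_mult_def sum_distrib_left)
  also have "\<dots> = (\<Sum>j\<in>UNIV. \<Sum>i\<in>UNIV. y $ i * (J $ i $ j * x $ j))" by (rule sum.swap)
  also have "\<dots> = (\<Sum>j\<in>UNIV. \<Sum>i\<in>UNIV. eps * (x $ j * (J $ j $ i * y $ i)))"
  proof (intro sum.cong refl)
    fix i j
    have "transpose J $ j $ i = eps * J $ j $ i" by (simp add: J)
    then have "J $ i $ j = eps * J $ j $ i" by (simp add: transpose_def)
    then show "y $ i * (J $ i $ j * x $ j) = eps * (x $ j * (J $ j $ i * y $ i))" by simp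
  qed
  also have "\<dots> = eps * bil J x y"
    by (simp add: bil_def matrix_vector_mult_def sum_distrib_left)
  finally show ?thesis .
qed

lemma nondeg: "(\<And>y. bil J y x = 0) \<Longrightarrow> x = 0"
proof -
  assume a: "\<And>y. bil J y x = 0"
  have "J *v x = 0" using a[of "axis _ 1"] by (simp add: vec_eq_iff bil_axis)
  then show "x = 0" using J(2) by (metis invertible_left_inverse matrix_left_invertible_ker)
qed

lemma nondeg_witness:
  assumes "x \<noteq> 0" obtains y where "bil J y x = 1"
proof -
  obtain z where z: "bil J z x \<noteq> 0" using nondeg assms by blast
  show ?thesis by (rule that[of "(1 / bil J z x) *s z"]) (simp add: z)
qed

text \<open>\<open>x\<close> wedge \<open>y\<close> for a symmetric form, the symmetric product of \<open>x\<close> and \<open>y\<close> for a skew form.\<close>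

definition E :: "complex^'m \<Rightarrow> complex^'m \<Rightarrow> complex^'m^'m" where
  "E x y = (\<chi> i j. x $ i * (transpose J *v y) $ j - eps * (y $ i * (transpose J *v x) $ j))"

lemma E_mult_vec: "E x y *v z = bil J y z *s x - (eps * bil J x z) *s y"
proof -
  have *: "(\<Sum>j\<in>UNIV. (transpose J *v y) $ j * z $ j) = bil J y z" for y z
  proof -
    have "(\<Sum>j\<in>UNIV. (transpose J *v y) $ j * z $ j) = (\<Sum>j\<in>UNIV. \<Sum>i\<in>UNIV. J $ i $ j * y $ i * z $ j)"
      by (simp add: matrix_vector_mult_def transpose_def sum_distrib_right)
    also have "\<dots> = (\<Sum>i\<in>UNIV. \<Sum>j\<in>UNIV. J $ i $ j * y $ i * z $ j)" by (rule sum.swap)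
    finally show ?thesis by (simp add: bil_def matrix_vector_mult_def sum_distrib_left mult_ac)
  qed
  have "(E x y *v z) $ i = x $ i * bil J y z - eps * (y $ i * bil J x z)" for i
    unfolding *[symmetric]
    by (simp add: E_def matrix_vector_mult_def[of _ z] sum_distrib_left sum_subtractf[symmetric] algebra_simps
        del: sum_subtractf)
  then show ?thesis by (simp add: vec_eq_iff mult_ac)
qed

lemma E_in [simp]: "E x y \<in> sp_algebra J"
proof -
  have "bil J (E x y *v a) b + bil J a (E x y *v b) = 0" for a b
    using bil_swap[of x a] bil_swap[of y a]
    by (simp add: E_mult_vec algebra_simps)
  then show ?thesis by (simp add: sp_algebra_iff)
qed

lemma E_linear:
  "E (x + y) z = E x z + E y z" "E z (x + y) = E z x + E z y"
  "E (c *s x) z = cmat_scale c (E x z)" "E z (c *s x) = cmat_scale c (E z x)"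
  "E (x - y) z = E x z - E y z" "E z (x - y) = E z x - E z y"
  "E 0 z = 0" "E z 0 = 0" "E (- x) z = - E x z" "E z (- x) = - E z x"
  by (simp_all add: E_def vec_eq_iff algebra_simps matrix_vector_right_distrib
      matrix_vector_mult_diff_distrib vec.scale vec.neg)

lemma E_sum: "E x (\<Sum>i\<in>B. f i) = (\<Sum>i\<in>B. E x (f i))" "E (\<Sum>i\<in>B. f i) x = (\<Sum>i\<in>B. E (f i) x)"
  by (induction B rule: infinite_finite_induct) (simp_all add: E_linear)

lemma E_swap: "E y x = cmat_scale (- eps) (E x y)"
  by (simp add: E_def vec_eq_iff algebra_simps)

lemma bil_sp:
  assumes "A \<in> sp_algebra J"
  shows "bil J (A *v x) y = - bil J x (A *v y)"
  using assms by (simp add: sp_algebra_iff add_eq_0_iff)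

lemma bracket_E:
  assumes "A \<in> sp_algebra J"
  shows "bracket A (E x y) = E (A *v x) y + E x (A *v y)"
  unfolding matrix_eq
  by (simp add: bracket_mult_vec E_mult_vec matrix_vector_mult_add_rdistrib bil_sp[OF assms]
      matrix_vector_mult_diff_distrib vec.scale algebra_simps)

lemma bracket_E_E:
  "bracket (E x y) (E z w) = cmat_scale (bil J y z) (E x w) - cmat_scale (eps * bil J x z) (E y w)
     + cmat_scale (bil J y w) (E z x) - cmat_scale (eps * bil J x w) (E z y)"
  by (simp add: bracket_E E_mult_vec E_linear)

text \<open>Apply \<open>E x y\<close> to a vector \<open>z\<close> with
  \<open>bil J x z = 1\<close> to express \<open>y\<close> by \<open>x\<close>. For a skew form,
  pairing this expression with \<open>z\<close> again shows that its coefficient is its own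
  negative: a symmetric product of nonzero vectors is nonzero.\<close>

lemma E_eq_0:
  assumes "E x y = 0" "x \<noteq> 0"
  obtains c where "y = c *s x" "eps = - 1 \<longrightarrow> y = 0"
proof -
  obtain z' where z': "bil J z' x = 1" using nondeg_witness[OF assms(2)] .
  define z where "z = eps *s z'"
  have z: "bil J x z = 1" using bil_swap[of x z'] z' by (simp add: z_def)
  have "bil J y z *s x - eps *s y = 0" using E_mult_vec[of x y z] assms(1) z by simp
  then have ye: "eps *s y = bil J y z *s x" by simp
  then have y: "y = (eps * bil J y z) *s x"
    by (metis eps2(2) vec.scale_scale vec.scale_one eps2(1))
  moreover have "y = 0" if "eps = -1"
  proof -
    have "bil J y z = - bil J y z" using arg_cong[OF y, of "\<lambda>y. bil J y z"] z that by simp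
    then have "bil J y z = 0" by simp
    then show ?thesis using y by simp
  qed
  ultimately show ?thesis using that by blast
qed

text \<open>As \<open>M\<close> is skew for the form, the two terms of \<open>E x y\<close>
  contribute equally.\<close>

lemma trace_E_mult:
  assumes "M \<in> sp_algebra J"
  shows "trace (E x y ** M) = 2 * bil J y (M *v x)"
proof -
  have *: "(\<Sum>i\<in>UNIV. \<Sum>k\<in>UNIV. x $ i * (transpose J *v y) $ k * M $ k $ i) = bil J y (M *v x)" for x y
  proof -
    have "(\<Sum>i\<in>UNIV. \<Sum>k\<in>UNIV. x $ i * (transpose J *v y) $ k * M $ k $ i) =
      (\<Sum>k\<in>UNIV. \<Sum>i\<in>UNIV. x $ i * (transpose J *v y) $ k * M $ k $ i)" by (rule sum.swap)
    also have "\<dots> = (\<Sum>k\<in>UNIV. (transpose J *v y) $ k * (M *v x) $ k)"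
      by (simp add: matrix_vector_mult_def[of M] sum_distrib_left mult_ac)
    also have "\<dots> = (\<Sum>k\<in>UNIV. \<Sum>i\<in>UNIV. J $ i $ k * y $ i * (M *v x) $ k)"
      by (simp add: vector_matrix_mult_nth sum_distrib_right)
    also have "\<dots> = (\<Sum>i\<in>UNIV. \<Sum>k\<in>UNIV. J $ i $ k * y $ i * (M *v x) $ k)" by (rule sum.swap)
    also have "\<dots> = bil J y (M *v x)"
      by (simp add: bil_def matrix_vector_mult_def[of J] sum_distrib_left mult_ac)
    finally show ?thesis .
  qed
  have "trace (E x y ** M) = (\<Sum>i\<in>UNIV. \<Sum>k\<in>UNIV. x $ i * (transpose J *v y) $ k * M $ k $ i)
      - eps * (\<Sum>i\<in>UNIV. \<Sum>k\<in>UNIV. y $ i * (transpose J *v x) $ k * M $ k $ i)"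
    by (simp add: trace_def matrix_matrix_mult_def E_def sum_distrib_left sum_subtractf[symmetric]
        left_diff_distrib right_diff_distrib mult_ac del: sum_subtractf)
  also have "\<dots> = bil J y (M *v x) - eps * bil J x (M *v y)" by (simp only: *)
  also have "bil J x (M *v y) = - (eps * bil J y (M *v x))"
    using bil_swap[of x "M *v y"] bil_sp[OF assms, of y x] by simp
  finally show ?thesis by simp
qed

lemma trace_E_E:
  "trace (E x y ** E z w) = 2 * (bil J w x * bil J y z - eps * bil J z x * bil J y w)"
  by (simp add: trace_E_mult E_mult_vec)

end

section \<open>Diagonalizability on the standard representation\<close>

lemma vec_not_spanned_by_2:
  assumes "CARD('m) \<ge> 3"
  obtains r :: "complex^'m" where "r \<notin> vec.span {x, y}"
proof -
  have "vec.span {x, y} \<noteq> UNIV"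
  proof
    assume a: "vec.span {x, y} = UNIV"
    have "vec.dim (UNIV :: (complex^'m) set) \<le> card {x, y}"
      by (rule vec.dim_le_card) (simp_all add: a)
    also have "\<dots> \<le> 2" by (simp add: card_insert_if)
    finally show False using assms by (simp add: card_cart_basis)
  qed
  then show ?thesis using that by blast
qed

lemma matrix_inv_left:
  fixes A :: "complex^'m^'m"
  assumes "invertible A"
  shows "matrix_inv A ** A = mat 1"
  using assms someI_ex[of "\<lambda>A'. A ** A' = mat 1 \<and> A' ** A = mat 1"]
  unfolding invertible_def matrix_inv_def by blast

text \<open>One eigenvector \<open>w\<close> exists, and some matrix \<open>X\<close> carries it to
  any given vector. Scalar matrices commute with \<open>H\<close>, so eigenvectors of
  \<open>bracket H\<close> span all matrices, and \<open>X *v w\<close> is a sum of eigenvectors of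
  \<open>H\<close>.\<close>

lemma sl_ad_semisimple_diagonalizable:
  fixes H :: "complex^'m^'m"
  assumes ss: "sl_algebra \<subseteq> cmat.span {X. \<exists>c. bracket H X = cmat_scale c X}"
  shows "vec.span {w. \<exists>c. H *v w = c *s w} = UNIV"
proof -
  obtain w c where w: "w \<noteq> 0" "H *v w = c *s w" by (rule complex_matrix_eigenvector)
  have one: "mat 1 \<in> cmat.span {X. \<exists>c. bracket H X = cmat_scale c X}"
    by (rule cmat.span_base) (auto simp: bracket_def intro!: exI[of _ 0])
  have all: "X \<in> cmat.span {X. \<exists>c. bracket H X = cmat_scale c X}" for X
  proof -
    have "X - cmat_scale (trace X / of_nat CARD('m)) (mat 1) \<in> sl_algebra"
      by (simp add: sl_algebra_def trace_def sum_subtractf mat_def)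
    then have "X - cmat_scale (trace X / of_nat CARD('m)) (mat 1) + cmat_scale (trace X / of_nat CARD('m)) (mat 1)
        \<in> cmat.span {X. \<exists>c. bracket H X = cmat_scale c X}"
      using ss one by (intro cmat.span_add cmat.span_scale) auto
    then show ?thesis by simp
  qed
  obtain k where k: "w $ k \<noteq> 0" using w(1) by (auto simp: vec_eq_iff)
  have "x \<in> vec.span {w. \<exists>c. H *v w = c *s w}" for x
  proof -
    define X where "X = (\<chi> i j. if j = k then x $ i / w $ k else 0)"
    have "X *v w = x" using k
      by (simp add: X_def vec_eq_iff matrix_vector_mult_def if_distrib[of "\<lambda>a. a * _"] cong: if_cong)
    then show ?thesis using ad_eigenvectors_act[OF all[of X] w(2)] by simp
  qed
  then show ?thesis by blast
qed

context eps_form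
begin

lemma eps_nonzero: "eps \<noteq> 0"
  using eps by auto

text \<open>If \<open>w'\<close> is an eigenvector and \<open>bil J y w' = 1\<close>, then
  \<open>E x y\<close> maps \<open>w'\<close> to \<open>x\<close> for every \<open>x\<close>
  orthogonal to \<open>w'\<close>. So the span of the eigenvectors contains a hyperplane, and one
  more vector outside it finishes the proof.\<close>

lemma ad_semisimple_diagonalizable:
  assumes ss: "sp_algebra J \<subseteq> cmat.span {X. \<exists>c. bracket H X = cmat_scale c X}"
    and dim: "eps = 1 \<longrightarrow> CARD('m) \<ge> 3"
  shows "vec.span {w. \<exists>c. H *v w = c *s w} = UNIV"
proof -
  let ?S = "vec.span {w. \<exists>c. H *v w = c *s w}"
  obtain w c where w: "w \<noteq> 0" "H *v w = c *s w" by (rule complex_matrix_eigenvector)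
  obtain y where y: "bil J y w = 1" using nondeg_witness[OF w(1)] .
  have act: "E a b *v w' \<in> ?S" if "H *v w' = d *s w'" for a b w' d
    by (rule ad_eigenvectors_act[OF _ that]) (use ss E_in in blast)
  have perp: "x \<in> ?S" if "w' \<noteq> 0" "H *v w' = d *s w'" "bil J x w' = 0" for x w' d
  proof -
    note w' = that
    obtain y where y: "bil J y w' = 1" using nondeg_witness[OF w'(1)] .
    show ?thesis using act[OF w'(2), of x y] by (simp add: E_mult_vec y w'(3))
  qed
  show ?thesis using eps
  proof
    assume e: "eps = -1"
    have "y \<in> ?S"
    proof -
      \<comment> \<open>For a skew form the two terms of \<open>E y y\<close> agree, so half of it
        maps \<open>w\<close> to \<open>y\<close>, which lies outside the complement of
        \<open>w\<close>.\<close>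
      have "E ((1/2) *s y) y *v w = y"
        unfolding E_mult_vec using y e by (simp add: vec_eq_iff)
      then show ?thesis using act[OF w(2), of "(1/2) *s y" y] by simp
    qed
    then have "x \<in> ?S" for x
    proof -
      have "x - bil J x w *s y \<in> ?S" by (rule perp[OF w]) (simp add: y)
      then have "(x - bil J x w *s y) + bil J x w *s y \<in> ?S"
        using \<open>y \<in> ?S\<close> by (intro vec.span_add vec.span_scale)
      then show ?thesis by simp
    qed
    then show ?thesis by blast
  next
    assume e: "eps = 1"
    \<comment> \<open>An isotropic eigenvector lies in its own complement. Wanted is one that is not
      isotropic, or one independent of \<open>w\<close>, since then the two complements differ.
      Without either the span would lie in the line of \<open>w\<close>, yet it contains a
      hyperplane in dimension at least 3.\<close>
    have "\<exists>w' d. w' \<noteq> 0 \<and> H *v w' = d *s w' \<and> (bil J w' w' \<noteq> 0 \<or> w' \<notin> vec.span {w})"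
    proof (rule ccontr)
      assume a: "\<not> ?thesis"
      have "{w. \<exists>c. H *v w = c *s w} \<subseteq> vec.span {w}"
      proof
        fix u assume "u \<in> {w. \<exists>c. H *v w = c *s w}"
        then obtain c where u: "H *v u = c *s u" by auto
        show "u \<in> vec.span {w}"
        proof (cases "u = 0")
          case True
          then show ?thesis by (simp only: vec.span_zero)
        next
          case False
          then show ?thesis using a u by auto
        qed
      qed
      then have S: "?S \<subseteq> vec.span {w}" by (rule vec.span_minimal[OF _ vec.subspace_span])
      obtain r where r: "r \<notin> vec.span {w, y}"
        by (rule vec_not_spanned_by_2) (use dim e in auto)
      have "r - bil J r w *s y \<in> ?S" by (rule perp[OF w]) (simp add: y)
      then have "r - bil J r w *s y \<in> vec.span {w, y}"
        using S vec.span_mono[of "{w}" "{w, y}"] by blast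
      then have "(r - bil J r w *s y) + bil J r w *s y \<in> vec.span {w, y}"
        by (intro vec.span_add vec.span_scale vec.span_base[of y]) auto
      then show False using r by simp
    qed
    then obtain w' d where w': "w' \<noteq> 0" "H *v w' = d *s w'" "bil J w' w' \<noteq> 0 \<or> w' \<notin> vec.span {w}"
      by blast
    have "\<exists>z\<in>?S. bil J z w' \<noteq> 0"
    proof (cases "bil J w' w' = 0")
      case False
      then show ?thesis using w' by (intro bexI[of _ w'] vec.span_base) auto
    next
      case True
      show ?thesis
      proof (rule ccontr)
        assume a: "\<not> ?thesis"
        have "bil J z (w' - bil J y w' *s w) = 0" for z
        proof -
          have "z - bil J z w *s y \<in> ?S" by (rule perp[OF w]) (simp add: y)
          then have "bil J (z - bil J z w *s y) w' = 0" using a by blast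
          then show ?thesis by (simp add: mult.commute)
        qed
        then have "w' - bil J y w' *s w = 0" by (rule nondeg)
        then have "w' = bil J y w' *s w" by simp
        then have "w' \<in> vec.span {w}" by (metis insertI1 vec.span_base vec.span_scale)
        then show False using w'(3) True by blast
      qed
    qed
    then obtain z where z: "z \<in> ?S" "bil J z w' \<noteq> 0" by blast
    have "x \<in> ?S" for x
    proof -
      have "x - (bil J x w' / bil J z w') *s z \<in> ?S" by (rule perp[OF w'(1,2)]) (simp add: z)
      then have "(x - (bil J x w' / bil J z w') *s z) + (bil J x w' / bil J z w') *s z \<in> ?S"
        using z by (intro vec.span_add vec.span_scale)
      then show ?thesis by simp
    qed
    then show ?thesis by blast
  qed
qed

end

section \<open>Location of the highest weight for so(n) and sp(2n)\<close>

locale form_cartan = eps_form J eps for J :: "complex^'m^'m" and eps +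
  fixes H v :: "complex^'m^'m" and \<theta> :: complex
  assumes H: "H \<in> sp_algebra J"
    and comm: "\<And>X Y. X \<in> sp_algebra J \<Longrightarrow> Y \<in> sp_algebra J \<Longrightarrow> bracket H X = 0 \<Longrightarrow> bracket H Y = 0
        \<Longrightarrow> bracket X Y = 0"
    and realv: "\<And>X c. X \<in> sp_algebra J \<Longrightarrow> X \<noteq> 0 \<Longrightarrow> bracket H X = cmat_scale c X \<Longrightarrow> c \<in> \<real>"
    and pos: "\<And>X c. X \<in> sp_algebra J \<Longrightarrow> bracket H X = cmat_scale c X \<Longrightarrow> Re c > 0 \<Longrightarrow> bracket X v = 0"
    and v: "v \<in> sp_algebra J" "v \<noteq> 0" "bracket H v = cmat_scale \<theta> v"
    and ss: "sp_algebra J \<subseteq> cmat.span {X. \<exists>c. bracket H X = cmat_scale c X}"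
begin

lemma eigen_E: "H *v x = a *s x \<Longrightarrow> H *v y = b *s y \<Longrightarrow> bracket H (E x y) = cmat_scale (a + b) (E x y)"
  by (simp add: bracket_E[OF H] E_linear cmat.scale_left_distrib)

lemma eigen_bil:
  assumes "H *v x = a *s x" "H *v y = b *s y" "bil J x y \<noteq> 0"
  shows "a + b = 0"
proof -
  have "a * bil J x y + b * bil J x y = 0" using bil_sp[OF H, of x y] assms(1,2) by simp
  then show ?thesis using assms(3) by (simp add: ring_distribs(2)[symmetric])
qed

lemma eigen_v:
  assumes "H *v x = a *s x"
  shows "H *v (v *v x) = (\<theta> + a) *s (v *v x)"
proof -
  have "H *v (v *v x) = v *v (H *v x) + bracket H v *v x" by (simp add: bracket_mult_vec)
  then show ?thesis by (simp add: v assms cmat_scale_mult_vec vec.scale vec.scale_left_distrib add.commute)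
qed

text \<open>The tool for locating \<open>v\<close>: its annihilation by positive eigenvectors
  becomes a system of equations between the vectors \<open>v *v x i\<close>.\<close>

lemma pos_E:
  assumes "H *v x = a *s x" "H *v y = b *s y" "Re (a + b) > 0"
  shows "E (v *v x) y + E x (v *v y) = 0"
proof -
  have "bracket (E x y) v = 0" by (rule pos[OF E_in eigen_E[OF assms(1,2)] assms(3)])
  then have "bracket v (E x y) = 0" by (simp add: bracket_anticomm[of _ v])
  then show ?thesis by (simp add: bracket_E[OF v(1)])
qed

end

text \<open>The eigenbasis is not assumed to be adapted to the form; \<open>partner\<close> and
  \<open>dual\<close> take the place of a hyperbolic basis.\<close>

locale form_cartan_basis = form_cartan J eps H v \<theta>
  for J :: "complex^'m^'m" and eps H v \<theta> +
  fixes Q :: "complex^'m^'m" and e :: "'m \<Rightarrow> complex"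
  assumes Q: "invertible Q" and eig: "\<And>i. H *v column i Q = e i *s column i Q"
begin

abbreviation "x \<equiv> \<lambda>i. column i Q"

lemma bil_basis_nonzero:
  assumes "y \<noteq> 0" obtains i where "bil J (x i) y \<noteq> 0"
proof (rule ccontr)
  assume a: "\<not> thesis"
  have "bil J z y \<in> {0}" for z
  proof (rule columns_induct[OF Q, where sc = "(*)" and f = "\<lambda>z. bil J z y"])
    show "Vector_Spaces.linear (*s) (*) (\<lambda>z. bil J z y)"
      by unfold_locales (simp_all add: algebra_simps)
    show "module.subspace (*) {0 :: complex}"
      using vector_space_over_itself.subspace_single_0 by blast
  qed (use a that in blast)
  then have "y = 0" using nondeg by simp
  then show False using assms by simp
qed

lemma x_nonzero: "x i \<noteq> 0"
proof
  assume "x i = 0"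
  then have "Q *v axis i 1 = 0" by (simp add: matrix_vector_mul_component vec_eq_iff column_def matrix_vector_mult_def axis_def if_distrib cong: if_cong)
  then show False using Q by (metis axis_eq_0_iff invertible_left_inverse matrix_left_invertible_ker zero_neq_one)
qed

lemma ex_dual: "\<exists>d. \<forall>j. bil J (x j) d = (if j = i then 1 else 0)"
proof -
  \<comment> \<open>The right-hand side is row \<open>i\<close> of the inverse of \<open>Q\<close>,
    so pairing with column \<open>j\<close> of \<open>Q\<close> gives an entry of the identity
    matrix.\<close>
  have "\<exists>d. J *v d = axis i 1 v* matrix_inv Q"
    using J(2) by (metis invertible_right_inverse matrix_vector_mul_assoc matrix_vector_mul_lid)
  then obtain d where d: "J *v d = axis i 1 v* matrix_inv Q" by blast
  have *: "bil J (x j) d = (matrix_inv Q ** Q) $ i $ j" for j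
    by (simp add: bil_def d column_def matrix_matrix_mult_def vector_matrix_mult_def axis_def
        if_distrib[of "\<lambda>a. a * _"] if_distrib[of "\<lambda>a. _ * a"] mult.commute cong: if_cong)
  show ?thesis by (rule exI[of _ d]) (auto simp: * matrix_inv_left[OF Q] mat_def)
qed

definition dual :: "'m \<Rightarrow> complex^'m" where
  "dual i = (SOME d. \<forall>j. bil J (x j) d = (if j = i then 1 else 0))"

lemma bil_dual [simp]: "bil J (x j) (dual i) = (if j = i then 1 else 0)"
  using someI_ex[OF ex_dual[of i]] unfolding dual_def by blast

lemma E_basis_nonzero:
  assumes "i \<noteq> j \<or> eps = -1"
  shows "E (x i) (x j) \<noteq> 0"
proof
  assume "E (x i) (x j) = 0"
  then obtain c where c: "x j = c *s x i" "eps = -1 \<longrightarrow> x j = 0"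
    by (rule E_eq_0[OF _ x_nonzero])
  then have "i \<noteq> j" using assms x_nonzero by auto
  then have "bil J (x j) (dual j) = 0" unfolding c(1) bil_linear bil_dual by simp
  then show False by simp
qed

lemma partner: obtains j where "e j = - e i" "bil J (x i) (x j) \<noteq> 0"
proof -
  obtain j where j: "bil J (x j) (x i) \<noteq> 0" using bil_basis_nonzero x_nonzero by blast
  then have "bil J (x i) (x j) \<noteq> 0" using bil_swap[of "x j" "x i"] by auto
  moreover have "e j = - e i" using eigen_bil[OF eig eig j] by (simp add: add_eq_0_iff2)
  ultimately show ?thesis using that by blast
qed

text \<open>Otherwise take \<open>a\<close> with eigenvalue \<open>- e i\<close> and pairing 1 with
  \<open>x i\<close>, and a nonzero \<open>y\<close> with eigenvalue \<open>e i\<close> orthogonal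
  to \<open>a\<close>. Both \<open>E (x i) a\<close> and \<open>E y a\<close> commute with
  \<open>H\<close>, but their bracket is a nonzero multiple of \<open>E y a\<close>.\<close>

lemma e_simple:
  assumes "e i \<noteq> 0" "e i = e j"
  shows "i = j"
proof (rule ccontr)
  assume ij: "i \<noteq> j"
  obtain k where k: "e k = - e i" "bil J (x i) (x k) \<noteq> 0" by (rule partner)
  define a where "a = (1 / bil J (x i) (x k)) *s x k"
  have a: "H *v a = (- e i) *s a" "bil J (x i) a = 1"
    using k eig[of k] by (simp_all add: a_def vec.scale mult.commute)
  define y where "y = x j - bil J (x j) a *s x i"
  have y: "H *v y = e i *s y" "bil J y a = 0"
    using a eig[of i] eig[of j] assms(2)
    by (simp_all add: y_def vec.scale matrix_vector_mult_diff_distrib vec.scale_right_diff_distrib mult.commute)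
  have aa: "bil J a a = 0" using eigen_bil[OF a(1) a(1)] assms(1) by auto
  have xy: "bil J (x i) y = 0" using eigen_bil[OF eig[of i] y(1)] assms(1) by auto
  have ay: "bil J a y = 0" using bil_swap[of a y] y(2) by simp
  have "bracket (E (x i) a) (E y a) = 0"
  proof (rule comm[OF E_in E_in])
    show "bracket H (E (x i) a) = 0" using eigen_E[OF eig[of i] a(1)] by simp
    show "bracket H (E y a) = 0" using eigen_E[OF y(1) a(1)] by simp
  qed
  then have "cmat_scale eps (E y a) = 0"
    unfolding bracket_E_E aa xy ay a(2) by (simp add: cmat.scale_minus_left)
  then have Ey: "E y a = 0" using eps_nonzero by (simp add: cmat.scale_eq_0_iff)
  have "y \<noteq> 0"
  proof
    assume "y = 0"
    then have "bil J y (dual j) = 0" by simp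
    then show False using ij by (simp add: y_def)
  qed
  then obtain c where "a = c *s y" by (rule E_eq_0[OF Ey])
  then have "H *v a = e i *s a" using y(1) by (simp add: vec.scale mult.commute)
  then have "(2 * e i) *s a = 0" using a(1) by (simp add: vec_eq_iff)
  moreover have "a \<noteq> 0" using a(2) by auto
  ultimately show False using assms(1) by simp
qed

text \<open>Any such pair determines \<open>\<theta>\<close> as \<open>- e i - e j\<close>, so it
  remains to show that \<open>v\<close> annihilates all but the lowest eigenvectors.\<close>

lemma v_pairing:
  obtains i j where "bil J (v *v x i) (x j) \<noteq> 0"
proof (rule ccontr)
  assume a: "\<not> thesis"
  have "v *v x i = 0" for i
  proof (rule ccontr)
    assume "v *v x i \<noteq> 0"
    then obtain j where "bil J (x j) (v *v x i) \<noteq> 0" by (rule bil_basis_nonzero)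
    then have "bil J (v *v x i) (x j) \<noteq> 0" using bil_swap[of "x j" "v *v x i"] by auto
    then show False using a that by blast
  qed
  then have "v *v z \<in> {0}" for z
    by - (rule columns_induct[OF Q, where sc = "(*s)" and f = "(*v) v"],
      auto intro: vec.linear_axioms vec.subspace_single_0)
  then have "v = 0" by (simp add: matrix_eq)
  then show False using v by simp
qed

end

lemma third_index:
  fixes i j :: "'m::finite"
  assumes "CARD('m) \<ge> 3"
  obtains k where "k \<noteq> i" "k \<noteq> j"
proof -
  have "(UNIV :: 'm set) \<noteq> {i, j}"
    using assms card_length[of "[i, j]"] by (metis One_nat_def Suc_1 le_trans list.set(1,2) list.size(3,4) not_less_eq_eq numeral_3_eq_3 plus_1_eq_Suc add.commute)
  then show ?thesis using that by blast
qed

lemma finite_has_greatest: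
  fixes f :: "'a \<Rightarrow> real"
  assumes "finite A" "A \<noteq> {}"
  obtains t where "t \<in> A" "\<And>i. i \<in> A \<Longrightarrow> f i \<le> f t"
proof -
  have "Max (f ` A) \<in> f ` A" using assms by (intro Max_in) auto
  then obtain t where t: "t \<in> A" "Max (f ` A) = f t" by auto
  have "f i \<le> f t" if "i \<in> A" for i
    unfolding t(2)[symmetric] using assms(1) that by (intro Max_ge) auto
  then show ?thesis using that t(1) by blast
qed

context form_cartan_basis
begin

lemma partner_real_bound:
  assumes "\<And>j. Re (e j) \<le> T"
  shows "Re (e i) \<ge> - T"
proof -
  obtain j where "e j = - e i" by (rule partner)
  then show ?thesis using assms[of j] by simp
qed

lemma v_pairing_swap: "bil J (v *v x i) (x j) = - bil J (x i) (v *v x j)"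
  by (rule bil_sp[OF v(1)])

lemma v_pairing_weight:
  assumes "bil J (v *v x i) (x j) \<noteq> 0"
  shows "\<theta> = - e i - e j"
  using eigen_bil[OF eigen_v[OF eig] eig assms] by (simp add: algebra_simps add_eq_0_iff2)

lemma dual_ext:
  assumes "\<And>j. bil J y (dual j) = bil J z (dual j)"
  shows "y = z"
proof -
  define a where "a = matrix_inv Q *v (y - z)"
  obtain R where "Q ** R = mat 1" "R ** Q = mat 1" using Q by (auto simp: invertible_def)
  then have "Q *v a = y - z"
    unfolding a_def matrix_vector_mul_assoc
    by (metis Q matrix_inv_left matrix_left_right_inverse matrix_vector_mul_lid)
  then have yz: "y - z = (\<Sum>i\<in>UNIV. a $ i *s x i)" by (simp add: matrix_mult_sum)
  have "a $ j = 0" for j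
  proof -
    have "bil J (y - z) (dual j) = a $ j"
      unfolding yz by (simp add: bil_sum if_distrib cong: if_cong)
    then show ?thesis using assms[of j] by simp
  qed
  then have "y - z = 0" unfolding yz by simp
  then show ?thesis by simp
qed

text \<open>\<open>E (x t)\<close> is injective, so the equations of \<open>pos_E\<close> show first
  that \<open>v\<close> kills \<open>x t\<close>, then every \<open>x i\<close> with eigenvalue
  above \<open>- e t\<close>. Only the lowest eigenvalue \<open>- e t\<close> is left on both sides
  of the pairing.\<close>

lemma skew_highest_weight:
  assumes eps: "eps = -1"
  obtains t where "\<And>i. Im (e i) = 0" "\<And>i. i \<noteq> t \<Longrightarrow> Re (e i) < Re (e t)" "\<theta> = 2 * e t"
proof -
  have im: "Im (e i) = 0" for i
  proof -
    have "E (x i) (x i) \<noteq> 0" by (rule E_basis_nonzero) (simp add: eps)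
    then have "e i + e i \<in> \<real>" using realv[OF E_in] eigen_E[OF eig eig] by blast
    then show ?thesis by (simp add: complex_is_Real_iff)
  qed
  obtain t where t: "\<And>i. Re (e i) \<le> Re (e t)"
    using finite_has_greatest[of UNIV "\<lambda>i. Re (e i)"] by auto
  have low: "Re (e i) \<ge> - Re (e t)" for i by (rule partner_real_bound) (rule t)
  \<comment> \<open>If the largest eigenvalue is 0, all are, and everything commutes with
    \<open>H\<close>; then the squares of \<open>x t\<close> and of its partner would have to
    commute.\<close>
  have et: "e t \<noteq> 0"
  proof
    assume 0: "e t = 0"
    then have e0: "e i = 0" for i using t[of i] low[of i] im[of i] by (simp add: complex_eq_iff)
    obtain j where j: "bil J (x t) (x j) \<noteq> 0" by (rule partner)
    have "bracket (E (x t) (x t)) (E (x j) (x j)) = 0"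
      by (rule comm[OF E_in E_in]) (use eigen_E[OF eig eig] e0 in auto)
    then have "cmat_scale (4 * bil J (x t) (x j)) (E (x t) (x j)) = 0"
      unfolding bracket_E_E using E_swap[of "x t" "x j"] eps
      by (simp add: vec_eq_iff algebra_simps)
    then have "E (x t) (x j) = 0" using j by (simp add: cmat.scale_eq_0_iff)
    then show False using E_basis_nonzero[of t j] eps by simp
  qed
  have strict: "Re (e i) < Re (e t)" if "i \<noteq> t" for i
  proof (rule ccontr)
    assume "\<not> Re (e i) < Re (e t)"
    then have "e t = e i" using t[of i] im by (simp add: complex_eq_iff)
    then show False using e_simple[OF et] that by blast
  qed
  have tpos: "Re (e t) > 0"
    using low[of t] et im[of t] by (cases "Re (e t) = 0") (auto simp: complex_eq_iff)
  have Ezero: "y = 0" if "E (x t) y = 0" for y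
    by (rule E_eq_0[OF that x_nonzero]) (simp add: eps)
  have vt: "v *v x t = 0"
  proof -
    have "E (v *v x t) (x t) + E (x t) (v *v x t) = 0"
      by (rule pos_E[OF eig eig]) (simp add: tpos)
    then have "cmat_scale 2 (E (x t) (v *v x t)) = 0"
      using E_swap[of "v *v x t" "x t"] eps by (simp add: vec_eq_iff)
    then show ?thesis using Ezero by (simp add: cmat.scale_eq_0_iff)
  qed
  have vi: "v *v x i = 0" if "Re (e i) > - Re (e t)" for i
  proof -
    have "E (v *v x t) (x i) + E (x t) (v *v x i) = 0"
      by (rule pos_E[OF eig eig]) (use that in simp)
    then show ?thesis using vt Ezero by (simp add: E_linear)
  qed
  obtain i j where ij: "bil J (v *v x i) (x j) \<noteq> 0" by (rule v_pairing)
  then have "Re (e i) \<le> - Re (e t)" using vi[of i] by (cases "Re (e i) > - Re (e t)") auto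
  moreover have "Re (e j) \<le> - Re (e t)" using ij vi[of j] unfolding v_pairing_swap
    by (cases "Re (e j) > - Re (e t)") auto
  ultimately have "e i = - e t" "e j = - e t"
    using low[of i] low[of j] im by (simp_all add: complex_eq_iff)
  then have "\<theta> = 2 * e t" using v_pairing_weight[OF ij] by simp
  then show ?thesis using that[of t] im strict by auto
qed

lemma E_independent:
  assumes 0: "cmat_scale a (E (x i) (x k)) + cmat_scale b (E (x j) (x k)) + cmat_scale c (E (x j) (x i)) = 0"
    and d: "i \<noteq> j" "i \<noteq> k" "j \<noteq> k"
  shows "a = 0" "b = 0" "c = 0"
proof -
  have ap: "a *s (E (x i) (x k) *v z) + b *s (E (x j) (x k) *v z) + c *s (E (x j) (x i) *v z) = 0" for z
    using arg_cong[OF 0, of "\<lambda>M. M *v z"]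
    by (simp add: matrix_vector_mult_add_rdistrib cmat_scale_mult_vec)
  have "bil J (a *s x i + b *s x j) (dual i) = 0" "bil J (a *s x i + b *s x j) (dual j) = 0"
    using arg_cong[OF ap[of "dual k"], of "\<lambda>w. bil J w (dual i)"]
      arg_cong[OF ap[of "dual k"], of "\<lambda>w. bil J w (dual j)"] d
    by (simp_all add: E_mult_vec)
  then show "a = 0" "b = 0" using d by simp_all
  then show "c = 0"
    using arg_cong[OF ap[of "dual i"], of "\<lambda>w. bil J w (dual j)"] d by (simp add: E_mult_vec)
qed

text \<open>The weight belongs to the wedge of the two top eigenvectors. Dimension 5 guarantees two
  positive eigenvalues and an index other than these two and their partners.\<close>

lemma symmetric_highest_weight:
  assumes eps: "eps = 1" and card: "CARD('m) \<ge> 5"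
  obtains t s where "t \<noteq> s" "\<And>i. Im (e i) = 0" "Re (e s) < Re (e t)" "0 < Re (e s)"
    "\<And>i. i \<noteq> t \<Longrightarrow> i \<noteq> s \<Longrightarrow> Re (e i) < Re (e s)" "\<theta> = e t + e s"
proof -
  have card_le: "\<exists>k. k \<notin> A" if "card A < 5" for A :: "'m set"
  proof (rule ccontr)
    assume "\<not> ?thesis"
    then have "A = UNIV" by blast
    then show False using that card by simp
  qed
  have sumreal: "Im (e i + e j) = 0" if "i \<noteq> j" for i j
  proof -
    have "E (x i) (x j) \<noteq> 0" by (rule E_basis_nonzero) (simp add: that)
    then have "e i + e j \<in> \<real>" using realv[OF E_in] eigen_E[OF eig eig] by blast
    then show ?thesis by (simp add: complex_is_Real_iff)
  qed
  have im: "Im (e i) = 0" for i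
  proof -
    obtain j where j: "j \<notin> {i}" using card_le[of "{i}"] by auto
    obtain k where k: "k \<notin> {i, j}" using card_le[of "{i, j}"] j by auto
    \<comment> \<open>Three pairwise sums are real, hence so is each of the three terms.\<close>
    show ?thesis using sumreal[of i j] sumreal[of i k] sumreal[of j k] j k by auto
  qed
  define P where "P = {i. Re (e i) > 0}"
  define N where "N = {i. Re (e i) < 0}"
  define Z where "Z = {i. e i = 0}"
  \<comment> \<open>On the zero eigenspace all \<open>E\<close> commute with \<open>H\<close>, hence
    with each other. For three distinct indices this makes the pairings vanish, so more than two
    zero eigenvalues would leave one of them without a partner.\<close>
  have Z3: "bil J (x j) (x j) = 0 \<and> bil J (x i) (x j) = 0"
    if "i \<in> Z" "j \<in> Z" "k \<in> Z" "i \<noteq> j" "i \<noteq> k" "j \<noteq> k" for i j k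
  proof -
    have "bracket (E (x i) (x j)) (E (x j) (x k)) = 0"
      by (rule comm[OF E_in E_in])
        (use eigen_E[OF eig[of i] eig[of j]] eigen_E[OF eig[of j] eig[of k]] that in \<open>auto simp: Z_def\<close>)
    moreover have "E (x j) (x j) = 0" using E_swap[of "x j" "x j"] eps by (simp add: vec_eq_iff)
    ultimately have "cmat_scale (bil J (x j) (x j)) (E (x i) (x k))
       + cmat_scale (- bil J (x i) (x j)) (E (x j) (x k)) + cmat_scale (bil J (x j) (x k)) (E (x j) (x i)) = 0"
      unfolding bracket_E_E by (simp add: eps vec_eq_iff)
    from E_independent[OF this] that show ?thesis by auto
  qed
  have "card Z \<le> 2"
  proof (rule ccontr)
    assume c3: "\<not> card Z \<le> 2"
    have ex: "\<exists>k\<in>Z. k \<notin> A" if "card A \<le> 2" "finite A" for A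
    proof (rule ccontr)
      assume "\<not> ?thesis"
      then have "Z \<subseteq> A" by blast
      then show False using card_mono[OF that(2), of Z] that(1) c3 by simp
    qed
    obtain i where i: "i \<in> Z" using ex[of "{}"] by auto
    obtain j where j: "e j = - e i" "bil J (x i) (x j) \<noteq> 0" by (rule partner)
    have jZ: "j \<in> Z" using i j by (simp add: Z_def)
    have card2: "card {a, b} \<le> 2" for a b :: 'm by (cases "a = b") auto
    obtain l where l: "l \<in> Z" "l \<notin> {i, j}" using ex[OF card2, of i j] by auto
    obtain k where k: "k \<in> Z" "k \<notin> {i, l}" using ex[OF card2, of i l] by auto
    show False
    proof (cases "i = j")
      case True
      then show False using Z3[of l i k] l k i j by auto
    next
      case False
      then show False using Z3[of i j l] l i jZ j by auto
    qed
  qed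
  moreover have "card N \<le> card P"
  proof -
    have "\<forall>i. \<exists>j. e j = - e i" using partner by metis
    then obtain p where p: "\<And>i. e (p i) = - e i" by metis
    show ?thesis
    proof (rule card_inj_on_le[of p])
      show "inj_on p N"
      proof (rule inj_onI)
        fix i j assume ij: "i \<in> N" "p i = p j"
        have "e i = e j" using p[of i] p[of j] ij(2) by simp
        moreover have "e i \<noteq> 0" using ij(1) by (auto simp: N_def)
        ultimately show "i = j" using e_simple by blast
      qed
      show "p ` N \<subseteq> P" using p by (auto simp: N_def P_def)
    qed simp
  qed
  moreover have "CARD('m) \<le> card P + card N + card Z"
  proof -
    have U: "(UNIV :: 'm set) = P \<union> N \<union> Z" using im by (auto simp: P_def N_def Z_def complex_eq_iff)
    have "CARD('m) \<le> card (P \<union> N) + card Z" unfolding U by (rule card_Un_le)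
    also have "card (P \<union> N) \<le> card P + card N" by (rule card_Un_le)
    finally show ?thesis by simp
  qed
  \<comment> \<open>At most two eigenvalues vanish and at most half of the others are negative, so
    \<open>5 \<le> 2 * card P + 2\<close>.\<close>
  ultimately have P2: "card P \<ge> 2" using card by linarith
  have "P \<noteq> {}" using P2 by auto
  then obtain t where t: "t \<in> P" "\<And>i. i \<in> P \<Longrightarrow> Re (e i) \<le> Re (e t)"
    using finite_has_greatest[of P "\<lambda>i. Re (e i)"] by auto
  have "P - {t} \<noteq> {}"
  proof
    assume "P - {t} = {}"
    then have "P \<subseteq> {t}" by blast
    then show False using card_mono[of "{t}" P] P2 by simp
  qed
  then obtain s where s: "s \<in> P - {t}" "\<And>i. i \<in> P - {t} \<Longrightarrow> Re (e i) \<le> Re (e s)"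
    using finite_has_greatest[of "P - {t}" "\<lambda>i. Re (e i)"] by auto
  have spos: "Re (e s) > 0" and st: "s \<noteq> t" using s by (auto simp: P_def)
  have eq: "i = j" if "Re (e i) = Re (e j)" "Re (e i) \<noteq> 0" for i j
    using e_simple[of i j] that im by (auto simp: complex_eq_iff)
  have les: "Re (e i) < Re (e s)" if "i \<noteq> t" "i \<noteq> s" for i
  proof (cases "i \<in> P")
    case True
    then show ?thesis using s(2)[of i] eq[of i s] that spos by force
  next
    case False
    then show ?thesis using spos by (simp add: P_def)
  qed
  have lst: "Re (e s) < Re (e t)" using t(2)[of s] s eq[of s t] st spos by force
  obtain t' where t': "e t' = - e t" by (rule partner)
  obtain s' where s': "e s' = - e s" by (rule partner)
  have low: "Re (e i) > - Re (e s)" if "i \<noteq> t'" "i \<noteq> s'" for i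
  proof -
    obtain j where j: "e j = - e i" by (rule partner)
    have "j \<noteq> t" using that(1) j t' eq[of i t'] lst spos by auto
    moreover have "j \<noteq> s" using that(2) j s' eq[of i s'] spos by auto
    ultimately show ?thesis using les[of j] j by simp
  qed
  \<comment> \<open>The eigenvalue of \<open>r\<close> lies strictly between \<open>- e s\<close>
    and \<open>e s\<close>, so \<open>r\<close> has a positive sum with \<open>s\<close> as well as
    with \<open>t\<close>.\<close>
  obtain r where "r \<notin> {t, s, t', s'}" using card_le[of "{t, s, t', s'}"] card_length[of "[t, s, t', s']"] by fastforce
  then have r: "r \<noteq> t" "r \<noteq> s" "Re (e r) > - Re (e s)" using low[of r] by auto
  have comb: "E (v *v x i) (x j) + E (x i) (v *v x j) = 0" if "Re (e i) + Re (e j) > 0" for i j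
    by (rule pos_E[OF eig eig]) (use that in simp)
  define c where "c = bil J (v *v x t) (dual t)"
  \<comment> \<open>Compares the coefficient at the wedge of \<open>x j\<close> and
    \<open>x i\<close> in the equation for \<open>t\<close> and \<open>i\<close>. Since
    \<open>j\<close> must differ from \<open>i\<close>, two choices are needed: \<open>i = s\<close>
    and \<open>i = r\<close> together reach every \<open>j\<close> other than
    \<open>t\<close>.\<close>
  have coef: "bil J (v *v x t) (dual j) = 0" if "i \<noteq> t" "j \<noteq> t" "j \<noteq> i" "Re (e i) + Re (e t) > 0" for i j
  proof -
    have "(E (v *v x t) (x i) + E (x t) (v *v x i)) *v dual j = 0" using comb[of t i] that by simp
    then have "bil J ((E (v *v x t) (x i) + E (x t) (v *v x i)) *v dual j) (dual i) = 0" by simp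
    then show ?thesis
      unfolding matrix_vector_mult_add_rdistrib E_mult_vec bil_linear using that by (simp add: eps)
  qed
  have coef0: "bil J (v *v x t) (dual j) = 0" if "j \<noteq> t" for j
    using coef[of s j] coef[of r j] that st r spos lst by (cases "j = s") auto
  have vt: "v *v x t = c *s x t"
    by (rule dual_ext) (use coef0 in \<open>auto simp: c_def\<close>)
  have "\<exists>\<delta>. v *v x i = \<delta> *s x t - c *s x i" if "i \<noteq> t" "Re (e i) + Re (e t) > 0" for i
  proof -
    have "E (x t) (c *s x i + v *v x i) = 0"
      using comb[of t i] that by (simp add: vt E_linear)
    then obtain \<delta> where "c *s x i + v *v x i = \<delta> *s x t" by (rule E_eq_0[OF _ x_nonzero])
    then have "v *v x i = \<delta> *s x t - c *s x i" by (simp add: eq_diff_eq add.commute)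
    then show ?thesis by blast
  qed
  then obtain \<delta> where vd: "\<And>i. i \<noteq> t \<Longrightarrow> Re (e i) + Re (e t) > 0 \<Longrightarrow> v *v x i = \<delta> i *s x t - c *s x i"
    by metis
  \<comment> \<open>In the equation for \<open>s\<close> and \<open>i\<close>, the known shapes of
    \<open>v *v x s\<close> and \<open>v *v x i\<close> leave a combination of three independent
    wedges.\<close>
  have third: "- 2 * c = 0" "\<delta> s = 0" "\<delta> i = 0" if "i \<noteq> t" "i \<noteq> s" "Re (e i) > - Re (e s)" for i
  proof -
    have "E (v *v x s) (x i) + E (x s) (v *v x i) = 0" using comb[of s i] that by simp
    then have "cmat_scale (\<delta> s) (E (x t) (x i)) + cmat_scale (- 2 * c) (E (x s) (x i))
        + cmat_scale (\<delta> i) (E (x s) (x t)) = 0"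
      using vd[of s] vd[of i] that st spos lst by (simp add: E_linear vec_eq_iff algebra_simps)
    from E_independent[OF this] that st show "- 2 * c = 0" "\<delta> s = 0" "\<delta> i = 0" by auto
  qed
  have c0: "c = 0" using third(1)[OF r] by simp
  have kill: "v *v x i = 0" if "Re (e i) > - Re (e s)" for i
  proof (cases "i = t")
    case True
    then show ?thesis by (simp add: vt c0)
  next
    case False
    then show ?thesis using vd[of i] that lst third(2)[OF r] third(3)[of i] c0 by (cases "i = s") auto
  qed
  obtain i j where ij: "bil J (v *v x i) (x j) \<noteq> 0" by (rule v_pairing)
  then have "Re (e i) \<le> - Re (e s)" using kill[of i] by (cases "Re (e i) > - Re (e s)") auto
  then have i: "i = t' \<or> i = s'" using low[of i] by force
  have "Re (e j) \<le> - Re (e s)" using ij kill[of j] unfolding v_pairing_swap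
    by (cases "Re (e j) > - Re (e s)") auto
  then have j: "j = t' \<or> j = s'" using low[of j] by force
  have "i \<noteq> j"
  proof
    assume "i = j"
    then have "bil J (v *v x i) (x i) = 0"
      using v_pairing_swap[of i i] bil_swap[of "v *v x i" "x i"] eps by simp
    then show False using ij \<open>i = j\<close> by simp
  qed
  then have "\<theta> = e t + e s" using v_pairing_weight[OF ij] i j t' s' by auto
  show ?thesis
  proof (rule that[of t s])
    show "t \<noteq> s" using st by simp
  qed (fact im lst spos les \<open>\<theta> = e t + e s\<close>)+
qed

end

section \<open>The special linear algebra\<close>

abbreviation dot :: "complex^'m \<Rightarrow> complex^'m \<Rightarrow> complex" where
  "dot \<equiv> bil (mat 1)"

lemma dot_eq: "dot f x = (\<Sum>i\<in>UNIV. f $ i * x $ i)"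
  by (simp add: bil_def)

lemma dot_axis: "dot (axis i 1) (axis j 1) = (if i = j then 1 else 0)"
  by (simp add: dot_eq axis_def if_distrib[of "\<lambda>a. a * _"] if_distrib[of "\<lambda>a. _ * a"] cong: if_cong)

lemma dot_mult: "dot (f v* A) x = dot f (A *v x)"
proof -
  have "dot (f v* A) x = (\<Sum>j\<in>UNIV. \<Sum>i\<in>UNIV. A $ i $ j * f $ i * x $ j)"
    by (simp add: dot_eq vector_matrix_mult_nth sum_distrib_right)
  also have "\<dots> = (\<Sum>i\<in>UNIV. \<Sum>j\<in>UNIV. A $ i $ j * f $ i * x $ j)" by (rule sum.swap)
  also have "\<dots> = dot f (A *v x)"
    by (simp add: dot_eq matrix_vector_mult_def sum_distrib_left mult_ac)
  finally show ?thesis .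
qed

text \<open>The trace-free part of the rank-one matrix \<open>x f^T\<close>. Correcting the trace,
  instead of demanding \<open>dot f x = 0\<close>, keeps it bilinear in all vectors and
  covectors.\<close>

definition rank1 :: "complex^'m \<Rightarrow> complex^'m \<Rightarrow> complex^'m^'m" where
  "rank1 x f = (\<chi> i j. x $ i * f $ j - (if i = j then dot f x / of_nat CARD('m) else 0))"

lemma rank1_mult_vec: "rank1 x f *v z = dot f z *s x - (dot f x / of_nat CARD('m)) *s (z :: complex^'m)"
proof -
  have "(rank1 x f *v z) $ i = (\<Sum>j\<in>UNIV. x $ i * (f $ j * z $ j) -
      (if i = j then dot f x / of_nat CARD('m) * z $ j else 0))" for i
    unfolding matrix_vector_mult_def by (simp, intro sum.cong) (auto simp: rank1_def algebra_simps)
  then show ?thesis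
    by (simp add: vec_eq_iff sum_subtractf sum_distrib_left[symmetric] dot_eq[symmetric] mult.commute)
qed

lemma rank1_in [simp]: "rank1 x f \<in> sl_algebra"
  by (simp add: sl_algebra_def trace_def rank1_def sum_subtractf dot_eq mult.commute)

lemma rank1_linear:
  "rank1 (x + y) f = rank1 x f + rank1 y f" "rank1 x (f + f') = rank1 x f + rank1 x f'"
  "rank1 (c *s x) f = cmat_scale c (rank1 x f)" "rank1 x (c *s f) = cmat_scale c (rank1 x f)"
  "rank1 (x - y) f = rank1 x f - rank1 y f" "rank1 x (f - f') = rank1 x f - rank1 x f'"
  "rank1 0 f = 0" "rank1 x 0 = 0"
  by (simp_all add: vec_eq_iff rank1_def algebra_simps add_divide_distrib diff_divide_distrib)

lemma bracket_rank1: "bracket A (rank1 x f) = rank1 (A *v x) f - rank1 x (f v* A)"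
  unfolding matrix_eq
  by (simp add: bracket_mult_vec rank1_mult_vec matrix_vector_mult_diff_rdistrib dot_mult
      matrix_vector_mult_diff_distrib vec.scale)

lemma vec_mult_rank1: "h v* rank1 x f = dot h x *s f - (dot f x / of_nat CARD('m)) *s (h :: complex^'m)"
proof -
  have "(h v* rank1 x f) $ j = (\<Sum>i\<in>UNIV. h $ i * x $ i * f $ j -
      (if i = j then dot f x / of_nat CARD('m) * h $ j else 0))" for j
    unfolding vector_matrix_mult_nth by (intro sum.cong) (auto simp: rank1_def algebra_simps)
  then show ?thesis
    by (simp add: vec_eq_iff sum_subtractf sum_distrib_right[symmetric] dot_eq[symmetric])
qed

lemma bracket_rank1_rank1: "bracket (rank1 x f) (rank1 z h) = cmat_scale (dot f z) (rank1 x h) - cmat_scale (dot h x) (rank1 z f)"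
  by (simp add: bracket_rank1 rank1_mult_vec vec_mult_rank1 rank1_linear)

text \<open>The matrices \<open>rank1 (x i) (f j)\<close> have eigenvalues \<open>e i - e j\<close>.
  Annihilation by the positive ones forces \<open>v\<close> to be a scalar plus a multiple of the
  map sending \<open>x b\<close> to \<open>x t\<close>; this multiple is not 0, because
  \<open>v\<close> is nonzero and trace-free.\<close>

lemma sl_highest_weight:
  fixes H v :: "complex^'m^'m"
  assumes card: "CARD('m) \<ge> 2"
    and comm: "\<And>X Y. X \<in> sl_algebra \<Longrightarrow> Y \<in> sl_algebra \<Longrightarrow> bracket H X = 0 \<Longrightarrow> bracket H Y = 0
        \<Longrightarrow> bracket X Y = 0"
    and realv: "\<And>X c. X \<in> sl_algebra \<Longrightarrow> X \<noteq> 0 \<Longrightarrow> bracket H X = cmat_scale c X \<Longrightarrow> c \<in> \<real>"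
    and pos: "\<And>X c. X \<in> sl_algebra \<Longrightarrow> bracket H X = cmat_scale c X \<Longrightarrow> Re c > 0 \<Longrightarrow> bracket X v = 0"
    and v: "v \<in> sl_algebra" "v \<noteq> 0" "bracket H v = cmat_scale \<theta> v"
    and ss: "sl_algebra \<subseteq> cmat.span {X. \<exists>c. bracket H X = cmat_scale c X}"
  obtains Q R :: "complex^'m^'m" and e t b where "invertible Q" "invertible R"
    "\<And>i. H *v column i Q = e i *s column i Q" "\<And>i. column i R v* H = e i *s column i R"
    "\<And>i. i \<noteq> t \<Longrightarrow> Re (e i) < Re (e t)" "\<And>i. i \<noteq> b \<Longrightarrow> Re (e b) < Re (e i)" "\<theta> = e t - e b"
proof -
  obtain Q :: "complex^'m^'m" and e where Q: "invertible Q" "\<And>i. H *v column i Q = e i *s column i Q"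
    by (rule eigenbasis[OF sl_ad_semisimple_diagonalizable[OF ss]]) (rule that)
  \<comment> \<open>The columns of \<open>R\<close> form the basis of covectors dual to the columns
    of \<open>Q\<close>.\<close>
  define R where "R = transpose (matrix_inv Q)"
  let ?x = "\<lambda>i. column i Q" and ?f = "\<lambda>i. column i R"
  have QR: "matrix_inv Q ** Q = mat 1" using Q(1) by (rule matrix_inv_left)
  then have QR': "Q ** matrix_inv Q = mat 1" by (simp add: matrix_left_right_inverse)
  have invR: "invertible R" unfolding R_def
    unfolding invertible_def
    by (rule exI[of _ "transpose Q"]) (simp add: matrix_transpose_mul[symmetric] QR QR')
  have fx: "dot (?f i) (?x j) = (if i = j then 1 else 0)" for i j
  proof -
    have "dot (?f i) (?x j) = (matrix_inv Q ** Q) $ i $ j"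
      by (simp add: dot_eq R_def column_def transpose_def matrix_matrix_mult_def)
    then show ?thesis by (simp add: QR mat_def)
  qed
  have ext_f: "y = z" if "\<And>j. dot y (?x j) = dot z (?x j)" for y z
  proof -
    have "(y v* Q) $ j = (z v* Q) $ j" for j
      using that[of j] by (simp add: dot_eq vector_matrix_mult_nth column_def mult.commute)
    then have "y v* Q = z v* Q" by (simp add: vec_eq_iff)
    then have "(y v* Q) v* matrix_inv Q = (z v* Q) v* matrix_inv Q" by simp
    then show ?thesis by (simp add: vector_matrix_mul_assoc QR')
  qed
  have fH: "?f i v* H = e i *s ?f i" for i
    by (rule ext_f) (simp add: dot_mult Q(2) fx)
  have x0: "?x i \<noteq> 0" for i using fx[of i i] by auto
  have eigen: "bracket H (rank1 (?x i) (?f j)) = cmat_scale (e i - e j) (rank1 (?x i) (?f j))" for i j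
    by (simp add: bracket_rank1 Q(2) fH rank1_linear cmat.scale_left_diff_distrib)
  \<comment> \<open>Equal eigenvalues would put two matrices that do not commute into the
    centralizer of \<open>H\<close>.\<close>
  have distinct: "e i \<noteq> e j" if "i \<noteq> j" for i j
  proof
    assume ij: "e i = e j"
    have "bracket (rank1 (?x i) (?f j)) (rank1 (?x j) (?f i)) = 0"
      by (rule comm) (use eigen[of i j] eigen[of j i] ij in auto)
    then have "(rank1 (?x i) (?f i) - rank1 (?x j) (?f j)) *v ?x i = 0"
      by (simp add: bracket_rank1_rank1 fx)
    then show False using that x0 by (simp add: matrix_vector_mult_diff_rdistrib rank1_mult_vec fx)
  qed
  have im: "Im (e i) = Im (e j)" for i j
  proof (cases "i = j")
    case False
    have "rank1 (?x i) (?f j) *v ?x j \<noteq> 0" using False x0[of i] by (simp add: rank1_mult_vec fx)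
    then have "rank1 (?x i) (?f j) \<noteq> 0" by auto
    then have "e i - e j \<in> \<real>" using realv[OF rank1_in _ eigen] by blast
    then show ?thesis by (simp add: complex_is_Real_iff)
  qed simp
  obtain t where t: "\<And>i. Re (e i) \<le> Re (e t)"
    using finite_has_greatest[of UNIV "\<lambda>i. Re (e i)"] by auto
  obtain b where b: "\<And>i. Re (e b) \<le> Re (e i)"
    using finite_has_greatest[of UNIV "\<lambda>i. - Re (e i)"] by auto
  have tlt: "Re (e i) < Re (e t)" if "i \<noteq> t" for i
    using t[of i] distinct[OF that] im[of i t] by (metis complex_eq_iff le_less)
  have blt: "Re (e b) < Re (e i)" if "i \<noteq> b" for i
    using b[of i] distinct[OF that] im[of i b] by (metis complex_eq_iff le_less)
  have tb: "t \<noteq> b"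
  proof
    assume "t = b"
    then have "i = t" for i using tlt[of i] blt[of i] by force
    then have "(UNIV :: 'm set) = {t}" by auto
    then have "CARD('m) = 1" by (metis card_1_singleton_iff One_nat_def)
    then show False using card by simp
  qed
  have rel: "dot (?f j) z *s (v *v ?x i) = dot (?f j) (v *v z) *s ?x i" if "Re (e i) > Re (e j)" for i j z
  proof -
    have ij: "i \<noteq> j" using that by auto
    have "bracket (rank1 (?x i) (?f j)) v = 0" by (rule pos[OF rank1_in eigen]) (use that in simp)
    then have "bracket (rank1 (?x i) (?f j)) v *v z = 0" by simp
    then show ?thesis using ij by (simp add: bracket_mult_vec rank1_mult_vec fx vec.scale)
  qed
  define c where "c = dot (?f b) (v *v ?x b)"
  have vi: "v *v ?x i = c *s ?x i" if "i \<noteq> b" for i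
    using rel[OF blt[OF that], of "?x b"] by (simp add: fx c_def)
  define a where "a = dot (?f t) (v *v ?x b)"
  have ext_x: "y = z" if "\<And>j. dot (?f j) y = dot (?f j) z" for y z
  proof -
    have "(matrix_inv Q *v y) $ j = (matrix_inv Q *v z) $ j" for j
      using that[of j] by (simp add: dot_eq matrix_vector_mult_def column_def R_def transpose_def)
    then have "matrix_inv Q *v y = matrix_inv Q *v z" by (simp add: vec_eq_iff)
    then have "Q *v (matrix_inv Q *v y) = Q *v (matrix_inv Q *v z)" by simp
    then show ?thesis by (simp add: matrix_vector_mul_assoc QR')
  qed
  have vb: "v *v ?x b = a *s ?x t + c *s ?x b"
  proof (rule ext_x)
    fix j
    have "dot (?f j) (v *v ?x b) = 0" if "j \<noteq> t" "j \<noteq> b"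
      using rel[OF tlt[OF that(1)], of "?x b"] that x0[of t] by (simp add: fx)
    then show "dot (?f j) (v *v ?x b) = dot (?f j) (a *s ?x t + c *s ?x b)"
      using tb by (cases "j = t"; cases "j = b") (auto simp: fx a_def c_def)
  qed
  have "a \<noteq> 0"
  proof
    assume a: "a = 0"
    have cv: "(v - mat c) *v ?x i \<in> {0}" for i
    proof -
      have "mat c *v z = c *s z" for z :: "complex^'m"
        by (simp add: vec_eq_iff matrix_vector_mult_def mat_def if_distrib[of "\<lambda>a. a * _"] cong: if_cong)
      then show ?thesis using vi[of i] vb a by (cases "i = b") (auto simp: matrix_vector_mult_diff_rdistrib)
    qed
    have "(v - mat c) *v z \<in> {0}" for z
      by (rule columns_induct[OF Q(1), where sc = "(*s)" and f = "(*v) (v - mat c)"])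
        (use cv in \<open>auto intro: vec.linear_axioms vec.subspace_single_0\<close>)
    then have "v - mat c = 0" by (simp add: matrix_eq)
    then have "v = mat c" by simp
    then have "of_nat CARD('m) * c = 0" using v(1) by (simp add: sl_algebra_def trace_def mat_def)
    then have "c = 0" by simp
    then show False using v(2) \<open>v = mat c\<close> by (simp add: vec_eq_iff mat_def)
  qed
  have "bracket H v *v ?x b = \<theta> *s (v *v ?x b)" by (simp add: v(3) cmat_scale_mult_vec)
  then have "dot (?f t) (bracket H v *v ?x b) = dot (?f t) (\<theta> *s (v *v ?x b))" by simp
  then have "(e t - e b) * a = \<theta> * a"
    using tb by (simp add: bracket_mult_vec vb Q(2) vec.scale matrix_vector_right_distrib fx algebra_simps)
  then have "\<theta> = e t - e b" using \<open>a \<noteq> 0\<close> by simp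
  then show ?thesis using that[OF Q(1) invR Q(2) fH tlt blt] by blast
qed

section \<open>Projection onto the Cartan square\<close>

lemma tvec_linear:
  "tvec (A + B) = tvec A + tvec B" "tvec (A - B) = tvec A - tvec B" "tvec (- A) = - tvec A"
  "tvec (cmat_scale c A) = tscale c (tvec A)" "tvec 0 = 0"
  by (auto simp: tvec_def tscale_def fun_eq_iff split: list.split)

lemma tmult_diff: "(r - s) \<otimes>\<^sub>t t = r \<otimes>\<^sub>t t - s \<otimes>\<^sub>t t" "t \<otimes>\<^sub>t (r - s) = t \<otimes>\<^sub>t r - t \<otimes>\<^sub>t s"
  "(- r) \<otimes>\<^sub>t t = - (r \<otimes>\<^sub>t t)" "t \<otimes>\<^sub>t (- r) = - (t \<otimes>\<^sub>t r)"
  by (auto simp: tmult_def fun_eq_iff algebra_simps sum_subtractf sum_negf)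

lemma tmult_sum: "(\<Sum>i\<in>A. f i) \<otimes>\<^sub>t t = (\<Sum>i\<in>A. f i \<otimes>\<^sub>t t)" "t \<otimes>\<^sub>t (\<Sum>i\<in>A. f i) = (\<Sum>i\<in>A. t \<otimes>\<^sub>t f i)"
  by (induction A rule: infinite_finite_induct) (auto simp: tmult_linear)

lemma linear_tact: "Vector_Spaces.linear tscale tscale (tact X)"
proof unfold_locales
  show "tact X (s + t) = tact X s + tact X t" for s t
  proof
    fix w
    show "tact X (s + t) w = (tact X s + tact X t) w"
      unfolding tact_def plus_fun_apply sum.distrib[symmetric]
      by (intro sum.cong refl) (simp add: algebra_simps sum.distrib sum_subtractf split: prod.split)
  qed
  show "tact X (tscale c t) = tscale c (tact X t)" for c t
  proof
    fix w
    show "tact X (tscale c t) w = tscale c (tact X t) w"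
      unfolding tact_def tscale_def sum_distrib_left
      by (intro sum.cong refl) (simp add: algebra_simps sum_distrib_left split: prod.split)
  qed
qed

interpretation tact: Vector_Spaces.linear tscale tscale "tact X"
  by (rule linear_tact)

lemmas tact_linear = tact.add tact.diff tact.scale tact.zero

abbreviation tt :: "complex^'m^'m \<Rightarrow> complex^'m^'m \<Rightarrow> 'm tensor" where
  "tt X Y \<equiv> tvec X \<otimes>\<^sub>t tvec Y"

lemma tt_linear:
  "tt (A + B) C = tt A C + tt B C" "tt C (A + B) = tt C A + tt C B"
  "tt (A - B) C = tt A C - tt B C" "tt C (A - B) = tt C A - tt C B"
  "tt (cmat_scale c A) C = tscale c (tt A C)" "tt C (cmat_scale c A) = tscale c (tt C A)"
  "tt 0 A = 0" "tt A 0 = 0" "tt (- A) B = - tt A B" "tt A (- B) = - tt A B"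
  by (simp_all add: tvec_linear tmult_linear tmult_diff)

lemma tt_in: "X \<in> g \<Longrightarrow> Y \<in> g \<Longrightarrow> tt X Y \<in> tpower g 2"
  unfolding tpower_def
  by (rule tens.span_base) (auto intro!: exI[of _ "[X, Y]"])

lemma subspace_tpower: "tens.subspace (tpower g k)"
  by (simp add: tpower_def tens.subspace_span)

text \<open>Of the Cartan square only irreducibility and one nonzero vector \<open>u\<close> with
  \<open>H\<close>-eigenvalue \<open>d\<close> are recorded, and of the Cartan subalgebra only the
  element \<open>H\<close>.\<close>

locale cartan_proj =
  fixes g :: "(complex^'m^'m) set" and H :: "complex^'m^'m" and P :: "'m tensor \<Rightarrow> 'm tensor"
    and C :: "'m tensor set" and u :: "'m tensor" and d :: complex
  assumes irr: "irreducible_module g tscale tact C" and CT: "C \<subseteq> tpower g 2"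
    and u: "u \<in> C" "u \<noteq> 0" "tact H u = tscale d u"
    and PC: "P ` tpower g 2 = C"
    and P_add: "\<And>s t. s \<in> tpower g 2 \<Longrightarrow> t \<in> tpower g 2 \<Longrightarrow> P (s + t) = P s + P t"
    and P_scale: "\<And>c t. t \<in> tpower g 2 \<Longrightarrow> P (tscale c t) = tscale c (P t)"
    and P_act: "\<And>X t. X \<in> g \<Longrightarrow> t \<in> tpower g 2 \<Longrightarrow> P (tact X t) = tact X (P t)"
    and Hg: "H \<in> g"
begin

lemma P_0: "P 0 = 0"
  using P_scale[of 0 0] tens.subspace_0[OF subspace_tpower[of g 2]] by simp

lemma P_sum: "finite A \<Longrightarrow> (\<And>i. i \<in> A \<Longrightarrow> f i \<in> tpower g 2) \<Longrightarrow> P (\<Sum>i\<in>A. f i) = (\<Sum>i\<in>A. P (f i))"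
  by (induction A rule: finite_induct)
    (simp_all add: P_0 P_add tens.subspace_sum[OF subspace_tpower])

lemma P_diff: "s \<in> tpower g 2 \<Longrightarrow> t \<in> tpower g 2 \<Longrightarrow> P (s - t) = P s - P t"
  using P_add[of s "tscale (-1) t"] P_scale[of t "-1"] tens.subspace_scale[OF subspace_tpower, of t g 2 "-1"]
  by simp

text \<open>The image under \<open>P\<close> of the span of \<open>S\<close> is a submodule of the irreducible module \<open>C\<close>; it
  cannot be all of \<open>C\<close>, because it does not contain the weight vector \<open>u\<close>.\<close>

lemma P_kills:
  assumes S: "S \<subseteq> tpower g 2"
    and inv: "\<And>X s. X \<in> g \<Longrightarrow> s \<in> S \<Longrightarrow> tact X s \<in> tens.span S"
    and eig: "S \<subseteq> tens.span {t \<in> tpower g 2. \<exists>c. c \<noteq> d \<and> tact H t = tscale c t}" (is "_ \<subseteq> tens.span ?G")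
    and t: "t \<in> tens.span S"
  shows "P t = 0"
proof -
  let ?W = "tens.span S"
  have W: "?W \<subseteq> tpower g 2" by (rule tens.span_minimal[OF S subspace_tpower])
  have invW: "tact X s \<in> ?W" if X: "X \<in> g" and s: "s \<in> ?W" for X s
    using s
  proof (induction rule: tens.span_induct_alt)
    case base
    show ?case by (simp only: tact_linear tens.span_zero)
  next
    case (step c a b)
    show ?case unfolding tact_linear
      by (rule tens.span_add[OF tens.span_scale[OF inv[OF X step(1)]] step(2)])
  qed
  have "module.subspace tscale (P ` ?W)"
  proof (rule tens.subspaceI)
    show "0 \<in> P ` ?W" using P_0 tens.span_zero[of S] by (metis image_eqI)
    show "a + b \<in> P ` ?W" if ab: "a \<in> P ` ?W" "b \<in> P ` ?W" for a b
    proof -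
      obtain a' where a': "a = P a'" "a' \<in> ?W" using ab(1) by (rule imageE)
      obtain b' where b': "b = P b'" "b' \<in> ?W" using ab(2) by (rule imageE)
      show ?thesis
      proof (rule image_eqI)
        show "a + b = P (a' + b')" unfolding a'(1) b'(1)
          using P_add[OF subsetD[OF W a'(2)] subsetD[OF W b'(2)]] by simp
        show "a' + b' \<in> ?W" by (rule tens.span_add[OF a'(2) b'(2)])
      qed
    qed
    show "tscale c a \<in> P ` ?W" if ab: "a \<in> P ` ?W" for c a
    proof -
      obtain a' where a': "a = P a'" "a' \<in> ?W" using ab by (rule imageE)
      show ?thesis
      proof (rule image_eqI)
        show "tscale c a = P (tscale c a')" unfolding a'(1)
          using P_scale[OF subsetD[OF W a'(2)]] by simp
        show "tscale c a' \<in> ?W" by (rule tens.span_scale[OF a'(2)])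
      qed
    qed
  qed
  moreover have "tact X a \<in> P ` ?W" if Xa: "X \<in> g" "a \<in> P ` ?W" for X a
  proof -
    obtain a' where a': "a = P a'" "a' \<in> ?W" using Xa(2) by (rule imageE)
    show ?thesis
    proof (rule image_eqI)
      show "tact X a = P (tact X a')" unfolding a'(1)
        using P_act[OF Xa(1) subsetD[OF W a'(2)]] by simp
      show "tact X a' \<in> ?W" by (rule invW[OF Xa(1) a'(2)])
    qed
  qed
  ultimately have "invariant_subspace g tscale tact (P ` ?W)" by (simp add: invariant_subspace_def)
  moreover have "P ` ?W \<subseteq> C" using W PC by blast
  ultimately have cases: "P ` ?W = {0} \<or> P ` ?W = C"
    using irr unfolding irreducible_module_def by blast
  have "u \<notin> P ` ?W"
  proof
    assume "u \<in> P ` ?W"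
    then obtain w where w: "u = P w" "w \<in> ?W" by (rule imageE)
    have "w \<in> tens.span ?G"
      using w(2) tens.span_minimal[OF eig tens.subspace_span] by blast
    \<comment> \<open>\<open>P\<close> commutes with the action of \<open>H\<close>, so
      \<open>P w\<close> is again a sum of eigenvectors with eigenvalues other than
      \<open>d\<close>. Membership in \<open>tpower g 2\<close> is carried along because
      \<open>P\<close> is linear only there.\<close>
    then have "w \<in> tpower g 2 \<and> P w \<in> tens.span {t. \<exists>c. c \<noteq> d \<and> tact H t = tscale c t}"
    proof (induction rule: tens.span_induct_alt)
      case base
      show ?case by (simp only: P_0 tens.span_zero tens.subspace_0[OF subspace_tpower])
    next
      case (step c a b)
      obtain e where a: "a \<in> tpower g 2" "e \<noteq> d" "tact H a = tscale e a" using step(1) by auto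
      have "tact H (P a) = tscale e (P a)" using P_act[OF Hg a(1)] P_scale[OF a(1)] a(3) by simp
      then have Pa: "P a \<in> tens.span {t. \<exists>c. c \<noteq> d \<and> tact H t = tscale c t}"
        using a(2) by (intro tens.span_base) auto
      have ca: "tscale c a \<in> tpower g 2" by (rule tens.subspace_scale[OF subspace_tpower a(1)])
      have Pab: "P (tscale c a + b) = tscale c (P a) + P b"
        using P_add[OF ca conjunct1[OF step(2)]] P_scale[OF a(1)] by simp
      show ?case
      proof
        show "tscale c a + b \<in> tpower g 2"
          by (rule tens.subspace_add[OF subspace_tpower ca conjunct1[OF step(2)]])
        show "P (tscale c a + b) \<in> tens.span {t. \<exists>c. c \<noteq> d \<and> tact H t = tscale c t}"
          unfolding Pab by (rule tens.span_add[OF tens.span_scale[OF Pa] conjunct2[OF step(2)]])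
      qed
    qed
    then have "u \<in> tens.span {t. \<exists>c. c \<noteq> d \<and> tact H t = tscale c t}" by (simp only: w(1))
    then have "u = 0" by (rule tens.span_eigen_disjoint[OF linear_tact _ u(3)])
    then show False using u(2) by simp
  qed
  then have "P ` ?W = {0}" using cases u(1) by blast
  then show ?thesis using t by blast
qed

end

lemma multilinear_span:
  fixes Q1 Q2 Q3 Q4 :: "complex^'m^'m" and sc :: "complex \<Rightarrow> 'v::ab_group_add \<Rightarrow> 'v"
  assumes Q: "invertible Q1" "invertible Q2" "invertible Q3" "invertible Q4"
    and lin: "\<And>y z w. Vector_Spaces.linear (*s) sc (\<lambda>x. \<phi> x y z w)"
      "\<And>x z w. Vector_Spaces.linear (*s) sc (\<lambda>y. \<phi> x y z w)"
      "\<And>x y w. Vector_Spaces.linear (*s) sc (\<lambda>z. \<phi> x y z w)"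
      "\<And>x y z. Vector_Spaces.linear (*s) sc (\<lambda>w. \<phi> x y z w)"
    and S: "module.subspace sc S"
    and b: "\<And>i j k l. \<phi> (column i Q1) (column j Q2) (column k Q3) (column l Q4) \<in> S"
  shows "\<phi> x y z w \<in> S"
proof -
  have 1: "\<phi> (column i Q1) (column j Q2) (column k Q3) w \<in> S" for i j k w
    by (rule columns_induct[OF Q(4) S lin(4)]) (rule b)
  have 2: "\<phi> (column i Q1) (column j Q2) z w \<in> S" for i j z w
    by (rule columns_induct[where f = "\<lambda>z. \<phi> (column i Q1) (column j Q2) z w", OF Q(3) S lin(3)]) (rule 1)
  have 3: "\<phi> (column i Q1) y z w \<in> S" for i y z w
    by (rule columns_induct[where f = "\<lambda>y. \<phi> (column i Q1) y z w", OF Q(2) S lin(2)]) (rule 2)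
  show ?thesis
    by (rule columns_induct[where f = "\<lambda>x. \<phi> x y z w", OF Q(1) S lin(1)]) (rule 3)
qed

text \<open>The submodule is spanned by all values of \<open>\<phi>\<close>, but its eigenvalues
  need checking only on eigenbases. The alternative of the value 0 covers coinciding indices, and
  separate matrices allow vectors and covectors to be mixed.\<close>

lemma (in cartan_proj) P_kills_multilinear:
  fixes Q1 Q2 Q3 Q4 :: "complex^'m^'m"
  assumes Q: "invertible Q1" "invertible Q2" "invertible Q3" "invertible Q4"
    and lin: "\<And>y z w. Vector_Spaces.linear (*s) tscale (\<lambda>x. \<phi> x y z w)"
      "\<And>x z w. Vector_Spaces.linear (*s) tscale (\<lambda>y. \<phi> x y z w)"
      "\<And>x y w. Vector_Spaces.linear (*s) tscale (\<lambda>z. \<phi> x y z w)"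
      "\<And>x y z. Vector_Spaces.linear (*s) tscale (\<lambda>w. \<phi> x y z w)"
    and T: "\<And>x y z w. \<phi> x y z w \<in> tpower g 2"
    and act: "\<And>X x y z w. X \<in> g \<Longrightarrow> tact X (\<phi> x y z w) \<in> tens.span {\<phi> x y z w | x y z w. True}"
    and eig: "\<And>i j k l. \<phi> (column i Q1) (column j Q2) (column k Q3) (column l Q4) = 0 \<or>
      (\<exists>c. c \<noteq> d \<and> tact H (\<phi> (column i Q1) (column j Q2) (column k Q3) (column l Q4))
        = tscale c (\<phi> (column i Q1) (column j Q2) (column k Q3) (column l Q4)))"
  shows "P (\<phi> x y z w) = 0"
proof (rule P_kills)
  let ?S = "{\<phi> x y z w | x y z w. True}"
  let ?G = "{t \<in> tpower g 2. \<exists>c. c \<noteq> d \<and> tact H t = tscale c t}"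
  show "?S \<subseteq> tpower g 2" using T by blast
  show "\<phi> x y z w \<in> tens.span ?S" by (rule tens.span_base) blast
  show "tact X s \<in> tens.span ?S" if "X \<in> g" "s \<in> ?S" for X s using act that by blast
  have "\<phi> x y z w \<in> tens.span ?G" for x y z w
  proof (rule multilinear_span[where \<phi> = \<phi> and sc = tscale and ?Q1.0 = Q1 and ?Q2.0 = Q2
        and ?Q3.0 = Q3 and ?Q4.0 = Q4])
    fix i j k l
    let ?t = "\<phi> (column i Q1) (column j Q2) (column k Q3) (column l Q4)"
    consider "?t = 0" | "?t \<in> ?G" using eig[of i j k l] T by blast
    then show "?t \<in> tens.span ?G"
      by cases (simp only: tens.span_zero, rule tens.span_base)
  qed (rule Q lin tens.subspace_span)+
  then show "?S \<subseteq> tens.span ?G" by blast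
qed

section \<open>Ideals of the tensor algebra\<close>

lemma carrier_tensor_algebra_iff: "x \<in> carrier (tensor_algebra g) \<longleftrightarrow> x \<in> tensors_ge g 0"
  by (simp add: tensor_algebra_def)

lemma subspace_tensors_ge: "tens.subspace (tensors_ge g k)"
  by (simp add: tensors_ge_def tens.subspace_span)

lemma tpower_tensors_ge: "k \<le> s \<Longrightarrow> tpower g s \<subseteq> tensors_ge g k"
  unfolding tensors_ge_def by (auto intro: tens.span_base)

lemma tensors_ge_mono: "k \<le> l \<Longrightarrow> tensors_ge g l \<subseteq> tensors_ge g k"
  unfolding tensors_ge_def by (intro tens.span_mono) force

lemma tvec_in: "X \<in> g \<Longrightarrow> tvec X \<in> tensors_ge g 1"
  unfolding tensors_ge_eq
  by (rule tens.span_base) (auto intro!: exI[of _ "[X]"])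

lemma tensors_ge_1_Nil: "t \<in> tensors_ge g 1 \<Longrightarrow> t [] = 0"
  unfolding tensors_ge_eq
proof (induction rule: tens.span_induct_alt)
  case base
  show ?case by simp
next
  case (step c x y)
  then obtain Xs where "x = foldr tmult (map tvec Xs) tone" "1 \<le> length Xs" by auto
  then have "x [] = 0" by (cases Xs) (auto simp: tmult_tvec_Nil)
  then show ?case using step by (simp add: tscale_def)
qed

lemma tensors_decomp:
  "t \<in> tensors_ge g 0 \<Longrightarrow> \<exists>c. t - tscale c tone \<in> tensors_ge g 1"
  unfolding tensors_ge_eq[of g 0]
proof (induction rule: tens.span_induct_alt)
  case base
  have "0 - tscale 0 tone \<in> tensors_ge g 1"
    using tens.subspace_0[OF subspace_tensors_ge[of g 1]] by simp
  then show ?case by blast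
next
  case (step c x y)
  obtain d where d: "y - tscale d tone \<in> tensors_ge g 1" using step by blast
  obtain Xs where Xs: "x = foldr tmult (map tvec Xs) tone" "set Xs \<subseteq> g" using step by auto
  show ?case
  proof (cases "Xs = []")
    case True
    have "tscale c x + y - tscale (c + d) tone = y - tscale d tone"
      using True Xs by (simp add: tens.scale_left_distrib)
    then show ?thesis using d by metis
  next
    case False
    then have "x \<in> tensors_ge g 1" unfolding tensors_ge_eq
      by (intro tens.span_base) (use Xs in \<open>auto simp: Suc_le_eq\<close>)
    then have "tscale c x + (y - tscale d tone) \<in> tensors_ge g 1"
      by (intro tens.subspace_add[OF subspace_tensors_ge] tens.subspace_scale[OF subspace_tensors_ge] d)
    then have "tscale c x + y - tscale d tone \<in> tensors_ge g 1" by (simp only: add_diff_eq)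
    then show ?thesis by blast
  qed
qed

lemma ideal_tensors_ge_1: "ideal (tensors_ge g 1) (tensor_algebra g)"
proof (rule idealI[OF ring_tensor_algebra])
  have "a_inv (tensor_algebra g) x = - x" if "x \<in> tensors_ge g 1" for x
  proof -
    interpret ring "tensor_algebra g" by (rule ring_tensor_algebra)
    have "x \<in> tensors_ge g 0" using that tensors_ge_mono[of 0 1 g] by auto
    moreover from this have "- x \<in> tensors_ge g 0" by (rule tens.subspace_neg[OF subspace_tensors_ge])
    ultimately show ?thesis
      by (intro minus_equality) (auto simp: tensor_algebra_def)
  qed
  then show "subgroup (tensors_ge g 1) (add_monoid (tensor_algebra g))"
    using tensors_ge_mono[of 0 1 g] tens.subspace_neg[OF subspace_tensors_ge[of g 1]]
      tens.subspace_add[OF subspace_tensors_ge[of g 1]] tens.subspace_0[OF subspace_tensors_ge[of g 1]]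
    by (intro subgroup.intro) (auto simp: tensor_algebra_def a_inv_def)
  show "x \<otimes>\<^bsub>tensor_algebra g\<^esub> a \<in> tensors_ge g 1" "a \<otimes>\<^bsub>tensor_algebra g\<^esub> x \<in> tensors_ge g 1"
    if "a \<in> tensors_ge g 1" "x \<in> carrier (tensor_algebra g)" for a x
    using that tensors_ge_mult[of x g 0 a 1] tensors_ge_mult[of a g 1 x 0] by (simp_all add: tensor_algebra_def)
qed

lemma ideal_subspace:
  assumes "ideal I (tensor_algebra g)"
  shows "tens.subspace I"
proof (rule tens.subspaceI)
  interpret ideal I "tensor_algebra g" by (rule assms)
  show "0 \<in> I" using additive_subgroup.zero_closed[OF is_additive_subgroup]
    by (simp add: tensor_algebra_def)
  show "x + y \<in> I" if "x \<in> I" "y \<in> I" for x y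
    using additive_subgroup.a_closed[OF is_additive_subgroup that] by (simp add: tensor_algebra_def)
  show "tscale c x \<in> I" if "x \<in> I" for c x
  proof -
    have "tscale c tone \<in> carrier (tensor_algebra g)"
      unfolding carrier_tensor_algebra_iff
      by (rule tens.subspace_scale[OF subspace_tensors_ge tone_in_tensors])
    then have "tscale c tone \<otimes>\<^sub>t x \<in> I" using I_l_closed[OF that] by (simp add: tensor_algebra_def)
    then show ?thesis by (simp add: tmult_linear)
  qed
qed

lemma ideal_mult:
  assumes "ideal I (tensor_algebra g)" "a \<in> I" "x \<in> tensors_ge g 0"
  shows "x \<otimes>\<^sub>t a \<in> I" "a \<otimes>\<^sub>t x \<in> I"
  using ideal.I_l_closed[OF assms(1,2)] ideal.I_r_closed[OF assms(1,2)] assms(3)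
  by (auto simp: tensor_algebra_def)

lemma env_ideal_subset:
  assumes "\<And>X Y. X \<in> g \<Longrightarrow> Y \<in> g \<Longrightarrow> bracket X Y \<in> g"
  shows "env_ideal g \<subseteq> tensors_ge g 1"
  unfolding env_ideal_def
proof (rule ring.genideal_minimal[OF ring_tensor_algebra ideal_tensors_ge_1])
  have "tt X Y - tt Y X - tvec (bracket X Y) \<in> tensors_ge g 1" if "X \<in> g" "Y \<in> g" for X Y
    using tt_in[OF that] tt_in[OF that(2,1)] tpower_tensors_ge[of 1 2 g] tvec_in[OF assms[OF that]]
    by (intro tens.subspace_diff[OF subspace_tensors_ge]) auto
  then show "{tt X Y - tt Y X - tvec (bracket X Y) |X Y. X \<in> g \<and> Y \<in> g} \<subseteq> tensors_ge g 1" by blast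
qed

lemma env_ideal_ideal:
  assumes "\<And>X Y. X \<in> g \<Longrightarrow> Y \<in> g \<Longrightarrow> bracket X Y \<in> g"
  shows "ideal (env_ideal g) (tensor_algebra g)"
  unfolding env_ideal_def
proof (rule ring.genideal_ideal[OF ring_tensor_algebra])
  have "tt X Y - tt Y X - tvec (bracket X Y) \<in> tensors_ge g 0" if "X \<in> g" "Y \<in> g" for X Y
    using tt_in[of _ g] tpower_tensors_ge[of 0 2 g] tvec_in[of _ g] tensors_ge_mono[of 0 1 g] assms that
    by (intro tens.subspace_diff[OF subspace_tensors_ge]) auto
  then show "{tt X Y - tt Y X - tvec (bracket X Y) |X Y. X \<in> g \<and> Y \<in> g} \<subseteq> carrier (tensor_algebra g)"
    by (auto simp: carrier_tensor_algebra_iff)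
qed

text \<open>\<open>env_ideal g\<close> lies in positive degree, so the constant part survives in the
  quotient and \<open>env_plus g\<close> is proper. An element outside it has a nonzero constant
  part, and subtracting the rest puts a unit into any larger ideal.\<close>

lemma maximalideal_env_plus:
  assumes br: "\<And>X Y. X \<in> g \<Longrightarrow> Y \<in> g \<Longrightarrow> bracket X Y \<in> g"
  shows "maximalideal (env_plus g) (env_algebra g)"
proof (rule maximalidealI)
  let ?R = "tensor_algebra g"
  interpret R: ring ?R by (rule ring_tensor_algebra)
  interpret K: ideal "env_ideal g" ?R by (rule env_ideal_ideal[OF br])
  have plus: "env_plus g = (+>\<^bsub>?R\<^esub>) (env_ideal g) ` tensors_ge g 1"
    by (auto simp: env_plus_def env_proj_def)
  show id: "ideal (env_plus g) (env_algebra g)"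
    unfolding plus env_algebra_def
    by (rule R.ring_ideal_imp_quot_ideal[OF K.ideal_axioms ideal_tensors_ge_1])
  interpret Q: ring "env_algebra g" unfolding env_algebra_def by (rule K.quotient_is_ring)
  have hom: "(+>\<^bsub>?R\<^esub>) (env_ideal g) \<in> ring_hom ?R (env_algebra g)"
    unfolding env_algebra_def by (rule K.rcos_ring_hom)
  have tone: "tone \<in> carrier ?R" by (simp add: carrier_tensor_algebra_iff tone_in_tensors)
  have one: "\<one>\<^bsub>env_algebra g\<^esub> = env_ideal g +>\<^bsub>?R\<^esub> tone"
    using ring_hom_one[OF hom] by (simp add: tensor_algebra_def)
  show "carrier (env_algebra g) \<noteq> env_plus g"
  proof
    assume "carrier (env_algebra g) = env_plus g"
    then have "\<one>\<^bsub>env_algebra g\<^esub> \<in> env_plus g" using Q.one_closed by simp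
    then obtain t where t: "env_ideal g +>\<^bsub>?R\<^esub> tone = env_ideal g +>\<^bsub>?R\<^esub> t" "t \<in> tensors_ge g 1"
      unfolding one plus by (rule imageE)
    have "tone \<in> env_ideal g +>\<^bsub>?R\<^esub> t"
      using K.a_rcos_self[OF tone] t(1) by simp
    then obtain k where "k \<in> env_ideal g" "tone = k \<oplus>\<^bsub>?R\<^esub> t"
      unfolding a_r_coset_def' by blast
    then have tk: "tone = k + t" by (simp add: tensor_algebra_def)
    have "k \<in> tensors_ge g 1" using env_ideal_subset[OF br] \<open>k \<in> env_ideal g\<close> by blast
    have "k [] + t [] = 1" using fun_cong[OF tk, of "[]"] by (simp add: tone_def)
    then show False using tensors_ge_1_Nil[OF t(2)] tensors_ge_1_Nil[OF \<open>k \<in> tensors_ge g 1\<close>]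
      by simp
  qed
  fix M assume M: "ideal M (env_algebra g)" "env_plus g \<subseteq> M" "M \<subseteq> carrier (env_algebra g)"
  interpret M: ideal M "env_algebra g" by (rule M(1))
  show "M = env_plus g \<or> M = carrier (env_algebra g)"
  proof (cases "M \<subseteq> env_plus g")
    case False
    then obtain m where m: "m \<in> M" "m \<notin> env_plus g" by blast
    then have "m \<in> a_rcosets\<^bsub>?R\<^esub> (env_ideal g)" using M(3) by (auto simp: env_algebra_def FactRing_def)
    then obtain a where a: "a \<in> carrier ?R" "m = env_ideal g +>\<^bsub>?R\<^esub> a"
      by (auto simp: A_RCOSETS_def')
    obtain c where c: "a - tscale c tone \<in> tensors_ge g 1"
      using tensors_decomp[of a g] a(1) by (auto simp: carrier_tensor_algebra_iff)
    have "c \<noteq> 0" using c m(2) a(2) unfolding plus by auto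
    define b where "b = a - tscale c tone"
    have ct: "tscale r tone \<in> carrier ?R" for r
      unfolding carrier_tensor_algebra_iff by (rule tens.subspace_scale[OF subspace_tensors_ge tone_in_tensors])
    have nb: "- b \<in> tensors_ge g 1" unfolding b_def by (rule tens.subspace_neg[OF subspace_tensors_ge c])
    then have nbc: "- b \<in> carrier ?R" using tensors_ge_mono[of 0 1 g] by (auto simp: carrier_tensor_algebra_iff)
    have "env_ideal g +>\<^bsub>?R\<^esub> (- b) \<in> M" using M(2) nb unfolding plus by blast
    then have "m \<oplus>\<^bsub>env_algebra g\<^esub> (env_ideal g +>\<^bsub>?R\<^esub> (- b)) \<in> M" using m(1) by (rule M.a_closed[rotated])
    also have "m \<oplus>\<^bsub>env_algebra g\<^esub> (env_ideal g +>\<^bsub>?R\<^esub> (- b)) = env_ideal g +>\<^bsub>?R\<^esub> (a \<oplus>\<^bsub>?R\<^esub> (- b))"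
      unfolding a(2) using ring_hom_add[OF hom a(1) nbc] by simp
    also have "a \<oplus>\<^bsub>?R\<^esub> (- b) = tscale c tone" by (simp add: tensor_algebra_def b_def)
    finally have cM: "env_ideal g +>\<^bsub>?R\<^esub> tscale c tone \<in> M" .
    have "(env_ideal g +>\<^bsub>?R\<^esub> tscale (1/c) tone) \<otimes>\<^bsub>env_algebra g\<^esub> (env_ideal g +>\<^bsub>?R\<^esub> tscale c tone) \<in> M"
      by (rule M.I_l_closed[OF cM]) (rule ring_hom_closed[OF hom ct])
    also have "(env_ideal g +>\<^bsub>?R\<^esub> tscale (1/c) tone) \<otimes>\<^bsub>env_algebra g\<^esub> (env_ideal g +>\<^bsub>?R\<^esub> tscale c tone)
        = env_ideal g +>\<^bsub>?R\<^esub> (tscale (1/c) tone \<otimes>\<^bsub>?R\<^esub> tscale c tone)"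
      using ring_hom_mult[OF hom ct ct] by simp
    also have "tscale (1/c) tone \<otimes>\<^bsub>?R\<^esub> tscale c tone = tone"
      using \<open>c \<noteq> 0\<close> by (simp add: tensor_algebra_def tmult_linear)
    finally have "\<one>\<^bsub>env_algebra g\<^esub> \<in> M" unfolding one .
    then have "M = carrier (env_algebra g)" by (rule M.one_imp_carrier)
    then show ?thesis ..
  qed (use M in blast)
qed

lemma ideal_contains_tensors_ge_1:
  assumes I: "ideal I (tensor_algebra g)" and gI: "\<And>X. X \<in> g \<Longrightarrow> tvec X \<in> I"
  shows "tensors_ge g 1 \<subseteq> I"
  unfolding tensors_ge_eq
proof (rule tens.span_minimal[OF _ ideal_subspace[OF I]], rule subsetI)
  fix x assume "x \<in> {foldr (\<otimes>\<^sub>t) (map tvec Xs) tone |Xs. set Xs \<subseteq> g \<and> 1 \<le> length Xs}"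
  then obtain Xs where Xs: "x = foldr (\<otimes>\<^sub>t) (map tvec Xs) tone" "set Xs \<subseteq> g" "1 \<le> length Xs" by blast
  then obtain X Ys where X: "Xs = X # Ys" by (cases Xs) auto
  have "foldr (\<otimes>\<^sub>t) (map tvec Ys) tone \<in> tensors_ge g 0"
    unfolding tensors_ge_eq by (rule tens.span_base) (use Xs X in auto)
  then show "x \<in> I"
    using ideal_mult(2)[OF I gI[of X]] Xs X by simp
qed

text \<open>The conclusion of the theorem, named so that each of the three cases can be proved in
  its own locale.\<close>

definition ideal_alternative ::
  "(complex^'m^'m) set \<Rightarrow> ('m tensor \<Rightarrow> 'm tensor) \<Rightarrow> complex \<Rightarrow> bool"
where
  "ideal_alternative g P lam \<longleftrightarrow> (lam \<noteq> 0 \<longrightarrow> I_bar g P lam = carrier (env_algebra g)) \<and>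
    (lam = 0 \<longrightarrow> I_bar g P lam = env_plus g \<and>
       maximalideal (env_plus g) (env_algebra g) \<and>
       (\<forall>M. maximalideal M (env_algebra g) \<and> M \<subseteq> env_plus g \<longrightarrow> M = env_plus g))"

section \<open>Congruences modulo the ideal\<close>

locale cartan_ideal = cartan_proj g H P C u d
  for g :: "(complex^'m^'m) set" and H P C u d +
  fixes lam :: complex
  assumes sub: "cmat.subspace g" and br: "\<And>X Y. X \<in> g \<Longrightarrow> Y \<in> g \<Longrightarrow> bracket X Y \<in> g"
begin

abbreviation "II \<equiv> I_ideal g P lam"

text \<open>A generator of the ideal without its Cartan part \<open>P (tt X Y)\<close>. Combinations
  of such elements lie in the ideal once the Cartan parts cancel, as in \<open>rel_sum\<close> and
  \<open>rel_diff\<close>.\<close>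

definition rel :: "complex^'m^'m \<Rightarrow> complex^'m^'m \<Rightarrow> 'm tensor" where
  "rel X Y = tt X Y - tscale (1/2) (tvec (bracket X Y)) - tscale (lam * killing g X Y) tone"

lemma generators_carrier:
  "{tt X Y - P (tt X Y) - tscale (1/2) (tvec (bracket X Y)) - tscale (lam * killing g X Y) tone |X Y.
     X \<in> g \<and> Y \<in> g} \<subseteq> carrier (tensor_algebra g)"
proof -
  have "tt X Y - P (tt X Y) - tscale (1/2) (tvec (bracket X Y)) - tscale (lam * killing g X Y) tone
      \<in> tensors_ge g 0" if "X \<in> g" "Y \<in> g" for X Y
  proof -
    have "tt X Y \<in> tpower g 2" using that by (rule tt_in)
    then have "tt X Y \<in> tensors_ge g 0" "P (tt X Y) \<in> tensors_ge g 0"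
      using tpower_tensors_ge[of 0 2 g] PC CT by blast+
    moreover have "tvec (bracket X Y) \<in> tensors_ge g 0"
      using tvec_in[OF br[OF that]] tensors_ge_mono[of 0 1 g] by auto
    ultimately show ?thesis
      by (intro tens.subspace_diff[OF subspace_tensors_ge] tens.subspace_scale[OF subspace_tensors_ge] tone_in_tensors)
  qed
  then show ?thesis by (auto simp: carrier_tensor_algebra_iff)
qed

lemma ideal_II: "ideal II (tensor_algebra g)"
  unfolding I_ideal_def by (rule ring.genideal_ideal[OF ring_tensor_algebra generators_carrier])

lemmas II_add = tens.subspace_add[OF ideal_subspace[OF ideal_II]]
  and II_diff = tens.subspace_diff[OF ideal_subspace[OF ideal_II]]
  and II_scale = tens.subspace_scale[OF ideal_subspace[OF ideal_II]]
  and II_sum = tens.subspace_sum[OF ideal_subspace[OF ideal_II]]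

lemma II_mult: "a \<in> II \<Longrightarrow> X \<in> g \<Longrightarrow> tvec X \<otimes>\<^sub>t a \<in> II" "a \<in> II \<Longrightarrow> X \<in> g \<Longrightarrow> a \<otimes>\<^sub>t tvec X \<in> II"
  using ideal_mult[OF ideal_II] tvec_in[of X g] tensors_ge_mono[of 0 1 g] by auto

lemma generator_in:
  assumes "X \<in> g" "Y \<in> g"
  shows "rel X Y - P (tt X Y) \<in> II"
proof -
  have "tt X Y - P (tt X Y) - tscale (1/2) (tvec (bracket X Y)) - tscale (lam * killing g X Y) tone \<in> II"
    unfolding I_ideal_def
    by (rule subsetD[OF ring.genideal_self[OF ring_tensor_algebra generators_carrier]]) (use assms in blast)
  moreover have "tt X Y - P (tt X Y) - tscale (1/2) (tvec (bracket X Y)) - tscale (lam * killing g X Y) tone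
     = rel X Y - P (tt X Y)"
    by (simp add: rel_def algebra_simps)
  ultimately show ?thesis by simp
qed

lemma rel_sum:
  assumes "finite A" "\<And>k. k \<in> A \<Longrightarrow> X k \<in> g" "\<And>k. k \<in> A \<Longrightarrow> Y k \<in> g"
    and "P (\<Sum>k\<in>A. tt (X k) (Y k)) = 0"
  shows "(\<Sum>k\<in>A. rel (X k) (Y k)) \<in> II"
proof -
  have "(\<Sum>k\<in>A. rel (X k) (Y k) - P (tt (X k) (Y k))) \<in> II"
    by (rule II_sum) (use generator_in assms in blast)
  moreover have "(\<Sum>k\<in>A. P (tt (X k) (Y k))) = 0"
    using P_sum[OF assms(1), of "\<lambda>k. tt (X k) (Y k)"] assms tt_in by (metis (no_types, lifting))
  ultimately show ?thesis by (simp only: sum_subtractf diff_0_right)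
qed

lemma rel_diff:
  assumes "X \<in> g" "Y \<in> g" "X' \<in> g" "Y' \<in> g" "P (tt X Y - tt X' Y') = 0"
  shows "rel X Y - rel X' Y' \<in> II"
proof -
  have "(rel X Y - P (tt X Y)) - (rel X' Y' - P (tt X' Y')) \<in> II"
    by (intro II_diff generator_in assms)
  moreover have "P (tt X Y) = P (tt X' Y')"
    using P_diff[OF tt_in[OF assms(1,2)] tt_in[OF assms(3,4)]] assms(5) by simp
  moreover have "(a - p) - (b - p) = a - b" for a b p :: "'m tensor"
    by (simp only: diff_diff_eq2 diff_add_cancel)
  ultimately show ?thesis by simp
qed

text \<open>Once \<open>g\<close> lies in the ideal, so does everything of positive degree, and the
  generator for \<open>X0\<close> and \<open>Y0\<close> leaves the constant
  \<open>lam * killing g X0 Y0\<close>. For \<open>lam = 0\<close> no generator has a constant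
  part.\<close>

lemma conclusion:
  assumes gI: "\<And>X. X \<in> g \<Longrightarrow> tvec X \<in> II"
    and k: "X0 \<in> g" "Y0 \<in> g" "killing g X0 Y0 \<noteq> 0"
  shows "ideal_alternative g P lam"
  unfolding ideal_alternative_def
proof (intro conjI impI allI)
  have T1: "tensors_ge g 1 \<subseteq> II" by (rule ideal_contains_tensors_ge_1[OF ideal_II gI])
  have PT: "P (tt X Y) \<in> tensors_ge g 1" if "X \<in> g" "Y \<in> g" for X Y
    using tt_in[OF that] PC CT tpower_tensors_ge[of 1 2 g] by force
  have tT: "tt X Y \<in> tensors_ge g 1" if "X \<in> g" "Y \<in> g" for X Y
    using tt_in[OF that] tpower_tensors_ge[of 1 2 g] by force
  {
    assume lam: "lam \<noteq> 0"
    have "tt X0 Y0 - tscale (1/2) (tvec (bracket X0 Y0)) - P (tt X0 Y0) \<in> II"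
      using T1 tT[OF k(1,2)] PT[OF k(1,2)] tvec_in[OF br[OF k(1,2)]]
      by (intro II_diff II_scale) auto
    from II_diff[OF this generator_in[OF k(1,2)]]
    have "tscale (lam * killing g X0 Y0) tone \<in> II"
      by (simp add: rel_def algebra_simps)
    then have "tscale (1 / (lam * killing g X0 Y0)) (tscale (lam * killing g X0 Y0) tone) \<in> II"
      by (rule II_scale)
    then have "tone \<in> II" using lam k(3) by simp
    then have "II = carrier (tensor_algebra g)"
      using ideal.one_imp_carrier[OF ideal_II] by (simp add: tensor_algebra_def)
    then show "I_bar g P lam = carrier (env_algebra g)"
      by (auto simp: I_bar_def env_proj_def env_algebra_def FactRing_def A_RCOSETS_def')
  }
  assume lam: "lam = 0"
  have "II \<subseteq> tensors_ge g 1"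
    unfolding I_ideal_def
  proof (rule ring.genideal_minimal[OF ring_tensor_algebra ideal_tensors_ge_1])
    have "tt X Y - P (tt X Y) - tscale (1 / 2) (tvec (bracket X Y)) - tscale (lam * killing g X Y) tone
        \<in> tensors_ge g 1" if "X \<in> g" "Y \<in> g" for X Y
      unfolding lam mult_zero_left tens.scale_zero_left diff_0_right
      by (intro tens.subspace_diff[OF subspace_tensors_ge] tens.subspace_scale[OF subspace_tensors_ge]
          tT PT tvec_in br that)
    then show "{tt X Y - P (tt X Y) - tscale (1 / 2) (tvec (bracket X Y)) - tscale (lam * killing g X Y) tone |X Y.
       X \<in> g \<and> Y \<in> g} \<subseteq> tensors_ge g 1" by blast
  qed
  then have "II = tensors_ge g 1" using T1 by blast
  then show "I_bar g P lam = env_plus g" by (simp add: I_bar_def env_plus_def)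
  show mx: "maximalideal (env_plus g) (env_algebra g)" by (rule maximalideal_env_plus[OF br])
  show "M = env_plus g" if M: "maximalideal M (env_algebra g) \<and> M \<subseteq> env_plus g" for M
  proof -
    interpret p: maximalideal "env_plus g" "env_algebra g" by (rule mx)
    interpret M: maximalideal M "env_algebra g" using M by blast
    have "env_plus g = M \<or> env_plus g = carrier (env_algebra g)"
      using M by (intro M.I_maximal p.ideal_axioms p.a_subset) blast
    then show ?thesis using p.I_notcarr by auto
  qed
qed

end

section \<open>Killing forms\<close>

text \<open>Composition with a projection \<open>pr\<close> onto \<open>V\<close> extends
  \<open>f\<close> to all matrices without changing the trace. This exchanges the arbitrary basis
  chosen in \<open>trace_on\<close> for the elementary matrices.\<close>

lemma trace_on_eq:
  fixes V :: "(complex^'m^'m) set"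
  assumes V: "cmat.subspace V"
    and f: "Vector_Spaces.linear cmat_scale cmat_scale f" "\<And>x. x \<in> V \<Longrightarrow> f x \<in> V"
    and pr: "Vector_Spaces.linear cmat_scale cmat_scale pr" "\<And>x. pr x \<in> V" "\<And>x. x \<in> V \<Longrightarrow> pr x = x"
  shows "trace_on V f = (\<Sum>i\<in>UNIV. \<Sum>j\<in>UNIV. f (pr (axis i (axis j 1))) $ i $ j)"
proof -
  interpret f: Vector_Spaces.linear cmat_scale cmat_scale f by (rule f)
  interpret pr: Vector_Spaces.linear cmat_scale cmat_scale pr by (rule pr)
  define B where "B = (SOME B. cmat.independent B \<and> cmat.span B = V)"
  have "\<exists>B. cmat.independent B \<and> cmat.span B = V"
  proof -
    obtain B where B: "B \<subseteq> V" "cmat.independent B" "V \<subseteq> cmat.span B"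
      by (rule cmat.maximal_independent_subset)
    have "cmat.span B = V" by (rule antisym[OF cmat.span_minimal[OF B(1) V] B(3)])
    then show ?thesis using B(2) by (intro exI[of _ B] conjI)
  qed
  from someI_ex[OF this] have B: "cmat.independent B" "cmat.span B = V"
    unfolding B_def by simp_all
  have fin: "finite B"
  proof -
    obtain B' where B': "finite B'" "B' \<subseteq> V" "cmat.independent B'" "V \<subseteq> cmat.span B'"
      by (rule cmat_finite_basis)
    have "B \<subseteq> cmat.span B'" using cmat.span_superset[of B] B'(4) unfolding B(2) by (rule subset_trans)
    from cmat.independent_span_bound[OF B'(1) B(1) this] show ?thesis ..
  qed
  let ?c = "\<lambda>x b. cmat.representation B x b"
  have rep: "x = (\<Sum>b\<in>B. cmat_scale (?c x b) b)" if "x \<in> V" for x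
    using cmat.sum_representation_eq[OF B(1) _ fin order_refl, of x] that B(2) by simp
  have BV: "b \<in> V" if "b \<in> B" for b using cmat.span_base[OF that] unfolding B(2) .
  have lin: "?c (pr x) b = (\<Sum>i\<in>UNIV. \<Sum>j\<in>UNIV. x $ i $ j * ?c (pr (axis i (axis j 1))) b)" for x b
  proof -
    have "?c (pr x) b = ?c (\<Sum>i\<in>UNIV. \<Sum>j\<in>UNIV. cmat_scale (x $ i $ j) (pr (axis i (axis j 1)))) b"
      by (subst cmat_sum_axis[of x]) (simp add: pr.sum pr.scale)
    also have "\<dots> = (\<Sum>i\<in>UNIV. \<Sum>j\<in>UNIV. x $ i $ j * ?c (pr (axis i (axis j 1))) b)"
    proof -
      have 1: "cmat_scale (x $ i $ j) (pr (axis i (axis j 1))) \<in> cmat.span B" for i j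
        unfolding B(2) by (rule cmat.subspace_scale[OF V pr(2)])
      then have 2: "(\<Sum>j\<in>UNIV. cmat_scale (x $ i $ j) (pr (axis i (axis j 1)))) \<in> cmat.span B" for i
        by (intro cmat.span_sum)
      have 3: "?c (cmat_scale (x $ i $ j) (pr (axis i (axis j 1)))) b = x $ i $ j * ?c (pr (axis i (axis j 1))) b" for i j
        by (subst cmat.representation_scale[OF B(1)]) (simp_all add: B(2) pr(2))
      show ?thesis
        by (subst cmat.representation_sum[OF B(1) 2], subst cmat.representation_sum[OF B(1) 1]) (simp only: 3)
    qed
    finally show ?thesis .
  qed
  have "(\<Sum>i\<in>UNIV. \<Sum>j\<in>UNIV. f (pr (axis i (axis j 1))) $ i $ j) =
      (\<Sum>i\<in>UNIV. \<Sum>j\<in>UNIV. \<Sum>b\<in>B. ?c (pr (axis i (axis j 1))) b * f b $ i $ j)"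
  proof (intro sum.cong refl)
    fix i j
    have "f (pr (axis i (axis j 1))) = (\<Sum>b\<in>B. cmat_scale (?c (pr (axis i (axis j 1))) b) (f b))"
      by (subst rep[OF pr(2)]) (simp only: f.sum f.scale)
    then show "f (pr (axis i (axis j 1))) $ i $ j = (\<Sum>b\<in>B. ?c (pr (axis i (axis j 1))) b * f b $ i $ j)"
      by simp
  qed
  also have "\<dots> = (\<Sum>b\<in>B. \<Sum>i\<in>UNIV. \<Sum>j\<in>UNIV. ?c (pr (axis i (axis j 1))) b * f b $ i $ j)"
    unfolding sum.swap[of _ B UNIV] ..
  also have "\<dots> = (\<Sum>b\<in>B. ?c (f b) b)"
  proof (rule sum.cong[OF refl])
    fix b assume b: "b \<in> B"
    have "?c (f b) b = ?c (pr (f b)) b" using pr(3) f(2) BV[OF b] by simp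
    then show "(\<Sum>i\<in>UNIV. \<Sum>j\<in>UNIV. ?c (pr (axis i (axis j 1))) b * f b $ i $ j) = ?c (f b) b"
      unfolding lin[of "f b"] by (simp add: mult.commute)
  qed
  also have "\<dots> = trace_on V f" by (simp add: trace_on_def B_def Let_def)
  finally show ?thesis ..
qed

text \<open>Taking \<open>k = i\<close> and \<open>l = j\<close> shows that the map from
  \<open>Z\<close> to \<open>A ** Z ** B\<close> has trace \<open>trace A * trace B\<close> on the
  space of all matrices; a double bracket is a signed sum of four such maps.\<close>

lemma mult_axis_mult: "(A ** axis i (axis j 1) ** B) $ k $ l = A $ k $ i * (B $ j $ l :: complex)"
proof -
  have "(A ** axis i (axis j 1)) $ k $ m = (if m = j then A $ k $ i else 0)" for m
    by (auto simp: matrix_matrix_mult_def axis_def if_distrib[of "\<lambda>a. _ * a"]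
        if_distrib[of "\<lambda>a. a $ _"] cong: if_cong)
  then show ?thesis
    by (simp add: matrix_matrix_mult_def[of _ B] if_distrib[of "\<lambda>a. a * _"] cong: if_cong)
qed

lemma double_bracket_expand:
  fixes X Y Z :: "complex^'m^'m"
  shows "bracket X (bracket Y Z) = (X ** Y) ** Z ** mat 1 - X ** Z ** Y - (Y ** Z ** X - mat 1 ** Z ** (Y ** X))"
  by (simp add: bracket_def cmat_mult_diff matrix_mul_assoc)

lemma sum_double_bracket:
  fixes X Y :: "complex^'m^'m"
  shows "(\<Sum>i\<in>UNIV. \<Sum>j\<in>UNIV. bracket X (bracket Y (axis i (axis j 1))) $ i $ j)
    = 2 * of_nat CARD('m) * trace (X ** Y) - 2 * trace X * trace Y"
proof -
  have s: "(\<Sum>i\<in>UNIV. \<Sum>j\<in>UNIV. A $ i $ i * B $ j $ j) = trace A * trace B" for A B :: "complex^'m^'m"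
    by (simp add: trace_def sum_product)
  have "(\<Sum>i\<in>UNIV. \<Sum>j\<in>UNIV. bracket X (bracket Y (axis i (axis j 1))) $ i $ j)
    = trace (X ** Y) * trace (mat 1 :: complex^'m^'m) - trace X * trace Y
      - (trace Y * trace X - trace (mat 1 :: complex^'m^'m) * trace (Y ** X))"
    unfolding double_bracket_expand vector_minus_component mult_axis_mult sum_subtractf s ..
  also have "\<dots> = 2 * of_nat CARD('m) * trace (X ** Y) - 2 * trace X * trace Y"
    by (simp add: trace_mul_sym[of Y X] trace_I)
  finally show ?thesis .
qed

lemma linear_double_bracket: "Vector_Spaces.linear cmat_scale cmat_scale (\<lambda>Z. bracket X (bracket Y Z))"
  by unfold_locales (simp_all add: bracket_linear)

lemma subspace_sl: "cmat.subspace sl_algebra"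
  by (auto simp: cmat.subspace_def sl_algebra_def trace_def sum.distrib sum_distrib_left[symmetric])

lemma bracket_sl: "bracket A B \<in> sl_algebra"
  by (simp add: sl_algebra_def bracket_def trace_sub trace_mul_sym[of A B])

text \<open>Brackets ignore scalar matrices, so the projection onto the trace-free matrices drops
  out of the sum.\<close>

lemma killing_sl:
  fixes X Y :: "complex^'m^'m"
  assumes "X \<in> sl_algebra" "Y \<in> sl_algebra"
  shows "killing sl_algebra X Y = 2 * of_nat CARD('m) * trace (X ** Y)"
proof -
  define pr where "pr A = A - cmat_scale (trace A / of_nat CARD('m)) (mat 1)" for A :: "complex^'m^'m"
  have pr0: "bracket X (bracket Y (pr A)) = bracket X (bracket Y A)" for A
  proof -
    have "bracket Y (mat 1) = 0" by (simp add: bracket_def)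
    then show ?thesis by (simp add: pr_def bracket_linear)
  qed
  have k: "killing sl_algebra X Y = (\<Sum>i\<in>UNIV. \<Sum>j\<in>UNIV. bracket X (bracket Y (pr (axis i (axis j 1)))) $ i $ j)"
    unfolding killing_def
  proof (rule trace_on_eq[OF subspace_sl linear_double_bracket])
    show "Vector_Spaces.linear cmat_scale cmat_scale pr"
      by unfold_locales (simp_all add: pr_def vec_eq_iff trace_def algebra_simps sum.distrib
          sum_distrib_left[symmetric] add_divide_distrib)
    show "pr A \<in> sl_algebra" for A
      by (simp add: pr_def sl_algebra_def trace_def sum_subtractf mat_def)
    show "pr A = A" if "A \<in> sl_algebra" for A
      using that by (simp add: pr_def sl_algebra_def)
  qed (rule bracket_sl)
  show ?thesis using assms unfolding k pr0 by (simp add: sum_double_bracket sl_algebra_def)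
qed

context eps_form
begin

text \<open>The projection is half of the identity minus the adjoint for the form. The identity
  contributes \<open>2 * CARD('m)\<close> and the adjoint \<open>4 * eps\<close> to the coefficient
  of the trace form; half their difference is \<open>CARD('m) - 2 * eps\<close>.\<close>

lemma killing_sp:
  assumes XY: "X \<in> sp_algebra J" "Y \<in> sp_algebra J"
  shows "killing (sp_algebra J) X Y = (of_nat CARD('m) - 2 * eps) * trace (X ** Y)"
proof -
  define K where "K = matrix_inv J"
  have K: "K ** J = mat 1" "J ** K = mat 1"
    using matrix_inv_left[OF J(2)] by (auto simp: K_def matrix_left_right_inverse)
  have K': "K ** (J ** A) = A" "J ** (K ** A) = A" for A :: "complex^'m^'m"
    by (simp_all add: matrix_mul_assoc K)
  have tK: "transpose K = cmat_scale eps K"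
  proof -
    have "transpose K ** transpose J = mat 1" by (simp add: matrix_transpose_mul[symmetric] K)
    then have "cmat_scale eps (transpose K ** J) = mat 1" by (simp add: J cmat_scale_mult)
    then have "cmat_scale eps (transpose K ** J) ** K = K" by simp
    then have "cmat_scale eps (transpose K) = K"
      by (simp add: cmat_scale_mult matrix_mul_assoc[symmetric] K)
    then have "cmat_scale eps (cmat_scale eps (transpose K)) = cmat_scale eps K" by simp
    then show ?thesis by simp
  qed
  have neg: "trace (- A) = - trace A" for A :: "complex^'m^'m" by (simp add: trace_def sum_negf)
  have tr: "transpose A ** J = - (J ** A)" if "A \<in> sp_algebra J" for A
    using that by (simp add: sp_algebra_def add_eq_0_iff2)
  define pr where "pr A = cmat_scale (1/2) (A - K ** transpose A ** J)" for A :: "complex^'m^'m"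
  have tsimp: "transpose (A + B) = transpose A + transpose B" "transpose (A - B) = transpose A - transpose B"
    "transpose (cmat_scale c A) = cmat_scale c (transpose A)" for A B :: "complex^'m^'m" and c
    by (simp_all add: vec_eq_iff transpose_def)
  have "killing (sp_algebra J) X Y = (\<Sum>i\<in>UNIV. \<Sum>j\<in>UNIV. bracket X (bracket Y (pr (axis i (axis j 1)))) $ i $ j)"
    unfolding killing_def
  proof (rule trace_on_eq[OF subspace_sp_algebra linear_double_bracket])
    show "Vector_Spaces.linear cmat_scale cmat_scale pr"
      by unfold_locales
        (simp_all add: pr_def tsimp cmat_mult_diff cmat_scale_mult cmat.scale_right_distrib
          cmat.scale_right_diff_distrib algebra_simps)
    show "pr A \<in> sp_algebra J" for A
    proof -
      have "transpose A ** J + J ** A - (J ** A + transpose A ** J) = 0" by simp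
      then show ?thesis
        unfolding sp_algebra_def pr_def
        by (simp add: tsimp cmat_mult_diff cmat_scale_mult matrix_transpose_mul J tK
            matrix_mul_assoc[symmetric] K K' cmat.scale_right_diff_distrib)
    qed
    show "pr A = A" if "A \<in> sp_algebra J" for A
    proof -
      have "K ** transpose A ** J = - A"
        by (simp only: matrix_mul_assoc[symmetric] tr[OF that] cmat_mult_diff K')
      then show ?thesis by (simp add: pr_def vec_eq_iff)
    qed
    show "bracket X (bracket Y Z) \<in> sp_algebra J" if "Z \<in> sp_algebra J" for Z
      by (intro bracket_sp_algebra XY that)
  qed
  also have "\<dots> = (1/2) * ((\<Sum>i\<in>UNIV. \<Sum>j\<in>UNIV. bracket X (bracket Y (axis i (axis j 1))) $ i $ j)
      - (\<Sum>i\<in>UNIV. \<Sum>j\<in>UNIV. bracket X (bracket Y (K ** transpose (axis i (axis j 1)) ** J)) $ i $ j))"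
    unfolding pr_def bracket_linear cmat_scale_nth vector_minus_component
      sum_distrib_left[symmetric] sum_subtractf ..
  also have "(\<Sum>i\<in>UNIV. \<Sum>j\<in>UNIV. bracket X (bracket Y (K ** transpose (axis i (axis j 1)) ** J)) $ i $ j)
      = 4 * eps * trace (X ** Y)"
  proof -
    have ta: "transpose (axis i (axis j 1)) = (axis j (axis i 1) :: complex^'m^'m)" for i j
      by (auto simp: transpose_def axis_def vec_eq_iff)
    \<comment> \<open>The transposition exchanges the indices of the elementary matrix, which turns
      the product of two traces into one trace of a product; \<open>eps\<close> enters through the
      transpose of \<open>K\<close>.\<close>
    have s: "(\<Sum>i\<in>UNIV. \<Sum>j\<in>UNIV. (A ** (K ** transpose (axis i (axis j 1)) ** J) ** B) $ i $ j)
        = eps * trace (K ** (transpose A ** J) ** B)" for A B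
    proof -
      have "(\<Sum>i\<in>UNIV. \<Sum>j\<in>UNIV. (A ** (K ** transpose (axis i (axis j 1)) ** J) ** B) $ i $ j)
        = (\<Sum>i\<in>UNIV. \<Sum>j\<in>UNIV. ((A ** K) ** axis j (axis i 1) ** (J ** B)) $ i $ j)"
        by (simp add: ta matrix_mul_assoc)
      also have "\<dots> = (\<Sum>i\<in>UNIV. \<Sum>j\<in>UNIV. (A ** K) $ i $ j * (J ** B) $ i $ j)"
        unfolding mult_axis_mult ..
      also have "\<dots> = trace (transpose (A ** K) ** (J ** B))"
        unfolding trace_def matrix_matrix_mult_def[of "transpose _"]
        by (subst sum.swap) (simp add: transpose_def)
      also have "transpose (A ** K) ** (J ** B) = cmat_scale eps (K ** (transpose A ** J) ** B)"
        by (simp add: matrix_transpose_mul tK cmat_scale_mult matrix_mul_assoc)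
      finally show ?thesis by (simp add: trace_def sum_distrib_left)
    qed
    have XYt: "transpose (X ** Y) ** J = J ** (Y ** X)"
    proof -
      have "transpose (X ** Y) ** J = transpose Y ** (transpose X ** J)"
        by (simp add: matrix_transpose_mul matrix_mul_assoc)
      also have "\<dots> = - ((transpose Y ** J) ** X)" by (simp add: tr[OF XY(1)] cmat_mult_diff matrix_mul_assoc)
      also have "\<dots> = J ** (Y ** X)" by (simp add: tr[OF XY(2)] cmat_mult_diff matrix_mul_assoc)
      finally show ?thesis .
    qed
    have m1: "transpose (mat 1) ** J = J" by simp
    show ?thesis
      unfolding double_bracket_expand vector_minus_component sum_subtractf s XYt tr[OF XY(1)] tr[OF XY(2)] m1
      by (simp add: cmat_mult_diff K K' neg trace_mul_sym[of Y X])
  qed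
  also have "(\<Sum>i\<in>UNIV. \<Sum>j\<in>UNIV. bracket X (bracket Y (axis i (axis j 1))) $ i $ j)
      = 2 * of_nat CARD('m) * trace (X ** Y)"
  proof -
    have "X = - (K ** transpose X ** J)"
      by (simp only: matrix_mul_assoc[symmetric] tr[OF XY(1)] cmat_mult_diff K' minus_minus)
    then have "trace X = trace (- (K ** transpose X ** J))" by (rule arg_cong)
    also have "\<dots> = - trace (K ** transpose X ** J)" by (rule neg)
    also have "trace (K ** transpose X ** J) = trace (J ** (K ** transpose X))" by (rule trace_mul_sym)
    also have "\<dots> = trace X" unfolding K' by (simp add: trace_def transpose_def)
    finally have "trace X = 0" by simp
    then show ?thesis by (simp add: sum_double_bracket)
  qed
  finally show ?thesis by (simp add: algebra_simps)
qed

end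

section \<open>Relations in the three cases\<close>

text \<open>Both highest weights are evaluated at \<open>H0\<close>: the eigenvalue
  \<open>\<theta>\<close> of \<open>v\<close> fixes the eigenvalue \<open>2 * \<theta>\<close> of
  the weight vector \<open>u\<close> in the Cartan square.\<close>

lemma cartan_data:
  assumes c: "cartan_subalgebra g h" "positivity g h H0" and p: "cartan_projection g h H0 P"
  obtains C u v \<theta> where "cartan_proj g H0 P C u (2 * \<theta>)" "v \<in> g" "v \<noteq> 0"
    "bracket H0 v = cmat_scale \<theta> v"
    "\<And>X c. X \<in> g \<Longrightarrow> bracket H0 X = cmat_scale c X \<Longrightarrow> Re c > 0 \<Longrightarrow> bracket X v = 0"
proof -
  have H0: "H0 \<in> h" "H0 \<in> g"
    using c(2) cartan_subalgebraD(1)[OF c(1)] by (auto simp: positivity_def)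
  obtain C where C: "cartan_square g h H0 C" "P ` tpower g 2 = C"
    using p unfolding cartan_projection_def by (elim conjE exE)
  obtain \<theta> where th: "highest_weight g h H0 cmat_scale bracket g \<theta>"
      "highest_weight g h H0 tscale tact C (\<lambda>H. 2 * \<theta> H)"
    using C(1) unfolding cartan_square_def by (elim conjE exE)
  obtain v where v: "v \<in> g" "v \<noteq> 0" "\<forall>H\<in>h. bracket H v = cmat_scale (\<theta> H) v"
      "\<forall>\<alpha>. is_root g h \<alpha> \<and> Re (\<alpha> H0) > 0 \<longrightarrow> (\<forall>X\<in>root_space g h \<alpha>. bracket X v = 0)"
    using th(1) unfolding highest_weight_def by (elim conjE bexE)
  obtain u where u: "u \<in> C" "u \<noteq> 0" "\<forall>H\<in>h. tact H u = tscale (2 * \<theta> H) u"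
    using th(2) unfolding highest_weight_def by (elim conjE bexE)
  show ?thesis
  proof (rule that[of C u "\<theta> H0" v])
    show "cartan_proj g H0 P C u (2 * \<theta> H0)"
    proof
      show "irreducible_module g tscale tact C" "C \<subseteq> tpower g 2"
        using C(1) unfolding cartan_square_def by blast+
      show "u \<in> C" "u \<noteq> 0" by (fact u)+
      show "tact H0 u = tscale (2 * \<theta> H0) u" using u(3) H0(1) by (rule bspec)
      show "P ` tpower g 2 = C" by (fact C(2))
      show "H0 \<in> g" by (fact H0)
    qed (use p in \<open>simp_all add: cartan_projection_def\<close>)
    show "bracket H0 v = cmat_scale (\<theta> H0) v" using v(3) H0(1) by (rule bspec)
    show "\<And>X c. X \<in> g \<Longrightarrow> bracket H0 X = cmat_scale c X \<Longrightarrow> Re c > 0 \<Longrightarrow> bracket X v = 0"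
      by (rule positive_eigenvector_kills[OF c v(4)])
  qed (fact v)+
qed

lemma regular_commute:
  assumes c: "cartan_subalgebra g h" "positivity g h H0"
    and "X \<in> g" "Y \<in> g" "bracket H0 X = 0" "bracket H0 Y = 0"
  shows "bracket X Y = 0"
  using cartan_subalgebraD(3)[OF c(1)] regular_centralizer[OF c] assms(3-) by blast

lemma cartan_ad_diagonalizable:
  assumes c: "cartan_subalgebra g h" "positivity g h H0"
  shows "g \<subseteq> cmat.span {X. \<exists>c. bracket H0 X = cmat_scale c X}"
proof -
  have "H0 \<in> h" using c(2) by (simp add: positivity_def)
  then have "g = cmat.span {X\<in>g. \<exists>c. bracket H0 X = cmat_scale c X}"
    using cartan_subalgebraD(5)[OF c(1)] by simp
  also have "\<dots> \<subseteq> cmat.span {X. \<exists>c. bracket H0 X = cmat_scale c X}"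
    by (rule cmat.span_mono) auto
  finally show ?thesis .
qed

lemma tact_tt_eigen:
  assumes "bracket H X = cmat_scale a X" "bracket H Y = cmat_scale b Y"
  shows "tact H (tt X Y) = tscale (a + b) (tt X Y)"
  by (simp only: tact_tvec_tvec assms tt_linear tens.scale_left_distrib)

lemma tact_diff_eigen:
  "tact H s = tscale a s \<Longrightarrow> tact H t = tscale a t \<Longrightarrow> tact H (s - t) = tscale a (s - t)"
  by (simp only: tact.diff tens.scale_right_diff_distrib)

lemma trace_rank1_mult:
  fixes M :: "complex^'m^'m"
  assumes "trace M = 0"
  shows "trace (rank1 x f ** M) = dot f (M *v x)"
proof -
  have "trace (rank1 x f ** M) = (\<Sum>i\<in>UNIV. \<Sum>k\<in>UNIV. x $ i * f $ k * M $ k $ i -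
      (if i = k then dot f x / of_nat CARD('m) * M $ k $ i else 0))"
    unfolding trace_def matrix_matrix_mult_def
    by (simp, intro sum.cong refl) (auto simp: rank1_def left_diff_distrib)
  also have "\<dots> = (\<Sum>i\<in>UNIV. \<Sum>k\<in>UNIV. x $ i * f $ k * M $ k $ i) - dot f x / of_nat CARD('m) * trace M"
    by (simp add: sum_subtractf trace_def sum_distrib_left)
  also have "(\<Sum>i\<in>UNIV. \<Sum>k\<in>UNIV. x $ i * f $ k * M $ k $ i) = (\<Sum>k\<in>UNIV. \<Sum>i\<in>UNIV. x $ i * f $ k * M $ k $ i)"
    by (rule sum.swap)
  also have "\<dots> = dot f (M *v x)"
    by (simp add: dot_eq matrix_vector_mult_def sum_distrib_left mult_ac)
  finally show ?thesis by (simp add: assms)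
qed

lemma killing_rank1:
  fixes x :: "complex^'m"
  shows "killing sl_algebra (rank1 x f) (rank1 z h) = 2 * of_nat CARD('m) * (dot f z * dot h x) - 2 * (dot f x * dot h z)"
proof -
  have "trace (rank1 z h) = 0" using rank1_in[of z h] by (simp add: sl_algebra_def)
  then have "trace (rank1 x f ** rank1 z h) = dot h x * dot f z - dot h z / of_nat CARD('m) * dot f x"
    by (simp add: trace_rank1_mult rank1_mult_vec)
  then have "killing sl_algebra (rank1 x f) (rank1 z h) =
      2 * of_nat CARD('m) * (dot h x * dot f z - dot h z / of_nat CARD('m) * dot f x)"
    by (simp add: killing_sl)
  then show ?thesis by (simp add: right_diff_distrib mult_ac)
qed

text \<open>The second tensor power of \<open>sl(n)\<close> is spanned by tensors with two upper and two lower indices.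
  The Cartan square consists of those which are symmetric in either pair (and trace-free), so that
  the following antisymmetrizations are projected to zero.\<close>

definition \<phi>1 :: "complex^'m \<Rightarrow> complex^'m \<Rightarrow> complex^'m \<Rightarrow> complex^'m \<Rightarrow> 'm tensor" where
  "\<phi>1 x z f h = tt (rank1 x f) (rank1 z h) - tt (rank1 x h) (rank1 z f)"

definition \<phi>2 :: "complex^'m \<Rightarrow> complex^'m \<Rightarrow> complex^'m \<Rightarrow> complex^'m \<Rightarrow> 'm tensor" where
  "\<phi>2 x z f h = tt (rank1 x f) (rank1 z h) - tt (rank1 z f) (rank1 x h)"

lemma linear_tensorI:
  assumes "\<And>x y. f (x + y) = f x + f y" "\<And>c x. f (c *s x) = tscale c (f x)"
  shows "Vector_Spaces.linear (*s) tscale f"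
  by unfold_locales (fact assms)+

lemma \<phi>_linear:
  "Vector_Spaces.linear (*s) tscale (\<lambda>x. \<phi>1 x z f h)" "Vector_Spaces.linear (*s) tscale (\<lambda>z. \<phi>1 x z f h)"
  "Vector_Spaces.linear (*s) tscale (\<lambda>f. \<phi>1 x z f h)" "Vector_Spaces.linear (*s) tscale (\<lambda>h. \<phi>1 x z f h)"
  "Vector_Spaces.linear (*s) tscale (\<lambda>x. \<phi>2 x z f h)" "Vector_Spaces.linear (*s) tscale (\<lambda>z. \<phi>2 x z f h)"
  "Vector_Spaces.linear (*s) tscale (\<lambda>f. \<phi>2 x z f h)" "Vector_Spaces.linear (*s) tscale (\<lambda>h. \<phi>2 x z f h)"
  unfolding \<phi>1_def \<phi>2_def
  by (rule linear_tensorI; simp only: rank1_linear tt_linear tens.scale_right_diff_distrib add_diff_add)+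

lemma tact_\<phi>:
  "tact A (\<phi>1 x z f h) = \<phi>1 (A *v x) z f h + \<phi>1 x (A *v z) f h - \<phi>1 x z (f v* A) h - \<phi>1 x z f (h v* A)"
  "tact A (\<phi>2 x z f h) = \<phi>2 (A *v x) z f h + \<phi>2 x (A *v z) f h - \<phi>2 x z (f v* A) h - \<phi>2 x z f (h v* A)"
  unfolding \<phi>1_def \<phi>2_def tact.diff tact_tvec_tvec bracket_rank1 tt_linear
  by (simp_all only: algebra_simps)

context cartan_proj
begin

text \<open>The eigenvalue \<open>e i + e k - e j - e l\<close> equals
  \<open>2 * (e t - e b)\<close> only for \<open>i = k = t\<close> and \<open>j = l = b\<close>,
  where both antisymmetrizations vanish.\<close>

lemma P_\<phi>:
  fixes Q R :: "complex^'m^'m"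
  assumes g: "g = sl_algebra"
    and Q: "invertible Q" "\<And>i. H *v column i Q = e i *s column i Q"
    and R: "invertible R" "\<And>i. column i R v* H = e i *s column i R"
    and t: "\<And>i. i \<noteq> t \<Longrightarrow> Re (e i) < Re (e t)" and b: "\<And>i. i \<noteq> b \<Longrightarrow> Re (e b) < Re (e i)"
    and d: "d = 2 * (e t - e b)"
  shows "P (\<phi>1 x z f k) = 0" "P (\<phi>2 x z f k) = 0"
proof -
  have tt_rank1: "tt (rank1 x f) (rank1 z k) \<in> tpower g 2" for x f z k
    by (intro tt_in) (simp_all add: g)
  have \<phi>T: "\<phi>1 x z f k \<in> tpower g 2" "\<phi>2 x z f k \<in> tpower g 2" for x z f k
    unfolding \<phi>1_def \<phi>2_def by (intro tens.subspace_diff[OF subspace_tpower] tt_rank1)+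
  let ?x = "\<lambda>i. column i Q" and ?f = "\<lambda>i. column i R"
  have br: "bracket H (rank1 (?x i) (?f j)) = cmat_scale (e i - e j) (rank1 (?x i) (?f j))" for i j
    by (simp add: bracket_rank1 Q(2) R(2) rank1_linear cmat.scale_left_diff_distrib)
  have tt_eig: "tact H (tt (rank1 (?x i) (?f j)) (rank1 (?x k) (?f l)))
      = tscale (e i + e k - e j - e l) (tt (rank1 (?x i) (?f j)) (rank1 (?x k) (?f l)))" for i j k l
  proof -
    have "e i - e j + (e k - e l) = e i + e k - e j - e l" by simp
    then show ?thesis using tact_tt_eigen[OF br br, of i j k l] by simp
  qed
  have swap: "e i + e k - e j - e l = e i + e k - e l - e j" "e i + e k - e j - e l = e k + e i - e j - e l" for i k j l
    by simp_all
  have eig: "tact H (\<phi>1 (?x i) (?x k) (?f j) (?f l)) = tscale (e i + e k - e j - e l) (\<phi>1 (?x i) (?x k) (?f j) (?f l))"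
    "tact H (\<phi>2 (?x i) (?x k) (?f j) (?f l)) = tscale (e i + e k - e j - e l) (\<phi>2 (?x i) (?x k) (?f j) (?f l))"
    for i k j l
    unfolding \<phi>1_def \<phi>2_def
    using tt_eig[of i j k l] tt_eig[of i l k j] tt_eig[of k j i l]
    by (intro tact_diff_eigen; simp only: swap(1)[of i k l j] swap(2)[of k i j l])+
  have top: "Re (e i) \<le> Re (e t)" for i using t[of i] by (cases "i = t") auto
  have bot: "Re (e b) \<le> Re (e i)" for i using b[of i] by (cases "i = b") auto
  have ne1: "e i + e k - e j - e l \<noteq> d" if "j \<noteq> l" for i k j l
  proof
    assume "e i + e k - e j - e l = d"
    then have "Re (e i) + Re (e k) - Re (e j) - Re (e l) = 2 * (Re (e t) - Re (e b))"
      unfolding d by (auto simp: complex_eq_iff)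
    moreover have "Re (e j) + Re (e l) > 2 * Re (e b)"
      using that b[of j] b[of l] bot[of j] bot[of l] by (cases "j = b") force+
    ultimately show False using top[of i] top[of k] by argo
  qed
  have ne2: "e i + e k - e j - e l \<noteq> d" if "i \<noteq> k" for i k j l
  proof
    assume "e i + e k - e j - e l = d"
    then have "Re (e i) + Re (e k) - Re (e j) - Re (e l) = 2 * (Re (e t) - Re (e b))"
      unfolding d by (auto simp: complex_eq_iff)
    moreover have "Re (e i) + Re (e k) < 2 * Re (e t)"
      using that t[of i] t[of k] top[of i] top[of k] by (cases "i = t") force+
    ultimately show False using bot[of j] bot[of l] by argo
  qed
  have m: "\<phi>1 x z f k \<in> tens.span {\<phi>1 x z f k | x z f k. True}"
    "\<phi>2 x z f k \<in> tens.span {\<phi>2 x z f k | x z f k. True}" for x z f k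
    by (rule tens.span_base; blast)+
  show "P (\<phi>1 x z f k) = 0"
  proof (rule P_kills_multilinear[OF Q(1) Q(1) R(1) R(1), where \<phi> = \<phi>1])
    show "\<phi>1 (?x i) (?x k) (?f j) (?f l) = 0 \<or> (\<exists>c. c \<noteq> d \<and>
      tact H (\<phi>1 (?x i) (?x k) (?f j) (?f l)) = tscale c (\<phi>1 (?x i) (?x k) (?f j) (?f l)))" for i k j l
    proof (cases "j = l")
      case False
      then show ?thesis using eig(1) ne1 by blast
    qed (simp add: \<phi>1_def)
  qed (rule \<phi>_linear \<phi>T | simp only: tact_\<phi>, intro tens.span_add tens.span_diff m)+
  show "P (\<phi>2 x z f k) = 0"
  proof (rule P_kills_multilinear[OF Q(1) Q(1) R(1) R(1), where \<phi> = \<phi>2])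
    show "\<phi>2 (?x i) (?x k) (?f j) (?f l) = 0 \<or> (\<exists>c. c \<noteq> d \<and>
      tact H (\<phi>2 (?x i) (?x k) (?f j) (?f l)) = tscale c (\<phi>2 (?x i) (?x k) (?f j) (?f l)))" for i k j l
    proof (cases "i = k")
      case False
      then show ?thesis using eig(2) ne2 by blast
    qed (simp add: \<phi>2_def)
  qed (rule \<phi>_linear \<phi>T | simp only: tact_\<phi>, intro tens.span_add tens.span_diff m)+
qed

end

section \<open>The ideal for sl(n)\<close>

lemma tvec_sum: "tvec (\<Sum>i\<in>A. f i) = (\<Sum>i\<in>A. tvec (f i))"
proof (induction A rule: infinite_finite_induct)
  case (insert x F)
  then show ?case by (simp only: sum.insert tvec_linear not_False_eq_True)
qed (simp_all only: sum.infinite sum.empty tvec_linear not_False_eq_True)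

lemma scaled_in_ideal:
  assumes "tens.subspace I" "tscale c t \<in> I" "c \<noteq> 0"
  shows "t \<in> I"
  using tens.subspace_scale[OF assms(1,2), of "1 / c"] assms(3) by simp

context cartan_ideal
begin

lemma sl_relations:
  assumes g: "g = sl_algebra" and P\<phi>: "\<And>x z f k. P (\<phi>1 x z f k) = 0" "\<And>x z f k. P (\<phi>2 x z f k) = 0"
  shows "rel (rank1 x f) (rank1 z k) - rel (rank1 x k) (rank1 z f) \<in> II"
    "rel (rank1 x f) (rank1 z k) - rel (rank1 z f) (rank1 x k) \<in> II"
  using P\<phi>[of x z f k] unfolding \<phi>1_def \<phi>2_def by (intro rel_diff; simp add: g)+

text \<open>The Killing terms cancel by symmetry, and the two half brackets add up to a whole
  one.\<close>

lemma commutator_in_ideal: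
  assumes "rel X Y - rel Y X \<in> II" "killing g Y X = killing g X Y"
  shows "tt X Y - tt Y X - tvec (bracket X Y) \<in> II"
proof -
  have "tvec (bracket Y X) = - tvec (bracket X Y)"
    by (simp only: bracket_anticomm[of Y] tvec_linear)
  then have "rel X Y - rel Y X = tt X Y - tt Y X - tvec (bracket X Y)"
    unfolding rel_def assms(2) by (intro ext) (simp add: tscale_def)
  then show ?thesis using assms(1) by simp
qed

text \<open>Exchanging first the covectors and then the vectors exchanges the two factors.\<close>

lemma sl_commutator:
  assumes g: "g = sl_algebra" and P\<phi>: "\<And>x z f k. P (\<phi>1 x z f k) = 0" "\<And>x z f k. P (\<phi>2 x z f k) = 0"
  shows "tt (rank1 x f) (rank1 z k) - tt (rank1 z k) (rank1 x f) - tvec (bracket (rank1 x f) (rank1 z k)) \<in> II"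
proof (rule commutator_in_ideal)
  have "(rel (rank1 x f) (rank1 z k) - rel (rank1 x k) (rank1 z f)) + (rel (rank1 x k) (rank1 z f) - rel (rank1 z k) (rank1 x f)) \<in> II"
    by (intro II_add sl_relations[OF g P\<phi>])
  then show "rel (rank1 x f) (rank1 z k) - rel (rank1 z k) (rank1 x f) \<in> II" by simp
  show "killing g (rank1 z k) (rank1 x f) = killing g (rank1 x f) (rank1 z k)"
    by (simp add: g killing_rank1 mult.commute)
qed

lemma sl_in_ideal:
  fixes X :: "complex^'m^'m"
  assumes g: "g = sl_algebra" and P\<phi>: "\<And>x z f k. P (\<phi>1 x z f k) = 0" "\<And>x z f k. P (\<phi>2 x z f k) = 0"
    and card: "CARD('m) \<ge> 3" and lam: "2 * (of_nat CARD('m) + 1) * lam \<noteq> - (1/4)"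
    and X: "X \<in> g"
  shows "tvec X \<in> II"
proof -
  define E where "E i j = rank1 (axis i 1) (axis j 1 :: complex^'m)" for i j
  \<comment> \<open>In \<open>R1\<close> the Killing form is \<open>2 * CARD('m)\<close> on
    \<open>E q p\<close>, \<open>E p q\<close> and \<open>-2\<close> on \<open>E p p\<close>,
    \<open>E q q\<close>; \<open>\<kappa>\<close> is \<open>lam\<close> times the
    difference.\<close>
  define \<kappa> where "\<kappa> = 2 * (of_nat CARD('m) + 1) * lam"
  have Eg: "E i j \<in> g" for i j by (simp add: E_def g)
  have bE: "bracket (E i j) (E k l) = cmat_scale (if j = k then 1 else 0) (E i l) - cmat_scale (if i = l then 1 else 0) (E k j)"
    for i j k l by (simp add: E_def bracket_rank1_rank1 dot_axis eq_commute[of l i])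
  have kE: "killing g (E i j) (E k l) = 2 * of_nat CARD('m) * ((if j = k then 1 else 0) * (if i = l then 1 else 0))
      - 2 * ((if i = j then 1 else 0) * (if k = l then 1 else 0))" for i j k l
    unfolding E_def g killing_rank1 dot_axis by (simp add: eq_commute)
  let ?a = "\<lambda>i j. tvec (E i j)"
  have comm: "?a i j \<otimes>\<^sub>t ?a k l - ?a k l \<otimes>\<^sub>t ?a i j - tvec (bracket (E i j) (E k l)) \<in> II" for i j k l
    unfolding E_def by (rule sl_commutator[OF g P\<phi>])
  have r1: "rel (E i j) (E k l) - rel (E i l) (E k j) \<in> II" and r2: "rel (E i j) (E k l) - rel (E k j) (E i l) \<in> II"
    for i j k l unfolding E_def by (rule sl_relations[OF g P\<phi>])+
  have off: "?a q r \<in> II" if qr: "q \<noteq> r" for q r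
  proof -
    obtain p where p: "p \<noteq> q" "p \<noteq> r" by (rule third_index[OF card])
    note ne = qr p qr[symmetric] p[symmetric]
    define R1 where "R1 = ?a q p \<otimes>\<^sub>t ?a p q - ?a p p \<otimes>\<^sub>t ?a q q - tscale (1/2) (?a q q) + tscale (1/2) (?a p p) - tscale \<kappa> tone"
    define R2 where "R2 = ?a p q \<otimes>\<^sub>t ?a q r - ?a p r \<otimes>\<^sub>t ?a q q - tscale (1/2) (?a p r)"
    define R3 where "R3 = ?a q p \<otimes>\<^sub>t ?a p r - ?a q r \<otimes>\<^sub>t ?a p p - tscale (1/2) (?a q r)"
    define C1 where "C1 = ?a p p \<otimes>\<^sub>t ?a q r - ?a q r \<otimes>\<^sub>t ?a p p"
    define C2 where "C2 = ?a q q \<otimes>\<^sub>t ?a q r - ?a q r \<otimes>\<^sub>t ?a q q - ?a q r"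
    have R1: "R1 \<in> II"
    proof -
      have "R1 = rel (E q p) (E p q) - rel (E p p) (E q q)"
        unfolding R1_def rel_def bE kE \<kappa>_def using ne
        by (intro ext) (simp add: tvec_linear tscale_def algebra_simps)
      then show ?thesis using r2 by simp
    qed
    have R2: "R2 \<in> II"
    proof -
      have "R2 = rel (E p q) (E q r) - rel (E p r) (E q q)"
        unfolding R2_def rel_def bE kE using ne
        by (intro ext) (simp add: tvec_linear tscale_def algebra_simps)
      then show ?thesis using r1 by simp
    qed
    have R3: "R3 \<in> II"
    proof -
      have "R3 = rel (E q p) (E p r) - rel (E q r) (E p p)"
        unfolding R3_def rel_def bE kE using ne
        by (intro ext) (simp add: tvec_linear tscale_def algebra_simps)
      then show ?thesis using r1 by simp
    qed
    have C1: "C1 \<in> II" using comm[of p p q r] ne by (simp add: C1_def bE tvec_linear)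
    have C2: "C2 \<in> II" using comm[of q q q r] ne by (simp add: C2_def bE tvec_linear)
    \<comment> \<open>The overlap is \<open>E q p\<close>, \<open>E p q\<close>,
      \<open>E q r\<close>: \<open>R2\<close> rewrites the last two factors, \<open>R1\<close> the
      first two. \<open>R3\<close> and the commutators \<open>C1\<close>, \<open>C2\<close> bring
      both results to the same order. All cubic and quadratic terms cancel; 1/4 is 1/2 from half of
      \<open>C2\<close> less 1/4 from half of \<open>R3\<close>.\<close>
    have "?a q p \<otimes>\<^sub>t R2 - R1 \<otimes>\<^sub>t ?a q r + R3 \<otimes>\<^sub>t ?a q q + tscale (1/2) R3 - ?a p p \<otimes>\<^sub>t C2 - C1 \<otimes>\<^sub>t ?a q q
        - tscale (1/2) C2 - tscale (1/2) C1 \<in> II"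
      by (intro II_add II_diff II_scale II_mult R1 R2 R3 C1 C2 Eg)
    also have "?a q p \<otimes>\<^sub>t R2 - R1 \<otimes>\<^sub>t ?a q r + R3 \<otimes>\<^sub>t ?a q q + tscale (1/2) R3 - ?a p p \<otimes>\<^sub>t C2 - C1 \<otimes>\<^sub>t ?a q q
        - tscale (1/2) C2 - tscale (1/2) C1 = tscale (\<kappa> + 1/4) (?a q r)"
      unfolding R1_def R2_def R3_def C1_def C2_def tmult_diff tmult_linear tmult_assoc tmult_tone
      by (rule ext) (simp add: tscale_def algebra_simps)
    finally show ?thesis
      by (rule scaled_in_ideal[OF ideal_subspace[OF ideal_II]]) (use lam in \<open>simp add: \<kappa>_def eq_neg_iff_add_eq_0\<close>)
  qed
  have diag: "?a i i - ?a j j \<in> II" if ij: "i \<noteq> j" for i j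
  proof -
    have "(?a i j \<otimes>\<^sub>t ?a j i - ?a j i \<otimes>\<^sub>t ?a i j)
        - (?a i j \<otimes>\<^sub>t ?a j i - ?a j i \<otimes>\<^sub>t ?a i j - tvec (bracket (E i j) (E j i))) \<in> II"
      by (intro II_diff II_mult off comm Eg) (use ij in auto)
    moreover have "tvec (bracket (E i j) (E j i)) = ?a i i - ?a j j"
      by (simp add: bE tvec_linear)
    ultimately show ?thesis by simp
  qed
  have trX: "(\<Sum>i\<in>UNIV. X $ i $ i) = 0" using X by (simp add: g sl_algebra_def trace_def)
  have ax: "axis i (axis j 1) = E i j + cmat_scale (if i = j then 1 / of_nat CARD('m) else 0) (mat 1)" for i j
    unfolding E_def rank1_def dot_axis by (auto simp: vec_eq_iff axis_def mat_def)
  have "X = (\<Sum>i\<in>UNIV. \<Sum>j\<in>UNIV. cmat_scale (X $ i $ j) (E i j))"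
  proof -
    have "X = (\<Sum>i\<in>UNIV. \<Sum>j\<in>UNIV. cmat_scale (X $ i $ j) (E i j) +
        cmat_scale (if i = j then X $ i $ j / of_nat CARD('m) else 0) (mat 1))"
      by (subst cmat_sum_axis[of X], intro sum.cong refl) (auto simp: ax cmat.scale_right_distrib)
    also have "\<dots> = (\<Sum>i\<in>UNIV. \<Sum>j\<in>UNIV. cmat_scale (X $ i $ j) (E i j))
       + (\<Sum>i\<in>UNIV. \<Sum>j\<in>UNIV. cmat_scale (if i = j then X $ i $ j / of_nat CARD('m) else 0) (mat 1))"
      by (simp only: sum.distrib)
    also have "(\<Sum>i\<in>UNIV. \<Sum>j\<in>UNIV. cmat_scale (if i = j then X $ i $ j / of_nat CARD('m) else 0) (mat 1 :: complex^'m^'m))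
       = cmat_scale ((\<Sum>i\<in>UNIV. X $ i $ i) / of_nat CARD('m)) (mat 1)"
      by (simp only: cmat.scale_sum_left[symmetric] sum_divide_distrib sum.delta sum.delta' finite UNIV_I if_True)
    finally show ?thesis by (simp add: trX)
  qed
  then have "tvec X = tvec (\<Sum>i\<in>UNIV. \<Sum>j\<in>UNIV. cmat_scale (X $ i $ j) (E i j))"
    by (rule arg_cong)
  then have tX: "tvec X = (\<Sum>i\<in>UNIV. \<Sum>j\<in>UNIV. tscale (X $ i $ j) (?a i j))"
    by (simp only: tvec_sum tvec_linear)
  \<comment> \<open>Since \<open>X\<close> has trace 0, subtracting one fixed \<open>?a p p\<close>
    from all diagonal terms does not change the sum, and it leaves differences covered by
    \<open>diag\<close>.\<close>
  define p where "p = (SOME i :: 'm. True)"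
  let ?D = "\<lambda>i j. if i = j then ?a p p else 0"
  have "(\<Sum>i\<in>UNIV. \<Sum>j\<in>UNIV. tscale (X $ i $ j) (?D i j))
      = (\<Sum>i\<in>UNIV. \<Sum>j\<in>UNIV. if i = j then tscale (X $ i $ i) (?a p p) else 0)"
    by (intro sum.cong refl) simp
  also have "\<dots> = (\<Sum>i\<in>UNIV. tscale (X $ i $ i) (?a p p))" by (simp only: sum.delta finite UNIV_I if_True sum.delta')
  also have "\<dots> = tscale (\<Sum>i\<in>UNIV. X $ i $ i) (?a p p)" by (rule tens.scale_sum_left[symmetric])
  finally have D0: "(\<Sum>i\<in>UNIV. \<Sum>j\<in>UNIV. tscale (X $ i $ j) (?D i j)) = 0"
    by (simp only: trX tens.scale_zero_left)
  have "(\<Sum>i\<in>UNIV. \<Sum>j\<in>UNIV. tscale (X $ i $ j) (?a i j - ?D i j)) \<in> II"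
  proof (intro II_sum II_scale)
    fix i j
    consider "i \<noteq> j" | "i = j" "j = p" | "i = j" "j \<noteq> p" by blast
    then show "?a i j - ?D i j \<in> II"
    proof cases
      case 1
      then show ?thesis using off by simp
    next
      case 2
      then show ?thesis using tens.subspace_0[OF ideal_subspace[OF ideal_II]] by simp
    next
      case 3
      then show ?thesis using diag by simp
    qed
  qed
  then show ?thesis
    by (simp only: tX tens.scale_right_diff_distrib sum_subtractf D0 diff_0_right)
qed

lemma sl_conclusion:
  assumes g: "g = sl_algebra" and P\<phi>: "\<And>x z f k. P (\<phi>1 x z f k) = 0" "\<And>x z f k. P (\<phi>2 x z f k) = 0"
    and card: "CARD('m) \<ge> 3" and lam: "2 * (of_nat CARD('m) + 1) * lam \<noteq> - (1/4)"
  shows "ideal_alternative g P lam"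
proof -
  obtain i j :: 'm where ij: "i \<noteq> j" by (rule third_index[OF card])
  show ?thesis
  proof (rule conclusion)
    show "tvec X \<in> II" if "X \<in> g" for X by (rule sl_in_ideal[OF g P\<phi> card lam that])
    show "rank1 (axis i 1) (axis j 1) \<in> g" "rank1 (axis j 1) (axis i 1) \<in> g" by (simp_all add: g)
    show "killing g (rank1 (axis i 1) (axis j 1)) (rank1 (axis j 1) (axis i 1)) \<noteq> 0"
      unfolding g killing_rank1 dot_axis using ij card by simp
  qed
qed

end

section \<open>The ideals for so(n) and sp(2n)\<close>

context eps_form
begin

text \<open>The rows of the inverse of \<open>J\<close> are dual to the axes. Applied to
  \<open>z\<close>, the first terms of the \<open>E\<close> add up to \<open>X *v z\<close> by
  expanding \<open>z\<close>, and the second terms do so as well because \<open>X\<close> is skew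
  for the form; hence the factor 1/2.\<close>

lemma sp_eq_sum_E:
  assumes X: "X \<in> sp_algebra J"
  shows "X = (\<Sum>k\<in>UNIV. cmat_scale (1/2) (E (X *v axis k 1) (row k (matrix_inv J))))"
proof -
  define K where "K = matrix_inv J"
  have K: "K ** J = mat 1" "J ** K = mat 1"
    using matrix_inv_left[OF J(2)] by (auto simp: K_def matrix_left_right_inverse)
  have b: "bil J (row k K) z = z $ k" for k z
  proof -
    have "bil J (row k K) z = (K *v (J *v z)) $ k"
      by (simp add: bil_def row_def matrix_vector_mult_def[of K])
    then show ?thesis by (simp add: matrix_vector_mul_assoc K)
  qed
  have ax: "(\<Sum>k\<in>UNIV. z $ k *s axis k 1) = (z :: complex^'m)" for z
    by (simp add: vec_eq_iff axis_def if_distrib[of "\<lambda>a. _ * a"] cong: if_cong)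
  have dual: "(\<Sum>k\<in>UNIV. bil J u (axis k 1) *s row k K) = u" for u
  proof -
    have "bil J z (\<Sum>k\<in>UNIV. bil J u (axis k 1) *s row k K) = bil J z u" for z
    proof -
      have "bil J z (\<Sum>k\<in>UNIV. bil J u (axis k 1) *s row k K)
          = (\<Sum>k\<in>UNIV. bil J u (axis k 1) * (eps * z $ k))"
        by (simp add: bil_sum bil_swap[of z "row _ K"] b)
      also have "\<dots> = eps * bil J u (\<Sum>k\<in>UNIV. z $ k *s axis k 1)"
        by (simp add: bil_sum sum_distrib_left mult_ac)
      also have "\<dots> = bil J z u" by (simp add: ax bil_swap[of z u])
      finally show ?thesis .
    qed
    then have "bil J z ((\<Sum>k\<in>UNIV. bil J u (axis k 1) *s row k K) - u) = 0" for z by simp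
    then show ?thesis using nondeg by fastforce
  qed
  have "X *v z = (\<Sum>k\<in>UNIV. cmat_scale (1/2) (E (X *v axis k 1) (row k K))) *v z" for z
  proof -
    have s: "(\<Sum>k\<in>A. f k) *v z = (\<Sum>k\<in>A. f k *v z)" for A and f :: "'m \<Rightarrow> complex^'m^'m"
      by (induction A rule: infinite_finite_induct) (simp_all add: matrix_vector_mult_add_rdistrib)
    have t: "cmat_scale (1/2) (E (X *v axis k 1) (row k K)) *v z
       = (1/2) *s (X *v (z $ k *s axis k 1)) + (1/2) *s (bil J (X *v z) (axis k 1) *s row k K)" for k
    proof -
      have "bil J (X *v axis k 1) z = - (eps * bil J (X *v z) (axis k 1))"
        using bil_sp[OF X, of "axis k 1" z] bil_swap[of "axis k 1" "X *v z"] by simp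
      then show ?thesis
        by (simp add: cmat_scale_mult_vec E_mult_vec b vec.scale vec_eq_iff algebra_simps)
    qed
    have "(\<Sum>k\<in>UNIV. cmat_scale (1/2) (E (X *v axis k 1) (row k K))) *v z
       = (1/2) *s (X *v (\<Sum>k\<in>UNIV. z $ k *s axis k 1)) + (1/2) *s (\<Sum>k\<in>UNIV. bil J (X *v z) (axis k 1) *s row k K)"
      unfolding s t sum.distrib vec.scale_sum_right vec.sum ..
    also have "\<dots> = (1/2) *s (X *v z) + (1/2) *s (X *v z)" unfolding ax dual ..
    also have "\<dots> = X *v z" by (simp add: vec_eq_iff)
    finally show ?thesis ..
  qed
  then show ?thesis unfolding K_def[symmetric] matrix_eq by blast
qed

end

locale form_ideal = eps_form J eps + cartan_ideal "sp_algebra J" H P C u d lam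
  for J :: "complex^'m^'m" and eps H P C u d lam
begin

lemma eigen_tt_E:
  assumes "H *v x = a *s x" "H *v y = b *s y" "H *v z = a' *s z" "H *v w = b' *s w"
  shows "tact H (tt (E x y) (E z w)) = tscale (a + b + a' + b') (tt (E x y) (E z w))"
proof -
  have "bracket H (E x y) = cmat_scale (a + b) (E x y)" "bracket H (E z w) = cmat_scale (a' + b') (E z w)"
    using assms by (simp_all add: bracket_E[OF Hg] E_linear cmat.scale_left_distrib)
  from tact_tt_eigen[OF this] show ?thesis by (simp add: add.assoc)
qed

text \<open>For a skew form, the algebra is the symmetric square of the standard representation and the
  Cartan square its fourth symmetric power.\<close>

definition \<psi> :: "complex^'m \<Rightarrow> complex^'m \<Rightarrow> complex^'m \<Rightarrow> complex^'m \<Rightarrow> 'm tensor" where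
  "\<psi> x y z w = tt (E x y) (E z w) - tt (E x z) (E y w)"

lemma \<psi>_linear:
  "Vector_Spaces.linear (*s) tscale (\<lambda>x. \<psi> x y z w)" "Vector_Spaces.linear (*s) tscale (\<lambda>y. \<psi> x y z w)"
  "Vector_Spaces.linear (*s) tscale (\<lambda>z. \<psi> x y z w)" "Vector_Spaces.linear (*s) tscale (\<lambda>w. \<psi> x y z w)"
  unfolding \<psi>_def
  by (rule linear_tensorI; simp only: E_linear tt_linear tens.scale_right_diff_distrib add_diff_add)+

lemma tact_\<psi>:
  "A \<in> sp_algebra J \<Longrightarrow> tact A (\<psi> x y z w) =
     \<psi> (A *v x) y z w + \<psi> x (A *v y) z w + \<psi> x y (A *v z) w + \<psi> x y z (A *v w)"
  unfolding \<psi>_def tact.diff tact_tvec_tvec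
  by (simp only: bracket_E tt_linear) (simp only: algebra_simps)

text \<open>The eigenvalue \<open>4 * e t\<close> requires all four indices to be \<open>t\<close>,
  but \<open>\<psi>\<close> vanishes when its two middle arguments agree.\<close>

lemma P_\<psi>:
  fixes Q :: "complex^'m^'m"
  assumes Q: "invertible Q" "\<And>i. H *v column i Q = e i *s column i Q"
    and t: "\<And>i. i \<noteq> t \<Longrightarrow> Re (e i) < Re (e t)" and d: "d = 4 * e t"
  shows "P (\<psi> x y z w) = 0"
proof -
  have \<psi>T: "\<psi> x y z w \<in> tpower (sp_algebra J) 2" for x y z w
    unfolding \<psi>_def by (intro tens.subspace_diff[OF subspace_tpower] tt_in E_in)
  let ?x = "\<lambda>i. column i Q"
  have eig: "tact H (\<psi> (?x i) (?x j) (?x k) (?x l)) = tscale (e i + e j + e k + e l) (\<psi> (?x i) (?x j) (?x k) (?x l))"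
    for i j k l
    unfolding \<psi>_def
    using eigen_tt_E[OF Q(2) Q(2) Q(2) Q(2), of i j k l] eigen_tt_E[OF Q(2) Q(2) Q(2) Q(2), of i k j l]
    by (intro tact_diff_eigen) (simp_all only: add_ac)
  have top: "Re (e i) \<le> Re (e t)" for i using t[of i] by (cases "i = t") auto
  have ne: "e i + e j + e k + e l \<noteq> d" if "j \<noteq> k" for i j k l
  proof
    assume "e i + e j + e k + e l = d"
    then have "Re (e i) + Re (e j) + Re (e k) + Re (e l) = 4 * Re (e t)"
      unfolding d by (auto simp: complex_eq_iff)
    moreover have "Re (e j) + Re (e k) < 2 * Re (e t)"
      using that t[of j] t[of k] top[of j] top[of k] by (cases "j = t") force+
    ultimately show False using top[of i] top[of l] by argo
  qed
  have m: "\<psi> x y z w \<in> tens.span {\<psi> x y z w | x y z w. True}" for x y z w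
    by (rule tens.span_base) blast
  show ?thesis
  proof (rule P_kills_multilinear[OF Q(1) Q(1) Q(1) Q(1), where \<phi> = \<psi>])
    show "\<psi> (?x i) (?x j) (?x k) (?x l) = 0 \<or> (\<exists>c. c \<noteq> d \<and>
      tact H (\<psi> (?x i) (?x j) (?x k) (?x l)) = tscale c (\<psi> (?x i) (?x j) (?x k) (?x l)))" for i j k l
    proof (cases "j = k")
      case False
      then show ?thesis using eig ne by blast
    qed (simp add: \<psi>_def)
  qed (rule \<psi>_linear \<psi>T | simp only: tact_\<psi>, intro tens.span_add m)+
qed

lemma killing_E_E:
  "killing (sp_algebra J) (E x y) (E z w) =
     2 * (of_nat CARD('m) - 2 * eps) * (bil J w x * bil J y z - eps * bil J z x * bil J y w)"
  by (simp only: killing_sp[OF E_in E_in] trace_E_E mult_ac)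

lemma ideal_of_E:
  assumes "\<And>x y. tvec (E x y) \<in> II" "X \<in> sp_algebra J"
  shows "tvec X \<in> II"
proof -
  have "tvec X = tvec (\<Sum>k\<in>UNIV. cmat_scale (1/2) (E (X *v axis k 1) (row k (matrix_inv J))))"
    using sp_eq_sum_E[OF assms(2)] by (rule arg_cong)
  also have "\<dots> \<in> II" unfolding tvec_sum tvec_linear by (intro II_sum II_scale assms)
  finally show ?thesis .
qed

lemma skew_in_ideal:
  assumes eps: "eps = -1" and P\<psi>: "\<And>x y z w. P (\<psi> x y z w) = 0"
    and card: "CARD('m) \<ge> 3" and lam: "2 * (of_nat CARD('m) + 2) * lam \<noteq> - (1/4)"
  shows "tvec (E x y) \<in> II"
proof -
  let ?a = "\<lambda>x y. tvec (E x y)"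
  define \<kappa> where "\<kappa> = 2 * (of_nat CARD('m) + 2) * lam"
  have Es: "E y x = E x y" for x y using E_swap[of x y] eps by simp
  have Bs: "bil J y x = - bil J x y" for x y using bil_swap[of x y] eps by simp
  have B0: "bil J x x = 0" for x using Bs[of x x] by simp
  have r: "rel (E x y) (E z w) - rel (E x z) (E y w) \<in> II" for x y z w
    using P\<psi>[of x y z w] unfolding \<psi>_def by (intro rel_diff E_in)
  have comm: "tt (E x y) (E z w) - tt (E z w) (E x y) - tvec (bracket (E x y) (E z w)) \<in> II" for x y z w
  proof (rule commutator_in_ideal)
    have "(rel (E x y) (E z w) - rel (E x z) (E y w)) + (rel (E z x) (E w y) - rel (E z w) (E x y)) \<in> II"
      by (intro II_add r)
    then show "rel (E x y) (E z w) - rel (E z w) (E x y) \<in> II"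
      by (simp add: Es[of z x] Es[of w y])
    show "killing (sp_algebra J) (E z w) (E x y) = killing (sp_algebra J) (E x y) (E z w)"
      unfolding killing_E_E using Bs[of w x] Bs[of y z] Bs[of z x] Bs[of y w] by (simp add: algebra_simps)
  qed
  have qr: "?a q r \<in> II" if pq: "bil J p q = 1" "bil J p r = 0" "bil J q r = 0" for p q r
  proof -
    have B: "bil J q p = -1" "bil J r p = 0" "bil J r q = 0"
      by (subst Bs, simp add: pq)+
    note B = B pq B0
    \<comment> \<open>In units of \<open>2 * (CARD('m) + 2)\<close> the Killing form is -2 on
      \<open>E q q\<close>, \<open>E p p\<close> and 1 on \<open>E q p\<close>,
      \<open>E q p\<close>, whence \<open>3 * \<kappa>\<close>.\<close>
    define S1 where "S1 = ?a q q \<otimes>\<^sub>t ?a p p - ?a p q \<otimes>\<^sub>t ?a p q + tscale 2 (?a p q) + tscale (3 * \<kappa>) tone"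
    define S2 where "S2 = ?a p p \<otimes>\<^sub>t ?a q r - ?a p q \<otimes>\<^sub>t ?a p r - tscale (3/2) (?a p r)"
    define S3 where "S3 = ?a q q \<otimes>\<^sub>t ?a p r - ?a p q \<otimes>\<^sub>t ?a q r + tscale (3/2) (?a q r)"
    define C' where "C' = ?a p q \<otimes>\<^sub>t ?a q q - ?a q q \<otimes>\<^sub>t ?a p q - tscale 2 (?a q q)"
    have S1: "S1 \<in> II"
    proof -
      have "S1 = rel (E q q) (E p p) - rel (E q p) (E q p)"
        unfolding S1_def rel_def bracket_E_E killing_E_E B Es[of p q] \<kappa>_def tvec_linear unfolding eps
        by (intro ext) (simp add: tscale_def algebra_simps)
      then show ?thesis using r by simp
    qed
    have S2: "S2 \<in> II"
    proof -
      have "S2 = rel (E p p) (E q r) - rel (E p q) (E p r)"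
        unfolding S2_def rel_def bracket_E_E killing_E_E B Es[of p q] Es[of p r] tvec_linear unfolding eps
        by (intro ext) (simp add: tscale_def algebra_simps)
      then show ?thesis using r by simp
    qed
    have S3: "S3 \<in> II"
    proof -
      have "S3 = rel (E q q) (E p r) - rel (E q p) (E q r)"
        unfolding S3_def rel_def bracket_E_E killing_E_E B Es[of p q] Es[of q r] tvec_linear unfolding eps
        by (intro ext) (simp add: tscale_def algebra_simps)
      then show ?thesis using r by simp
    qed
    have C': "C' \<in> II"
    proof -
      have "bracket (E p q) (E q q) = cmat_scale 2 (E q q)"
        unfolding bracket_E_E B unfolding eps by (simp add: vec_eq_iff)
      then show ?thesis using comm[of p q q q] by (simp add: C'_def tvec_linear)
    qed
    \<comment> \<open>The overlap is \<open>E q q\<close>, \<open>E p p\<close>,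
      \<open>E q r\<close>: \<open>S1\<close> rewrites the first two factors, \<open>S2\<close> the
      last two, and \<open>S3\<close> with the commutator \<open>C'\<close> reconciles the
      results.\<close>
    have "S1 \<otimes>\<^sub>t ?a q r - ?a p q \<otimes>\<^sub>t S3 + C' \<otimes>\<^sub>t ?a p r + tscale (1/2) S3 - ?a q q \<otimes>\<^sub>t S2 \<in> II"
      by (intro II_add II_diff II_scale II_mult S1 S2 S3 C' E_in)
    also have "S1 \<otimes>\<^sub>t ?a q r - ?a p q \<otimes>\<^sub>t S3 + C' \<otimes>\<^sub>t ?a p r + tscale (1/2) S3 - ?a q q \<otimes>\<^sub>t S2
        = tscale (3 * (\<kappa> + 1/4)) (?a q r)"
      unfolding S1_def S2_def S3_def C'_def tmult_diff tmult_linear tmult_assoc tmult_tone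
      by (rule ext) (simp add: tscale_def algebra_simps)
    finally show ?thesis
    proof (rule scaled_in_ideal[OF ideal_subspace[OF ideal_II]])
      have "\<kappa> + 1/4 \<noteq> 0" using lam by (simp only: \<kappa>_def eq_neg_iff_add_eq_0 not_False_eq_True)
      then show "3 * (\<kappa> + 1/4) \<noteq> 0" by (simp only: mult_eq_0_iff) simp
    qed
  qed
  have qq: "?a q q \<in> II" for q
  proof (cases "q = 0")
    case True
    then show ?thesis using tens.subspace_0[OF ideal_subspace[OF ideal_II]]
      by (simp add: E_linear tvec_linear)
  next
    case False
    then obtain p where p: "bil J p q = 1" by (rule nondeg_witness)
    have Bqp: "bil J q p = -1" using Bs[of q p] p by simp
    \<comment> \<open>Projection onto the complement of \<open>p\<close> and \<open>q\<close>, which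
      is nonzero by the dimension. Two vectors there with pairing -1 give \<open>E q q\<close>, up
      to sign, as the bracket of \<open>E q (pr s)\<close> and \<open>E q (pr s')\<close>, both
      already in the ideal.\<close>
    define pr where "pr s = s + bil J s p *s q - bil J s q *s p" for s
    have pr0: "bil J p (pr s) = 0" "bil J q (pr s) = 0" for s
      using Bs[of s p] Bs[of s q] by (simp_all add: pr_def B0 p Bqp)
    obtain s where s: "s \<notin> vec.span {p, q}" using vec_not_spanned_by_2[OF card] .
    have r0: "pr s \<noteq> 0"
    proof
      assume "pr s = 0"
      then have "s = bil J s q *s p - bil J s p *s q" by (simp add: pr_def algebra_simps)
      moreover have "bil J s q *s p - bil J s p *s q \<in> vec.span {p, q}"
        by (intro vec.span_diff vec.span_scale vec.span_base) auto
      ultimately show False using s by simp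
    qed
    then obtain s' where s': "bil J s' (pr s) = 1" by (rule nondeg_witness)
    have rr: "bil J (pr s) (pr s') = -1"
    proof -
      have "bil J (pr s') (pr s) = 1" unfolding pr_def[of s'] by (simp add: s' pr0)
      then show ?thesis using Bs[of "pr s" "pr s'"] by simp
    qed
    have m: "?a q (pr s) \<in> II" "?a q (pr s') \<in> II" using qr p pr0 by blast+
    have "bil J (pr s) q = 0" by (subst Bs) (simp add: pr0)
    then have "bracket (E q (pr s)) (E q (pr s')) = - E q q"
      unfolding bracket_E_E by (simp add: rr pr0 B0 vec_eq_iff)
    then have "(tt (E q (pr s)) (E q (pr s')) - tt (E q (pr s')) (E q (pr s)) + ?a q q)
      - (tt (E q (pr s)) (E q (pr s')) - tt (E q (pr s')) (E q (pr s))) \<in> II"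
      using comm[of q "pr s" q "pr s'"]
      by (intro II_diff II_mult m E_in) (simp add: tvec_linear)
    then show ?thesis by simp
  qed
  \<comment> \<open>Polarization of the symmetric product.\<close>
  have "tscale (1/2) (?a (x + y) (x + y) - ?a x x - ?a y y) \<in> II" by (intro II_scale II_diff qq)
  also have "tscale (1/2) (?a (x + y) (x + y) - ?a x x - ?a y y) = ?a x y"
    unfolding E_linear tvec_linear Es[of y x] by (rule ext) (simp add: tscale_def)
  finally show ?thesis .
qed

lemma skew_conclusion:
  assumes eps: "eps = -1" and P\<psi>: "\<And>x y z w. P (\<psi> x y z w) = 0"
    and card: "CARD('m) \<ge> 3" and lam: "2 * (of_nat CARD('m) + 2) * lam \<noteq> - (1/4)"
  shows "ideal_alternative (sp_algebra J) P lam"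
proof -
  have "(axis undefined 1 :: complex^'m) \<noteq> 0" by (simp add: axis_eq_0_iff)
  then obtain p where p: "bil J p (axis undefined 1) = 1" by (rule nondeg_witness)
  have q: "bil J (axis undefined 1) p = -1" using bil_swap[of "axis undefined 1" p] p eps by simp
  have "of_nat (CARD('m) + 2) \<noteq> (0 :: complex)" by (simp only: of_nat_eq_0_iff)
  then have "of_nat CARD('m) + 2 \<noteq> (0 :: complex)" by (simp add: add.commute)
  moreover have "killing (sp_algebra J) (E p p) (E (axis undefined 1) (axis undefined 1))
      = - 4 * (of_nat CARD('m) + 2)"
    unfolding killing_E_E p q unfolding eps by (simp add: algebra_simps)
  ultimately have k: "killing (sp_algebra J) (E p p) (E (axis undefined 1) (axis undefined 1)) \<noteq> 0"
    by (simp only: mult_eq_0_iff) simp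
  show ?thesis
    by (rule conclusion[OF ideal_of_E[OF skew_in_ideal[OF assms]] E_in E_in k])
qed

text \<open>For a symmetric form, the algebra is the exterior square of the standard representation. The
  Cartan square has the symmetries of the Weyl tensor: antisymmetrization in three indices and
  contraction are projected to zero.\<close>

definition \<chi>3 :: "complex^'m \<Rightarrow> complex^'m \<Rightarrow> complex^'m \<Rightarrow> complex^'m \<Rightarrow> 'm tensor" where
  "\<chi>3 x y z w = tt (E x y) (E z w) + tt (E y z) (E x w) + tt (E z x) (E y w)"

definition \<omega> :: "complex^'m \<Rightarrow> complex^'m \<Rightarrow> 'm tensor" where
  "\<omega> x y = (\<Sum>k\<in>UNIV. tt (E x (axis k 1)) (E (axis k 1) y))"

lemma \<chi>3_linear:
  "Vector_Spaces.linear (*s) tscale (\<lambda>x. \<chi>3 x y z w)" "Vector_Spaces.linear (*s) tscale (\<lambda>y. \<chi>3 x y z w)"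
  "Vector_Spaces.linear (*s) tscale (\<lambda>z. \<chi>3 x y z w)" "Vector_Spaces.linear (*s) tscale (\<lambda>w. \<chi>3 x y z w)"
  unfolding \<chi>3_def
  by (rule linear_tensorI; simp only: E_linear tt_linear tens.scale_right_distrib; simp only: add_ac)+

lemma \<omega>_linear:
  "Vector_Spaces.linear (*s) tscale (\<lambda>x. \<omega> x y)" "Vector_Spaces.linear (*s) tscale (\<lambda>y. \<omega> x y)"
  unfolding \<omega>_def
  by (rule linear_tensorI; simp only: E_linear tt_linear tens.scale_sum_right sum.distrib)+

lemma tact_\<chi>3:
  "A \<in> sp_algebra J \<Longrightarrow> tact A (\<chi>3 x y z w) =
     \<chi>3 (A *v x) y z w + \<chi>3 x (A *v y) z w + \<chi>3 x y (A *v z) w + \<chi>3 x y z (A *v w)"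
  unfolding \<chi>3_def tact.add tact_tvec_tvec
  by (simp only: bracket_E tt_linear) (simp only: add_ac)

text \<open>The axes are orthonormal for \<open>J = mat 1\<close>, so \<open>A\<close> is a skew
  matrix and its two actions on the contracted index cancel.\<close>

lemma tact_\<omega>:
  assumes A: "A \<in> sp_algebra J" and J1: "J = mat 1"
  shows "tact A (\<omega> x y) = \<omega> (A *v x) y + \<omega> x (A *v y)"
proof -
  have skew: "A $ l $ k = - A $ k $ l" for k l
  proof -
    have "transpose A $ k $ l = (- A) $ k $ l" using A unfolding J1 so_algebra_eq[symmetric] so_algebra_def by simp
    then show ?thesis by (simp add: transpose_def)
  qed
  have ax: "A *v axis k 1 = (\<Sum>l\<in>UNIV. A $ l $ k *s axis l 1)" for k
    by (simp add: vec_eq_iff matrix_vector_mult_def axis_def if_distrib[of "\<lambda>a. _ * a"] cong: if_cong)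
  have 1: "(\<Sum>k\<in>UNIV. tt (E x (A *v axis k 1)) (E (axis k 1) y))
     = (\<Sum>k\<in>UNIV. \<Sum>l\<in>UNIV. tscale (A $ l $ k) (tt (E x (axis l 1)) (E (axis k 1) y)))"
    unfolding ax E_sum E_linear tvec_sum tvec_linear tmult_sum tmult_linear ..
  have "(\<Sum>k\<in>UNIV. tt (E x (axis k 1)) (E (A *v axis k 1) y))
     = (\<Sum>k\<in>UNIV. \<Sum>l\<in>UNIV. tscale (A $ l $ k) (tt (E x (axis k 1)) (E (axis l 1) y)))"
    unfolding ax E_sum E_linear tvec_sum tvec_linear tmult_sum tmult_linear ..
  also have "\<dots> = (\<Sum>l\<in>UNIV. \<Sum>k\<in>UNIV. tscale (A $ l $ k) (tt (E x (axis k 1)) (E (axis l 1) y)))"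
    by (rule sum.swap)
  also have "\<dots> = (\<Sum>l\<in>UNIV. \<Sum>k\<in>UNIV. - tscale (A $ k $ l) (tt (E x (axis k 1)) (E (axis l 1) y)))"
    by (intro sum.cong refl, subst skew) (rule tens.scale_minus_left)
  finally have 2: "(\<Sum>k\<in>UNIV. tt (E x (axis k 1)) (E (A *v axis k 1) y))
     = - (\<Sum>k\<in>UNIV. tt (E x (A *v axis k 1)) (E (axis k 1) y))"
    unfolding 1 sum_negf .
  have "tact A (\<omega> x y) = \<omega> (A *v x) y + (\<Sum>k\<in>UNIV. tt (E x (A *v axis k 1)) (E (axis k 1) y))
     + ((\<Sum>k\<in>UNIV. tt (E x (axis k 1)) (E (A *v axis k 1) y)) + \<omega> x (A *v y))"
    unfolding \<omega>_def tact.sum tact_tvec_tvec bracket_E[OF A] tt_linear sum.distrib ..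
  then show ?thesis unfolding 2 by simp
qed

text \<open>\<open>\<chi>3\<close> vanishes when two of its first three arguments agree. Three
  distinct indices contain \<open>t\<close> and \<open>s\<close> at most once each, so their
  eigenvalues sum to less than \<open>e t + 2 * e s\<close>, and a fourth adds at most
  \<open>e t\<close>. For \<open>\<omega>\<close> two eigenvalues give at most
  \<open>2 * e t\<close>, which is too small because \<open>e s\<close> is positive.\<close>

lemma P_\<chi>3_\<omega>:
  fixes Q :: "complex^'m^'m"
  assumes J1: "J = mat 1" and eps: "eps = 1"
    and Q: "invertible Q" "\<And>i. H *v column i Q = e i *s column i Q"
    and ts: "Re (e s) < Re (e t)" "0 < Re (e s)"
      "\<And>i. i \<noteq> t \<Longrightarrow> i \<noteq> s \<Longrightarrow> Re (e i) < Re (e s)"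
    and d: "d = 2 * (e t + e s)"
  shows "P (\<chi>3 x y z w) = 0" "P (\<omega> x y) = 0"
proof -
  have \<chi>T: "\<chi>3 x y z w \<in> tpower (sp_algebra J) 2" and \<omega>T: "\<omega> x y \<in> tpower (sp_algebra J) 2" for x y z w
    unfolding \<chi>3_def \<omega>_def
    by (intro tens.subspace_add[OF subspace_tpower] tens.subspace_sum[OF subspace_tpower] tt_in E_in)+
  let ?G = "{t \<in> tpower (sp_algebra J) 2. \<exists>c. c \<noteq> d \<and> tact H t = tscale c t}"
  let ?x = "\<lambda>i. column i Q"
  have eig: "tact H (\<chi>3 (?x i) (?x j) (?x k) (?x l)) = tscale (e i + e j + e k + e l) (\<chi>3 (?x i) (?x j) (?x k) (?x l))"
    for i j k l
  proof -
    have c: "e j + e k + e i + e l = e i + e j + e k + e l" "e k + e i + e j + e l = e i + e j + e k + e l"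
      by (simp_all only: add_ac)
    show ?thesis
      unfolding \<chi>3_def tact.add tens.scale_right_distrib
      using eigen_tt_E[OF Q(2) Q(2) Q(2) Q(2), of i j k l] eigen_tt_E[OF Q(2) Q(2) Q(2) Q(2), of j k i l]
        eigen_tt_E[OF Q(2) Q(2) Q(2) Q(2), of k i j l]
      by (simp only: c)
  qed
  have eig\<omega>: "tact H (\<omega> (?x i) (?x j)) = tscale (e i + e j) (\<omega> (?x i) (?x j))" for i j
  proof -
    have "\<omega> (c *s x) y = tscale c (\<omega> x y)" "\<omega> x (c *s y) = tscale c (\<omega> x y)" for c x y
      by (simp_all only: \<omega>_def E_linear tt_linear tens.scale_sum_right)
    then show ?thesis by (simp only: tact_\<omega>[OF Hg J1] Q(2) tens.scale_left_distrib)
  qed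
  have le: "Re (e i) \<le> Re (e t)" for i using ts(1) ts(3)[of i] by (cases "i = t"; cases "i = s") auto
  have le2: "Re (e i) \<le> Re (e s)" if "i \<noteq> t" for i using ts(3)[of i] that by (cases "i = s") auto
  have ne: "e i + e j + e k + e l \<noteq> d" if "i \<noteq> j" "i \<noteq> k" "j \<noteq> k" for i j k l
  proof
    assume "e i + e j + e k + e l = d"
    then have "Re (e i) + Re (e j) + Re (e k) + Re (e l) = 2 * Re (e t) + 2 * Re (e s)"
      unfolding d by (auto simp: complex_eq_iff)
    moreover have "Re (e i) + Re (e j) + Re (e k) < Re (e t) + 2 * Re (e s)"
    proof (cases "i = t \<or> j = t \<or> k = t")
      case True
      then show ?thesis
        using that ts(1) ts(3)[of i] ts(3)[of j] ts(3)[of k] le2[of i] le2[of j] le2[of k]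
        by (cases "i = s"; cases "j = s"; cases "k = s") auto
    next
      case False
      then show ?thesis using ts(1) le2[of i] le2[of j] le2[of k] by auto
    qed
    ultimately show False using le[of l] by argo
  qed
  have ne\<omega>: "e i + e j \<noteq> d" for i j
  proof
    assume "e i + e j = d"
    then have "Re (e i) + Re (e j) = 2 * Re (e t) + 2 * Re (e s)"
      unfolding d by (auto simp: complex_eq_iff)
    then show False using le[of i] le[of j] ts(2) by argo
  qed
  have Exx: "E x x = 0" for x using E_swap[of x x] eps by (simp add: vec_eq_iff)
  have Esw: "E y x = - E x y" for x y using E_swap[of x y] eps by (simp add: vec_eq_iff)
  have sp\<omega>: "\<omega> x y \<in> tens.span ?G" for x y
  proof -
    have b: "\<omega> (?x i) (?x j) \<in> tens.span ?G" for i j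
      by (rule tens.span_base) (use \<omega>T eig\<omega> ne\<omega> in blast)
    have "\<omega> (?x i) y \<in> tens.span ?G" for i y
      by (rule columns_induct[where f = "\<lambda>y. \<omega> (?x i) y", OF Q(1) tens.subspace_span \<omega>_linear(2)]) (rule b)
    then show ?thesis
      by (rule columns_induct[where f = "\<lambda>x. \<omega> x y", OF Q(1) tens.subspace_span \<omega>_linear(1)])
  qed
  let ?S\<omega> = "{\<omega> x y | x y. True}"
  have m: "\<chi>3 x y z w \<in> tens.span {\<chi>3 x y z w | x y z w. True}" and m\<omega>: "\<omega> x y \<in> tens.span ?S\<omega>"
    for x y z w
    by (rule tens.span_base; blast)+
  show "P (\<chi>3 x y z w) = 0"
  proof (rule P_kills_multilinear[OF Q(1) Q(1) Q(1) Q(1), where \<phi> = \<chi>3])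
    fix i j k l
    have 0: "\<chi>3 x x z w = 0" "\<chi>3 x z x w = 0" "\<chi>3 z x x w = 0" for x z w
      unfolding \<chi>3_def Exx Esw[of z x] tt_linear by simp_all
    show "\<chi>3 (?x i) (?x j) (?x k) (?x l) = 0 \<or> (\<exists>c. c \<noteq> d \<and>
      tact H (\<chi>3 (?x i) (?x j) (?x k) (?x l)) = tscale c (\<chi>3 (?x i) (?x j) (?x k) (?x l)))"
      using eig[of i j k l] ne[of i j k l] 0 by metis
  qed (rule \<chi>3_linear \<chi>T | simp only: tact_\<chi>3, intro tens.span_add m)+
  show "P (\<omega> x y) = 0"
  proof (rule P_kills[of ?S\<omega>, OF _ _ _ m\<omega>])
    show "?S\<omega> \<subseteq> tpower (sp_algebra J) 2" using \<omega>T by blast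
    show "?S\<omega> \<subseteq> tens.span ?G" using sp\<omega> by blast
    show "tact X s \<in> tens.span ?S\<omega>" if sS: "s \<in> ?S\<omega>" and X: "X \<in> sp_algebra J" for X s
    proof -
      obtain x y where s: "s = \<omega> x y" using sS by blast
      show ?thesis unfolding s tact_\<omega>[OF X J1] by (intro tens.span_add m\<omega>)
    qed
  qed
qed

end

section \<open>Reduction in degree three for so(n)\<close>

context form_ideal
begin

lemma symmetric_in_ideal:
  assumes J1: "J = mat 1" and eps: "eps = 1"
    and P0: "\<And>x y z w. P (\<chi>3 x y z w) = 0" "\<And>x y. P (\<omega> x y) = 0"
    and card: "CARD('m) \<ge> 3"
    and lam: "2 * (of_nat CARD('m) - 1) * (of_nat CARD('m) - 2) * lam + (of_nat CARD('m) - 4) / 2 \<noteq> 0"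
    and X: "X \<in> sp_algebra J"
  shows "tvec X \<in> II"
proof -
  let ?a = "\<lambda>x y. tvec (E x y)" and ?n = "of_nat CARD('m) :: complex"
  let ?e = "\<lambda>k. axis k 1 :: complex^'m"
  \<comment> \<open>Summed over \<open>k\<close>, the Killing forms of \<open>E x (?e k)\<close> and
    \<open>E (?e k) y\<close> give \<open>2 * (?n - 1) * (?n - 2) * bil J x y\<close>, so
    \<open>\<mu>\<close> is the coefficient of the constant in the contraction relation
    \<open>F\<close>.\<close>
  define \<mu> where "\<mu> = 2 * (?n - 1) * (?n - 2) * lam"
  have Exx: "E x x = 0" for x using E_swap[of x x] eps by (simp add: vec_eq_iff)
  have Esw: "E y x = - E x y" for x y using E_swap[of x y] eps by (simp add: vec_eq_iff)
  have Bs: "bil J y x = bil J x y" for x y using bil_swap[of x y] eps by simp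
  have Be: "bil J (?e k) x = x $ k" for k x by (simp add: bil_axis J1)
  have Be': "bil J x (?e k) = x $ k" for k x by (rule trans[OF Bs Be])
  have expand: "(\<Sum>k\<in>UNIV. x $ k *s ?e k) = x" for x
    by (simp add: vec_eq_iff axis_def if_distrib[of "\<lambda>a. _ * a"] cong: if_cong)
  have Bsum: "(\<Sum>k\<in>UNIV. x $ k * y $ k) = bil J x y" for x y by (simp add: bil_def J1)
  \<comment> \<open>\<open>S\<close> is the sum of the half brackets in the cyclic relation
    \<open>A\<close>, from which the Killing terms drop out.\<close>
  define S where "S x y z w = tscale (bil J x w) (?a y z) + tscale (bil J y w) (?a z x) + tscale (bil J z w) (?a x y)"
    for x y z w
  define A where "A x y z w = ?a x y \<otimes>\<^sub>t ?a z w + ?a y z \<otimes>\<^sub>t ?a x w + ?a z x \<otimes>\<^sub>t ?a y w - S x y z w" for x y z w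
  define F where "F x y = (\<Sum>k\<in>UNIV. ?a x (?e k) \<otimes>\<^sub>t ?a (?e k) y) - tscale ((?n - 2) / 2) (?a x y)
     - tscale (\<mu> * bil J x y) tone" for x y
  have A: "A x y z w \<in> II" for x y z w
  proof -
    define X' where "X' i = (if i = 0 then E x y else if i = Suc 0 then E y z else E z x)" for i :: nat
    define Y' where "Y' i = (if i = 0 then E z w else if i = Suc 0 then E x w else E y w)" for i :: nat
    have s3: "(\<Sum>i\<in>{0, 1, 2}. f i) = f 0 + (f 1 + f 2)" for f :: "nat \<Rightarrow> 'm tensor" by simp
    have "(\<Sum>i\<in>{0, 1, 2}. rel (X' i) (Y' i)) \<in> II"
    proof (rule rel_sum)
      show "P (\<Sum>i\<in>{0, 1, 2}. tt (X' i) (Y' i)) = 0"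
        using P0(1)[of x y z w] unfolding s3 X'_def Y'_def \<chi>3_def by (simp add: add.assoc)
    qed (auto simp: X'_def Y'_def)
    then have "rel (E x y) (E z w) + (rel (E y z) (E x w) + rel (E z x) (E y w)) \<in> II"
      unfolding s3 X'_def Y'_def by simp
    moreover have "rel (E x y) (E z w) + (rel (E y z) (E x w) + rel (E z x) (E y w)) = A x y z w"
      unfolding A_def S_def rel_def bracket_E_E killing_E_E tvec_linear
      unfolding tvec_linear Esw[of y z] Esw[of x z] Esw[of x y] Esw[of w x] Esw[of w y] Esw[of w z]
        Bs[of x w] Bs[of y w] Bs[of z w] Bs[of x y] Bs[of x z] Bs[of y z]
      unfolding eps
      by (intro ext) (simp add: tscale_def algebra_simps)
    ultimately show ?thesis by simp
  qed
  have F: "F x y \<in> II" for x y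
  proof -
    have "(\<Sum>k\<in>UNIV. rel (E x (?e k)) (E (?e k) y)) \<in> II"
      by (rule rel_sum) (use P0(2)[of x y] in \<open>simp_all add: \<omega>_def\<close>)
    moreover have "(\<Sum>k\<in>UNIV. rel (E x (?e k)) (E (?e k) y)) = F x y"
    proof -
      have b: "(\<Sum>k\<in>UNIV. bracket (E x (?e k)) (E (?e k) y)) = cmat_scale (?n - 2) (E x y)"
      proof -
        have t: "bracket (E x (?e k)) (E (?e k) y)
            = E x y - E (x $ k *s ?e k) y + E (y $ k *s ?e k) x" for k
          unfolding bracket_E_E E_linear Be Be' Exx unfolding eps by simp
        have "(\<Sum>k\<in>UNIV. bracket (E x (?e k)) (E (?e k) y))
            = (\<Sum>k\<in>(UNIV::'m set). E x y) - E x y + E y x"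
          unfolding t sum.distrib sum_subtractf E_sum(2)[symmetric] expand ..
        also have "(\<Sum>k\<in>(UNIV::'m set). E x y) = cmat_scale ?n (E x y)"
          unfolding vec_eq_iff sum_component cmat_scale_nth by simp
        also have "cmat_scale ?n (E x y) - E x y + E y x = cmat_scale (?n - 2) (E x y)"
          unfolding Esw[of y x] by (simp add: vec_eq_iff algebra_simps)
        finally show ?thesis .
      qed
      have k: "(\<Sum>k\<in>UNIV. lam * killing (sp_algebra J) (E x (?e k)) (E (?e k) y)) = \<mu> * bil J x y"
      proof -
        have t: "lam * killing (sp_algebra J) (E x (?e k)) (E (?e k) y)
          = 2 * lam * (?n - 2) * bil J x y - 2 * lam * (?n - 2) * (x $ k * y $ k)" for k
          unfolding killing_E_E Be Be' Bs[of y x] unfolding eps by (simp add: algebra_simps)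
        show ?thesis
          unfolding t sum_subtractf sum_distrib_left[symmetric] Bsum \<mu>_def
          by (simp add: algebra_simps)
      qed
      have "(\<Sum>k\<in>UNIV. rel (E x (?e k)) (E (?e k) y))
        = (\<Sum>k\<in>UNIV. ?a x (?e k) \<otimes>\<^sub>t ?a (?e k) y)
          - tscale (1/2) (tvec (\<Sum>k\<in>UNIV. bracket (E x (?e k)) (E (?e k) y)))
          - tscale (\<Sum>k\<in>UNIV. lam * killing (sp_algebra J) (E x (?e k)) (E (?e k) y)) tone"
        unfolding rel_def sum_subtractf tvec_sum tens.scale_sum_right tens.scale_sum_left ..
      then show ?thesis unfolding b k F_def tvec_linear by simp
    qed
    ultimately show ?thesis by simp
  qed
  \<comment> \<open>Multiply \<open>A x y z (?e k)\<close> by \<open>?a (?e k) w\<close> and sum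
    over \<open>k\<close>. By \<open>F\<close> the products become \<open>(?n - 2) / 2\<close> times
    the cyclic sum of products plus \<open>\<mu>\<close> times \<open>S\<close>, while the
    contraction of \<open>S\<close> is the cyclic sum itself. Replacing the cyclic sum by
    \<open>S\<close> through \<open>A\<close> gives the factor
    \<open>\<mu> + (?n - 2) / 2 - 1\<close>.\<close>
  have S: "S x y z w \<in> II" for x y z w
  proof -
    have sum: "(\<Sum>k\<in>UNIV. S x y z (?e k) \<otimes>\<^sub>t ?a (?e k) w)
      = ?a y z \<otimes>\<^sub>t ?a x w + ?a z x \<otimes>\<^sub>t ?a y w + ?a x y \<otimes>\<^sub>t ?a z w"
    proof -
      have t: "S x y z (?e k) \<otimes>\<^sub>t ?a (?e k) w = ?a y z \<otimes>\<^sub>t ?a (x $ k *s ?e k) w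
         + ?a z x \<otimes>\<^sub>t ?a (y $ k *s ?e k) w + ?a x y \<otimes>\<^sub>t ?a (z $ k *s ?e k) w" for k
        unfolding S_def Be' E_linear tvec_linear tmult_linear ..
      show ?thesis
        unfolding t sum.distrib tmult_sum(2)[symmetric] tvec_sum[symmetric] E_sum(2)[symmetric] expand ..
    qed
    have "(\<Sum>k\<in>UNIV. A x y z (?e k) \<otimes>\<^sub>t ?a (?e k) w) \<in> II"
      by (intro II_sum II_mult A E_in)
    moreover have "(\<Sum>k\<in>UNIV. A x y z (?e k) \<otimes>\<^sub>t ?a (?e k) w)
       = ?a x y \<otimes>\<^sub>t (\<Sum>k\<in>UNIV. ?a z (?e k) \<otimes>\<^sub>t ?a (?e k) w)
       + ?a y z \<otimes>\<^sub>t (\<Sum>k\<in>UNIV. ?a x (?e k) \<otimes>\<^sub>t ?a (?e k) w)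
       + ?a z x \<otimes>\<^sub>t (\<Sum>k\<in>UNIV. ?a y (?e k) \<otimes>\<^sub>t ?a (?e k) w)
       - (?a y z \<otimes>\<^sub>t ?a x w + ?a z x \<otimes>\<^sub>t ?a y w + ?a x y \<otimes>\<^sub>t ?a z w)"
      unfolding A_def tmult_diff tmult_linear tmult_assoc sum_subtractf sum.distrib sum tmult_sum ..
    ultimately have 1: "?a x y \<otimes>\<^sub>t (\<Sum>k\<in>UNIV. ?a z (?e k) \<otimes>\<^sub>t ?a (?e k) w)
       + ?a y z \<otimes>\<^sub>t (\<Sum>k\<in>UNIV. ?a x (?e k) \<otimes>\<^sub>t ?a (?e k) w)
       + ?a z x \<otimes>\<^sub>t (\<Sum>k\<in>UNIV. ?a y (?e k) \<otimes>\<^sub>t ?a (?e k) w)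
       - (?a y z \<otimes>\<^sub>t ?a x w + ?a z x \<otimes>\<^sub>t ?a y w + ?a x y \<otimes>\<^sub>t ?a z w) \<in> II" (is "?L \<in> II")
      by simp
    have "?L - ?a x y \<otimes>\<^sub>t F z w - ?a y z \<otimes>\<^sub>t F x w - ?a z x \<otimes>\<^sub>t F y w
       - tscale ((?n - 2) / 2 - 1) (A x y z w) \<in> II"
      by (intro II_diff II_scale II_mult 1 F A E_in)
    also have "?L - ?a x y \<otimes>\<^sub>t F z w - ?a y z \<otimes>\<^sub>t F x w - ?a z x \<otimes>\<^sub>t F y w
       - tscale ((?n - 2) / 2 - 1) (A x y z w) = tscale (\<mu> + (?n - 4) / 2) (S x y z w)"
      unfolding F_def A_def S_def tmult_diff tmult_linear tmult_tone
      by (rule ext) (simp add: tscale_def algebra_simps diff_divide_distrib)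
    finally show ?thesis
      by (rule scaled_in_ideal[OF ideal_subspace[OF ideal_II]]) (use lam in \<open>simp add: \<mu>_def\<close>)
  qed
  have off: "?a (?e i) (?e j) \<in> II" for i j
  proof (cases "i = j")
    case True
    then show ?thesis using tens.subspace_0[OF ideal_subspace[OF ideal_II]]
      by (simp add: Exx tvec_linear)
  next
    case False
    obtain k where k: "k \<noteq> i" "k \<noteq> j" by (rule third_index[OF card])
    \<comment> \<open>With the first and last arguments equal to a third axis, only one term of
      \<open>S\<close> survives.\<close>
    have "S (?e k) (?e i) (?e j) (?e k) = ?a (?e i) (?e j)"
      unfolding S_def Be' using k by (simp add: axis_def)
    then show ?thesis using S[of "?e k" "?e i" "?e j" "?e k"] by simp
  qed
  show ?thesis
  proof (rule ideal_of_E[OF _ X])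
    fix x y
    have lin: "Vector_Spaces.linear (*s) tscale (\<lambda>x. ?a x y)" "Vector_Spaces.linear (*s) tscale (\<lambda>y. ?a x y)" for x y
      by (rule linear_tensorI; simp only: E_linear tvec_linear)+
    have Q: "invertible (mat 1 :: complex^'m^'m)"
      unfolding invertible_def by (rule exI[of _ "mat 1"]) simp
    have col: "column i (mat 1) = ?e i" for i by (simp add: column_def mat_def axis_def vec_eq_iff)
    have "?a (?e i) y \<in> II" for i y
      by (rule columns_induct[where f = "\<lambda>y. ?a (?e i) y", OF Q ideal_subspace[OF ideal_II] lin(2)])
        (simp only: col off)
    then show "?a x y \<in> II"
      by - (rule columns_induct[where f = "\<lambda>x. ?a x y", OF Q ideal_subspace[OF ideal_II] lin(1)],
        simp only: col)
  qed
qed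

lemma symmetric_conclusion:
  assumes J1: "J = mat 1" and eps: "eps = 1"
    and P0: "\<And>x y z w. P (\<chi>3 x y z w) = 0" "\<And>x y. P (\<omega> x y) = 0"
    and card: "CARD('m) \<ge> 3"
    and lam: "2 * (of_nat CARD('m) - 1) * (of_nat CARD('m) - 2) * lam + (of_nat CARD('m) - 4) / 2 \<noteq> 0"
  shows "ideal_alternative (sp_algebra J) P lam"
proof -
  obtain i j :: 'm where ij: "i \<noteq> j" by (rule third_index[OF card])
  have B: "bil J (axis k 1) x = x $ k" for k x by (simp add: bil_axis J1)
  have "of_nat CARD('m) \<noteq> (of_nat 2 :: complex)" using card by (subst of_nat_eq_iff) simp
  then have "of_nat CARD('m) - 2 \<noteq> (0 :: complex)" by simp
  moreover have "killing (sp_algebra J) (E (axis i 1) (axis j 1)) (E (axis i 1) (axis j 1))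
      = - 2 * (of_nat CARD('m) - 2)"
    unfolding killing_E_E B unfolding eps using ij by (simp add: axis_def algebra_simps)
  ultimately have k: "killing (sp_algebra J) (E (axis i 1) (axis j 1)) (E (axis i 1) (axis j 1)) \<noteq> 0"
    by (simp only: mult_eq_0_iff) simp
  show ?thesis
    by (rule conclusion[OF symmetric_in_ideal[OF assms] E_in E_in k])
qed

end

section \<open>The three cases assembled\<close>

theorem theorem5p5:
  fixes g h :: "(complex^'m^'m) set" and H0 :: "complex^'m^'m"
    and P :: "'m tensor \<Rightarrow> 'm tensor" and lam :: complex and n :: nat
  assumes cases:
    "(n \<ge> 5 \<and> CARD('m) = n \<and> g = so_algebra \<and>
        lam \<noteq> - ((of_nat n - 4) / (4 * (of_nat n - 1) * (of_nat n - 2)))) \<or>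
     (n \<ge> 2 \<and> CARD('m) = 2 * n \<and> (\<exists>J. nondegenerate_skew J \<and> g = sp_algebra J) \<and>
        lam \<noteq> - (1 / (16 * (of_nat n + 1)))) \<or>
     (n \<ge> 3 \<and> CARD('m) = n \<and> g = sl_algebra \<and>
        lam \<noteq> - (1 / (8 * (of_nat n + 1))))"
    and cartan: "cartan_subalgebra g h" "positivity g h H0"
    and proj: "cartan_projection g h H0 P"
  shows "(lam \<noteq> 0 \<longrightarrow> I_bar g P lam = carrier (env_algebra g)) \<and>
    (lam = 0 \<longrightarrow> I_bar g P lam = env_plus g \<and>
       maximalideal (env_plus g) (env_algebra g) \<and>
       (\<forall>M. maximalideal M (env_algebra g) \<and> M \<subseteq> env_plus g \<longrightarrow> M = env_plus g))"
proof -
  obtain C u v \<theta> where cp: "cartan_proj g H0 P C u (2 * \<theta>)"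
    and v: "v \<in> g" "v \<noteq> 0" "bracket H0 v = cmat_scale \<theta> v"
    and pos: "\<And>X c. X \<in> g \<Longrightarrow> bracket H0 X = cmat_scale c X \<Longrightarrow> Re c > 0 \<Longrightarrow> bracket X v = 0"
    by (rule cartan_data[OF cartan proj]) (rule that)
  interpret cartan_proj g H0 P C u "2 * \<theta>" by (rule cp)
  note comm = regular_commute[OF cartan] and realv = regular_eigenvalue_real[OF cartan]
    and ss = cartan_ad_diagonalizable[OF cartan] and sub = cartan_subspace[OF cartan(1)]
  consider (so) "n \<ge> 5" "CARD('m) = n" "g = so_algebra"
      "lam \<noteq> - ((of_nat n - 4) / (4 * (of_nat n - 1) * (of_nat n - 2)))"
    | (sp) J where "n \<ge> 2" "CARD('m) = 2 * n" "nondegenerate_skew J" "g = sp_algebra J"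
      "lam \<noteq> - (1 / (16 * (of_nat n + 1)))"
    | (sl) "n \<ge> 3" "CARD('m) = n" "g = sl_algebra" "lam \<noteq> - (1 / (8 * (of_nat n + 1)))"
    using cases by blast
  then show ?thesis
  proof cases
    case so
    define J :: "complex^'m^'m" where "J = mat 1"
    have g: "g = sp_algebra J" by (simp add: so(3) so_algebra_eq J_def)
    have ef: "eps_form J 1"
      unfolding J_def by unfold_locales (auto simp: invertible_def intro!: exI[of _ "mat 1"])
    interpret eps_form J 1 by (rule ef)
    have fc: "form_cartan J 1 H0 v \<theta>"
      using Hg v pos comm realv ss unfolding g by unfold_locales
    have card: "CARD('m) \<ge> 5" using so by simp
    obtain Q :: "complex^'m^'m" and e where Q: "invertible Q" "\<And>i. H0 *v column i Q = e i *s column i Q"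
      by (rule eigenbasis[OF ad_semisimple_diagonalizable[OF ss[unfolded g]]]) (use card that in auto)
    interpret fb: form_cartan_basis J 1 H0 v \<theta> Q e
      by (intro form_cartan_basis.intro fc form_cartan_basis_axioms.intro Q)
    obtain t s where ts: "Re (e s) < Re (e t)" "0 < Re (e s)"
      "\<And>i. i \<noteq> t \<Longrightarrow> i \<noteq> s \<Longrightarrow> Re (e i) < Re (e s)" "\<theta> = e t + e s"
      by (rule fb.symmetric_highest_weight[OF refl card]) (rule that)
    interpret fi: form_ideal J 1 H0 P C u "2 * \<theta>" lam
      by (intro form_ideal.intro ef cartan_ideal.intro cartan_ideal_axioms.intro
          cp[unfolded g] subspace_sp_algebra bracket_sp_algebra)
    have P0: "P (fi.\<chi>3 x y z w) = 0" "P (fi.\<omega> x y) = 0" for x y z w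
      using ts(4) by (intro fi.P_\<chi>3_\<omega>[OF J_def refl Q ts(1-3)]; simp)+
    have lam': "2 * (of_nat CARD('m) - 1) * (of_nat CARD('m) - 2) * lam + (of_nat CARD('m) - 4) / 2 \<noteq> 0"
    proof
      assume a: "2 * (of_nat CARD('m) - 1) * (of_nat CARD('m) - 2) * lam + (of_nat CARD('m) - 4) / 2 = 0"
      have nz: "of_nat n - 1 \<noteq> (0 :: complex)" "of_nat n - 2 \<noteq> (0 :: complex)"
        using so(1) of_nat_eq_iff[of n 1, where ?'a = complex] of_nat_eq_iff[of n 2, where ?'a = complex] by auto
      let ?D = "4 * (of_nat n - 1) * (of_nat n - 2) :: complex"
      have "lam * ?D = 2 * (2 * (of_nat n - 1) * (of_nat n - 2) * lam + (of_nat n - 4) / 2) - (of_nat n - 4)"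
        by (simp add: algebra_simps diff_divide_distrib)
      also have "\<dots> = - (of_nat n - 4)" unfolding a[unfolded so(2)] by simp
      finally have "lam = - (of_nat n - 4) / ?D" using nz by (intro eq_divide_imp) (simp_all only: mult_eq_0_iff, simp)
      then show False using so(4) by (simp only: minus_divide_left not_False_eq_True)
    qed
    show ?thesis unfolding g ideal_alternative_def[symmetric]
      by (rule fi.symmetric_conclusion[OF J_def refl P0 _ lam']) (use card in simp)
  next
    case (sp J)
    have g: "g = sp_algebra J" by (rule sp(4))
    have ef: "eps_form J (-1)"
      using sp(3) by unfold_locales (auto simp: nondegenerate_skew_def vec_eq_iff)
    interpret eps_form J "-1" by (rule ef)
    have fc: "form_cartan J (-1) H0 v \<theta>"
      using Hg v pos comm realv ss unfolding g by unfold_locales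
    have card: "CARD('m) \<ge> 3" using sp by simp
    obtain Q :: "complex^'m^'m" and e where Q: "invertible Q" "\<And>i. H0 *v column i Q = e i *s column i Q"
      by (rule eigenbasis[OF ad_semisimple_diagonalizable[OF ss[unfolded g]]]) (use that in auto)
    interpret fb: form_cartan_basis J "-1" H0 v \<theta> Q e
      by (intro form_cartan_basis.intro fc form_cartan_basis_axioms.intro Q)
    obtain t where t: "\<And>i. i \<noteq> t \<Longrightarrow> Re (e i) < Re (e t)" "\<theta> = 2 * e t"
      by (rule fb.skew_highest_weight[OF refl]) (rule that)
    interpret fi: form_ideal J "-1" H0 P C u "2 * \<theta>" lam
      by (intro form_ideal.intro ef cartan_ideal.intro cartan_ideal_axioms.intro
          cp[unfolded g] subspace_sp_algebra bracket_sp_algebra)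
    have P0: "P (fi.\<psi> x y z w) = 0" for x y z w
      using t(2) by (intro fi.P_\<psi>[OF Q t(1)]; simp)
    \<comment> \<open>Here \<open>CARD('m) = 2 * n\<close>, so the coefficient of \<open>lam\<close>
      is \<open>4 * (n + 1)\<close> and the excluded value becomes
      \<open>- 1 / (16 * (n + 1))\<close>.\<close>
    have lam': "2 * (of_nat CARD('m) + 2) * lam \<noteq> - (1/4)"
    proof
      assume a: "2 * (of_nat CARD('m) + 2) * lam = - (1/4)"
      have nz: "of_nat n + 1 \<noteq> (0 :: complex)" using of_nat_neq_0[of n, where ?'a = complex] by (simp add: add.commute)
      let ?D = "16 * (of_nat n + 1) :: complex"
      have "lam * ?D = 4 * (2 * (of_nat (2 * n) + 2) * lam)" by (simp add: algebra_simps)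
      also have "\<dots> = - 1" unfolding a[unfolded sp(2)] by simp
      finally have "lam = - 1 / ?D" using nz by (intro eq_divide_imp) (simp_all only: mult_eq_0_iff, simp)
      then show False using sp(5) by (simp only: minus_divide_left not_False_eq_True)
    qed
    show ?thesis unfolding g ideal_alternative_def[symmetric]
      by (rule fi.skew_conclusion[OF refl P0 card lam'])
  next
    case sl
    have card: "CARD('m) \<ge> 3" using sl by simp
    then have card2: "CARD('m) \<ge> 2" by simp
    obtain Q R :: "complex^'m^'m" and e t b where Q: "invertible Q" "invertible R"
      "\<And>i. H0 *v column i Q = e i *s column i Q" "\<And>i. column i R v* H0 = e i *s column i R"
      "\<And>i. i \<noteq> t \<Longrightarrow> Re (e i) < Re (e t)" "\<And>i. i \<noteq> b \<Longrightarrow> Re (e b) < Re (e i)" "\<theta> = e t - e b"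
      by (rule sl_highest_weight[OF card2 comm[unfolded sl(3)] realv[unfolded sl(3)] pos[unfolded sl(3)]
            v[unfolded sl(3)] ss[unfolded sl(3)]]) (assumption | rule that)+
    have P0: "P (\<phi>1 x z f k) = 0" "P (\<phi>2 x z f k) = 0" for x z f k
      by (rule P_\<phi>[OF sl(3) Q(1,3,2,4-6)]; simp add: Q(7))+
    interpret ci: cartan_ideal g H0 P C u "2 * \<theta>" lam
      by (intro cartan_ideal.intro cartan_ideal_axioms.intro cp sub) (simp add: sl(3) bracket_sl)
    have lam': "2 * (of_nat CARD('m) + 1) * lam \<noteq> - (1/4)"
    proof
      assume a: "2 * (of_nat CARD('m) + 1) * lam = - (1/4)"
      have nz: "of_nat n + 1 \<noteq> (0 :: complex)" using of_nat_neq_0[of n, where ?'a = complex] by (simp add: add.commute)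
      let ?D = "8 * (of_nat n + 1) :: complex"
      have "lam * ?D = 4 * (2 * (of_nat n + 1) * lam)" by (simp add: algebra_simps)
      also have "\<dots> = - 1" unfolding a[unfolded sl(2)] by simp
      finally have "lam = - 1 / ?D" using nz by (intro eq_divide_imp) (simp_all only: mult_eq_0_iff, simp)
      then show False using sl(4) by (simp only: minus_divide_left not_False_eq_True)
    qed
    show ?thesis unfolding ideal_alternative_def[symmetric]
      by (rule ci.sl_conclusion[OF sl(3) P0 card lam'])
  qed
qed

end
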